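(* Let $n\geq 2$ and let $g$ be a complete $U(n)$-invariant Kähler metric on $\mathbb C^n$ with nonnegative holomorphic bisectional curvature. Then: 1. There is a constant $\kappa>0$ such that $$g\geq\frac{\kappa}{1+|z|^2}\,g_{\mathrm{Eucl}} .$$ 2. The strictly plurisubharmonic exhaustion $\rho=\log(1+|z|^2)$ has bounded $g$-gradient. 3. For $q=n+2$, the weighted space $$\mathcal H_q=\left\{F\in\mathcal O(\mathbb C^n): F(0)=0,\ \int_{\mathbb C^n}|F|^2(1+|z|^2)^{-q}\,dV_g<\infty\right\}$$ is a finite direct sum $\bigoplus_{d=1}^{d_*}\mathcal P_d$ for some integer $d_*$ with $1\leq d_*\leq q-1$, where $\mathcal P_d$ is the space of all homogeneous holomorphic polynomials of degree $d$ on $\mathbb C^n$. 4. The diagonal kernel of $\mathcal H_q$ has the form $$K_q(z)=K(|z|^2),\qquad K(s)=\sum_{d=1}^{d_*}c_d s^d,\qquad c_d>0 \text{ for each } 1\le d\le d_* .$$ 5. The function $q^{-1}\log(1+K_q)$ is a smooth strictly plurisubharmonic exhaustion of $\mathbb C^n$. 6. There exist radii $0<R_1<R_2<\cdots\to\infty$ such that, with $A_j=\{z\in\mathbb C^n: R_j\leq d_g(0,z)\leq R_{j+1}\}$, $$\frac1q\log(1+K_q(z))\geq j\qquad\text{for all } j\ge 1 \text{ and } z\in A_j,$$ and there is a constant $C_0<\infty$, independent of $z$ and $j$, such that $$\mathcal D_q(z)\leq C_0\,q^2\,(1+K_q(z))\qquad\text{for all } z\in\mathbb C^n .$$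
   Context: $\mathbb C^n$ carries its standard complex structure and the standard linear action of $U(n)$; $g_{\mathrm{Eucl}}$ is the Euclidean metric and $|z|$ the Euclidean norm; $\mathcal O(\mathbb C^n)$ is the space of entire functions. No upper curvature bound is assumed. Nonnegative holomorphic bisectional curvature means $R(Z,\bar Z,W,\bar W)\ge 0$ for all $(1,0)$-vectors $Z,W$ at every point. Metric conventions: in holomorphic coordinates, $g=\operatorname{Re}\big(\sum_{\alpha,\beta}g_{\alpha\bar\beta}\,dz_\alpha\otimes d\bar z_\beta\big)$. $d_g$, $dV_g$, $\nabla$ denote the distance, the volume measure and the $g$-gradient (of functions) of $g$. For a real function $v$, $|\nabla v|_g^2=4\sum_{\alpha,\beta}g^{\alpha\bar\beta}v_\alpha v_{\bar\beta}$; for a complex-valued function $F$, $|\nabla F|_g^2=|\nabla\operatorname{Re}F|_g^2+|\nabla\operatorname{Im}F|_g^2$. An exhaustion is a real function all of whose sublevel sets $\{\cdot\le a\}$ are compact. The space $\mathcal H_q$ has the inner product $\langle F,G\rangle=\int_{\mathbb C^n}F\bar G\,(1+|z|^2)^{-q}\,dV_g$. For an orthonormal basis $s_1,\ldots,s_N$ of $\mathcal H_q$, the diagonal kernel and the derivative sum are $$K_q(z)=\sum_{\nu=1}^N|s_\nu(z)|^2,\qquad \mathcal D_q(z)=\sum_{\nu=1}^N|\nabla s_\nu(z)|_g^2,$$ both independent of the choice of orthonormal basis. *)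

theory Defs
  imports "HOL-Analysis.Analysis"
begin

text \<open>
  \<open>\<complex>\<^sup>n\<close> is the type \<open>complex ^ 'n\<close>; \<open>norm\<close> is its Euclidean norm and \<open>c *s v\<close> its complex
  scalar multiplication. Frechet derivatives are real derivatives.
\<close>

definition dir_deriv ::
  "('a::real_normed_vector \<Rightarrow> 'b::real_normed_vector) \<Rightarrow> 'a \<Rightarrow> 'a \<Rightarrow> 'b"
  where "dir_deriv f v z = frechet_derivative f (at z) v"

primrec C_class :: "nat \<Rightarrow> ('a::real_normed_vector \<Rightarrow> 'b::real_normed_vector) \<Rightarrow> bool" where
  "C_class 0 f \<longleftrightarrow> continuous_on UNIV f"
| "C_class (Suc k) f \<longleftrightarrow> (\<forall>z. f differentiable (at z)) \<and> (\<forall>v. C_class k (dir_deriv f v))"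

definition smooth :: "('a::real_normed_vector \<Rightarrow> 'b::real_normed_vector) \<Rightarrow> bool"
  where "smooth f \<longleftrightarrow> (\<forall>k. C_class k f)"

definition wirt :: "'n \<Rightarrow> (complex ^ 'n::finite \<Rightarrow> complex) \<Rightarrow> complex ^ 'n \<Rightarrow> complex"
  where "wirt \<alpha> f z = (dir_deriv f (axis \<alpha> 1) z - \<i> * dir_deriv f (axis \<alpha> \<i>) z) / 2"

definition wirt_bar :: "'n \<Rightarrow> (complex ^ 'n::finite \<Rightarrow> complex) \<Rightarrow> complex ^ 'n \<Rightarrow> complex"
  where "wirt_bar \<alpha> f z = (dir_deriv f (axis \<alpha> 1) z + \<i> * dir_deriv f (axis \<alpha> \<i>) z) / 2"

definition entire :: "(complex ^ 'n::finite \<Rightarrow> complex) \<Rightarrow> bool"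
  where "entire F \<longleftrightarrow>
    (\<forall>z. \<exists>L. (F has_derivative L) (at z) \<and> (\<forall>c v. L (c *s v) = c * L v))"

definition levi_form :: "(complex ^ 'n::finite \<Rightarrow> real) \<Rightarrow> complex ^ 'n \<Rightarrow> complex ^ 'n \<Rightarrow> complex"
  where "levi_form f z Z =
    (\<Sum>\<alpha>\<in>UNIV. \<Sum>\<beta>\<in>UNIV.
      wirt \<alpha> (wirt_bar \<beta> (\<lambda>w. complex_of_real (f w))) z * Z $ \<alpha> * cnj (Z $ \<beta>))"

definition strictly_psh :: "(complex ^ 'n::finite \<Rightarrow> real) \<Rightarrow> bool"
  where "strictly_psh f \<longleftrightarrow> C_class 2 f \<and> (\<forall>z Z. Z \<noteq> 0 \<longrightarrow> Re (levi_form f z Z) > 0)"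

definition exhaustion :: "(complex ^ 'n::finite \<Rightarrow> real) \<Rightarrow> bool"
  where "exhaustion f \<longleftrightarrow> (\<forall>a. compact {z. f z \<le> a})"

text \<open>
  A Hermitian metric is given by its coefficients \<open>g z $ \<alpha> $ \<beta>\<close>, the value of
  \<open>g\<^sub>\<alpha>\<^sub>\<beta>\<close> (second index barred) at \<open>z\<close>. The associated Riemannian metric
  on the real tangent space \<open>\<complex>\<^sup>n\<close> is the real part of the Hermitian form.
\<close>

type_synonym 'n metric = "complex ^ 'n \<Rightarrow> complex ^ 'n ^ 'n"

definition riem :: "'n::finite metric \<Rightarrow> complex ^ 'n \<Rightarrow> complex ^ 'n \<Rightarrow> complex ^ 'n \<Rightarrow> real"
  where "riem g z v w = Re (\<Sum>\<alpha>\<in>UNIV. \<Sum>\<beta>\<in>UNIV. g z $ \<alpha> $ \<beta> * v $ \<alpha> * cnj (w $ \<beta>))"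

definition hermitian_metric :: "'n::finite metric \<Rightarrow> bool"
  where "hermitian_metric g \<longleftrightarrow>
    (\<forall>\<alpha> \<beta>. smooth (\<lambda>z. g z $ \<alpha> $ \<beta>)) \<and>
    (\<forall>z \<alpha> \<beta>. g z $ \<beta> $ \<alpha> = cnj (g z $ \<alpha> $ \<beta>)) \<and>
    (\<forall>z v. v \<noteq> 0 \<longrightarrow> riem g z v v > 0)"

definition kaehler_form ::
  "'n::finite metric \<Rightarrow> complex ^ 'n \<Rightarrow> complex ^ 'n \<Rightarrow> complex ^ 'n \<Rightarrow> real"
  where "kaehler_form g z v w = riem g z (\<i> *s v) w"

text \<open>
  The last condition is \<open>d\<omega> = 0\<close>: for constant vector fields \<open>u, v, w\<close> all brackets in the
  formula for \<open>d\<omega>(u, v, w)\<close> vanish.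
\<close>

definition kaehler_metric :: "'n::finite metric \<Rightarrow> bool"
  where "kaehler_metric g \<longleftrightarrow> hermitian_metric g \<and>
    (\<forall>z u v w.
      dir_deriv (\<lambda>p. kaehler_form g p v w) u z +
      dir_deriv (\<lambda>p. kaehler_form g p w u) v z +
      dir_deriv (\<lambda>p. kaehler_form g p u v) w z = 0)"

definition unitary_matrix :: "complex ^ 'n::finite ^ 'n \<Rightarrow> bool"
  where "unitary_matrix U \<longleftrightarrow> U ** (\<chi> i j. cnj (U $ j $ i)) = mat 1"

definition unitary_invariant :: "'n::finite metric \<Rightarrow> bool"
  where "unitary_invariant g \<longleftrightarrow>
    (\<forall>U z v w. unitary_matrix U \<longrightarrow> riem g (U *v z) (U *v v) (U *v w) = riem g z v w)"

text \<open>
  \<open>valid_path\<close> does not bound the derivative at the finitely many exceptional parameters, so a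
  path may have infinite length; \<open>has_integral\<close> admits only paths of finite length.
\<close>

definition gdist :: "'n::finite metric \<Rightarrow> complex ^ 'n \<Rightarrow> complex ^ 'n \<Rightarrow> real"
  where "gdist g x y = Inf {L. \<exists>\<gamma>. valid_path \<gamma> \<and> pathstart \<gamma> = x \<and> pathfinish \<gamma> = y \<and>
    ((\<lambda>t. sqrt (riem g (\<gamma> t) (vector_derivative \<gamma> (at t)) (vector_derivative \<gamma> (at t))))
      has_integral L) {0..1}}"

definition complete_metric :: "'n::finite metric \<Rightarrow> bool"
  where "complete_metric g \<longleftrightarrow>
    (\<forall>\<sigma> :: nat \<Rightarrow> complex ^ 'n.
      (\<forall>\<epsilon>>0. \<exists>N. \<forall>m\<ge>N. \<forall>k\<ge>N. gdist g (\<sigma> m) (\<sigma> k) < \<epsilon>) \<longrightarrow>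
      (\<exists>x. (\<lambda>k. gdist g (\<sigma> k) x) \<longlonglongrightarrow> 0))"

text \<open>
  The Riemannian volume measure: the density with respect to Lebesgue measure is the square root
  of the Gram determinant in the real coordinate frame
  \<open>\<partial>/\<partial>x\<^sub>\<alpha>\<close> (\<open>Inl \<alpha>\<close>), \<open>\<partial>/\<partial>y\<^sub>\<alpha>\<close> (\<open>Inr \<alpha>\<close>).
\<close>

definition real_frame :: "'n + 'n \<Rightarrow> complex ^ 'n::finite"
  where "real_frame a = (case a of Inl \<alpha> \<Rightarrow> axis \<alpha> 1 | Inr \<alpha> \<Rightarrow> axis \<alpha> \<i>)"

definition gram :: "'n::finite metric \<Rightarrow> complex ^ 'n \<Rightarrow> real ^ ('n + 'n) ^ ('n + 'n)"
  where "gram g z = (\<chi> a b. riem g z (real_frame a) (real_frame b))"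

definition riem_vol :: "'n::finite metric \<Rightarrow> (complex ^ 'n) measure"
  where "riem_vol g = density lborel (\<lambda>z. ennreal (sqrt (det (gram g z))))"

text \<open>
  \<open>ginv g z \<alpha> \<beta>\<close> is the coefficient with upper indices \<open>\<alpha>\<close> and barred \<open>\<beta>\<close>. It satisfies
  \<open>\<Sum>\<^sub>\<beta> ginv g z \<alpha> \<beta> * g z $ \<gamma> $ \<beta> = \<delta>\<^sub>\<alpha>\<^sub>\<gamma>\<close>, which forces the transpose of the inverse matrix.
\<close>

definition ginv :: "'n::finite metric \<Rightarrow> complex ^ 'n \<Rightarrow> 'n \<Rightarrow> 'n \<Rightarrow> complex"
  where "ginv g z \<alpha> \<beta> = matrix_inv (g z) $ \<beta> $ \<alpha>"

definition grad_sq :: "'n::finite metric \<Rightarrow> (complex ^ 'n \<Rightarrow> real) \<Rightarrow> complex ^ 'n \<Rightarrow> real"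
  where "grad_sq g v z = 4 * Re (\<Sum>\<alpha>\<in>UNIV. \<Sum>\<beta>\<in>UNIV. ginv g z \<alpha> \<beta> *
    wirt \<alpha> (\<lambda>w. complex_of_real (v w)) z * wirt_bar \<beta> (\<lambda>w. complex_of_real (v w)) z)"

definition cgrad_sq :: "'n::finite metric \<Rightarrow> (complex ^ 'n \<Rightarrow> complex) \<Rightarrow> complex ^ 'n \<Rightarrow> real"
  where "cgrad_sq g F z = grad_sq g (\<lambda>w. Re (F w)) z + grad_sq g (\<lambda>w. Im (F w)) z"

text \<open>
  The second and fourth indices of \<open>curv\<close> are the barred ones. The sign is the one for which the
  Fubini-Study metric has positive bisectional curvature.
\<close>

definition curv :: "'n::finite metric \<Rightarrow> complex ^ 'n \<Rightarrow> 'n \<Rightarrow> 'n \<Rightarrow> 'n \<Rightarrow> 'n \<Rightarrow> complex"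
  where "curv g z \<alpha> \<beta> \<gamma> \<delta> =
    - wirt \<gamma> (wirt_bar \<delta> (\<lambda>p. g p $ \<alpha> $ \<beta>)) z +
    (\<Sum>\<mu>\<in>UNIV. \<Sum>\<nu>\<in>UNIV. ginv g z \<mu> \<nu> *
      wirt \<gamma> (\<lambda>p. g p $ \<alpha> $ \<nu>) z * wirt_bar \<delta> (\<lambda>p. g p $ \<mu> $ \<beta>) z)"

definition bisectional ::
  "'n::finite metric \<Rightarrow> complex ^ 'n \<Rightarrow> complex ^ 'n \<Rightarrow> complex ^ 'n \<Rightarrow> complex"
  where "bisectional g z Z W =
    (\<Sum>\<alpha>\<in>UNIV. \<Sum>\<beta>\<in>UNIV. \<Sum>\<gamma>\<in>UNIV. \<Sum>\<delta>\<in>UNIV.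
      curv g z \<alpha> \<beta> \<gamma> \<delta> * Z $ \<alpha> * cnj (Z $ \<beta>) * W $ \<gamma> * cnj (W $ \<delta>))"

definition nonneg_bisectional :: "'n::finite metric \<Rightarrow> bool"
  where "nonneg_bisectional g \<longleftrightarrow> (\<forall>z Z W. Re (bisectional g z Z W) \<ge> 0)"

definition hom_poly :: "nat \<Rightarrow> (complex ^ 'n::finite \<Rightarrow> complex) set"
  where "hom_poly d =
    {F. \<exists>c :: ('n \<Rightarrow> nat) \<Rightarrow> complex.
      F = (\<lambda>z. \<Sum>m | sum m UNIV = d. c m * (\<Prod>i\<in>UNIV. (z $ i) ^ m i))}"

definition weighted_space :: "'n::finite metric \<Rightarrow> nat \<Rightarrow> (complex ^ 'n \<Rightarrow> complex) set"
  where "weighted_space g q = {F. entire F \<and> F 0 = 0 \<and>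
    (\<integral>\<^sup>+z. ennreal ((cmod (F z))\<^sup>2 / (1 + (norm z)\<^sup>2) ^ q) \<partial>riem_vol g) < \<infinity>}"

definition weighted_inner ::
  "'n::finite metric \<Rightarrow> nat \<Rightarrow> (complex ^ 'n \<Rightarrow> complex) \<Rightarrow> (complex ^ 'n \<Rightarrow> complex) \<Rightarrow> complex"
  where "weighted_inner g q F G =
    (\<integral>z. F z * cnj (G z) / complex_of_real ((1 + (norm z)\<^sup>2) ^ q) \<partial>riem_vol g)"

text \<open>
  Internal direct sum of spaces of complex-valued functions: the sum of the \<open>P d\<close> is \<open>H\<close> and the
  decomposition of each element of \<open>H\<close> is unique.
\<close>

definition is_direct_sum :: "('a \<Rightarrow> complex) set \<Rightarrow> 'i set \<Rightarrow> ('i \<Rightarrow> ('a \<Rightarrow> complex) set) \<Rightarrow> bool"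
  where "is_direct_sum H I P \<longleftrightarrow>
    (\<forall>p \<in> PiE I P. (\<lambda>z. \<Sum>d\<in>I. p d z) \<in> H) \<and>
    (\<forall>F \<in> H. \<exists>!p. p \<in> PiE I P \<and> F = (\<lambda>z. \<Sum>d\<in>I. p d z))"

definition onb ::
  "'n::finite metric \<Rightarrow> nat \<Rightarrow> nat \<Rightarrow> (nat \<Rightarrow> complex ^ 'n \<Rightarrow> complex) \<Rightarrow> bool"
  where "onb g q N s \<longleftrightarrow>
    (\<forall>i<N. s i \<in> weighted_space g q) \<and>
    (\<forall>i<N. \<forall>j<N. weighted_inner g q (s i) (s j) = (if i = j then 1 else 0)) \<and>
    (\<forall>F \<in> weighted_space g q. \<exists>c. F = (\<lambda>z. \<Sum>i<N. c i * s i z))"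

definition diag_kernel :: "nat \<Rightarrow> (nat \<Rightarrow> complex ^ 'n::finite \<Rightarrow> complex) \<Rightarrow> complex ^ 'n \<Rightarrow> real"
  where "diag_kernel N s z = (\<Sum>i<N. (cmod (s i z))\<^sup>2)"

definition deriv_sum ::
  "'n::finite metric \<Rightarrow> nat \<Rightarrow> (nat \<Rightarrow> complex ^ 'n \<Rightarrow> complex) \<Rightarrow> complex ^ 'n \<Rightarrow> real"
  where "deriv_sum g N s z = (\<Sum>i<N. cgrad_sq g (s i) z)"

text \<open>
  \<open>K\<close> and \<open>D\<close> are the diagonal kernel and the derivative sum of the weighted space: an orthonormal
  basis exists, and every orthonormal basis yields \<open>K\<close> and \<open>D\<close>. At most one pair \<open>K, D\<close> qualifies.
\<close>

definition kernel_data ::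
  "'n::finite metric \<Rightarrow> nat \<Rightarrow> (complex ^ 'n \<Rightarrow> real) \<Rightarrow> (complex ^ 'n \<Rightarrow> real) \<Rightarrow> bool"
  where "kernel_data g q K D \<longleftrightarrow>
    (\<exists>N s. onb g q N s) \<and>
    (\<forall>N s. onb g q N s \<longrightarrow> diag_kernel N s = K \<and> deriv_sum g N s = D)"

end

theory Submission
  imports Defs "HOL-Complex_Analysis.Cauchy_Integral_Formula"
begin

text \<open>
  On the axis spanned by \<open>E\<close>, unitary invariance makes \<open>g\<close> diagonal, with radial eigenvalue \<open>a x\<close>
  and tangential eigenvalue \<open>b x\<close> at \<open>x E\<close>. Closedness of the Kaehler form gives
  \<open>x b' = 2 (a - b)\<close>, and nonnegative curvature in the radial direction says that \<open>x a' / a\<close> is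
  nonincreasing. Hence \<open>a\<close> decreases and \<open>b\<close> lies between \<open>a\<close> and \<open>a 0\<close>. If \<open>x a' / a\<close> dropped
  below \<open>-2\<close>, radial rays would have finite length; so completeness makes \<open>x\<^sup>2 a\<close> nondecreasing and
  \<open>\<kappa> / (1 + |z|\<^sup>2) \<le> g \<le> a 0\<close>. Everything else follows from these two bounds and unitary invariance.

  By averaging over the circle, the homogeneous parts of an element of the weighted space belong to
  it again. Averaging over finitely many unitary maps, a nonzero homogeneous part of degree \<open>d\<close>
  makes \<open>|z|\<^sup>d\<close> square integrable, which holds for \<open>d = 1\<close> and fails for \<open>d \<ge> q\<close>. The diagonal
  kernel does not depend on the basis, so it is unitarily invariant, hence a polynomial in \<open>|z|\<^sup>2\<close>
  with positive coefficients. Strict plurisubharmonicity is then the Cauchy-Schwarz inequality for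
  these coefficients, and the derivative sum is bounded by Cauchy's estimate on discs of radius
  \<open>1 + |z|\<close>.
\<close>

section \<open>Iterated differentiability\<close>

text \<open>The threshold -2 is the borderline of radial length: for a = x^(-2) the integral of sqrt
  a diverges only logarithmically, and for faster power decay it converges. The same borderline
  governs the choice of q. The two metric bounds place the volume density between multiples of (1 +
  |z|^2)^(-n) and of 1, which is too coarse to determine the square integrable degrees. But with q =
  n + 2, degree 1 leaves at most a multiple of (1 + |z|^2)^(-n-1), which is integrable, while degree
  q leaves at least a multiple of |z|^(-2n) at infinity, which is not. Hence the top degree and the
  coefficients of the kernel stay implicit; what enters later is that the degrees form an interval
  starting at 1 and that the coefficients are positive. The derivative sum grows no faster than the
  kernel because the inverse metric costs a factor 1 + |z|^2, which is what Cauchy's estimate gains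
  on discs of radius 1 + |z|.\<close>

lemma dir_deriv_eqI: "(f has_derivative f') (at z) \<Longrightarrow> dir_deriv f v z = f' v"
  unfolding dir_deriv_def by (metis frechet_derivative_at)

lemma C_class_SucD: "C_class (Suc k) f \<Longrightarrow> C_class k f"
proof (induction k arbitrary: f)
  case 0
  then show ?case
    by (auto intro!: continuous_at_imp_continuous_on differentiable_imp_continuous_within)
next
  case (Suc k)
  have "C_class (Suc k) (dir_deriv f v)" for v
    using Suc.prems by (simp only: C_class.simps(2)[of "Suc k"])
  then have "C_class k (dir_deriv f v)" for v
    by (rule Suc.IH)
  then show ?case
    using Suc.prems by simp
qed

text \<open>\<open>dir_deriv\<close> is defined through a choice operator; this rule lets an
  explicit derivative stand in for it, so that each closure property below is the induction step of
  the matching differentiation rule.\<close>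

lemma C_class_SucI:
  assumes "\<And>z. (f has_derivative f' z) (at z)" and "\<And>v. C_class k (\<lambda>z. f' z v)"
  shows "C_class (Suc k) f"
proof -
  have "dir_deriv f v = (\<lambda>z. f' z v)" for v
    using dir_deriv_eqI[OF assms(1)] by auto
  then show ?thesis
    using assms unfolding C_class.simps differentiable_def by metis
qed

lemma C_class_has_derivative:
  assumes "C_class (Suc k) f"
  shows "(f has_derivative (\<lambda>v. dir_deriv f v z)) (at z)"
  using assms unfolding dir_deriv_def
  by (auto simp: frechet_derivative_works)

lemma C_class_const: "C_class k (\<lambda>z. c)"
proof (induction k arbitrary: c)
  case (Suc k)
  show ?case by (rule C_class_SucI[where f' = "\<lambda>_ _. 0"]) (auto simp: Suc)
qed auto

lemma C_class_bounded_linear: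
  assumes "bounded_linear f" shows "C_class k f"
proof (cases k)
  case 0
  then show ?thesis using assms by (simp add: linear_continuous_on)
next
  case (Suc j)
  show ?thesis unfolding Suc
    by (rule C_class_SucI[where f' = "\<lambda>_ v. f v"])
       (auto simp: C_class_const intro: bounded_linear_imp_has_derivative assms)
qed

lemma C_class_add: "C_class k f \<Longrightarrow> C_class k g \<Longrightarrow> C_class k (\<lambda>z. f z + g z)"
proof (induction k arbitrary: f g)
  case (Suc k)
  show ?case
    by (rule C_class_SucI[where f' = "\<lambda>z v. dir_deriv f v z + dir_deriv g v z"])
       (use Suc in \<open>auto intro!: has_derivative_add C_class_has_derivative[of k] Suc.IH\<close>)
qed (auto intro: continuous_on_add)

lemma C_class_sum: "(\<And>i. i \<in> I \<Longrightarrow> C_class k (f i)) \<Longrightarrow> C_class k (\<lambda>z. \<Sum>i\<in>I. f i z)"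
  by (induction I rule: infinite_finite_induct) (auto simp: C_class_const intro: C_class_add)

text \<open>The product rule keeps one factor undifferentiated in each summand, so the assumptions
  are lowered by one order with \<open>C_class_SucD\<close> before the induction hypothesis
  applies.\<close>

lemma C_class_mult:
  fixes f g :: "'a::real_normed_vector \<Rightarrow> 'b::real_normed_algebra"
  shows "C_class k f \<Longrightarrow> C_class k g \<Longrightarrow> C_class k (\<lambda>z. f z * g z)"
proof (induction k arbitrary: f g)
  case (Suc k)
  show ?case
    by (rule C_class_SucI[where f' = "\<lambda>z v. f z * dir_deriv g v z + dir_deriv f v z * g z"])
       (use Suc.prems Suc.prems[THEN C_class_SucD]
         in \<open>auto intro!: has_derivative_mult C_class_has_derivative[of k] C_class_add Suc.IH\<close>)
qed (auto intro: continuous_on_mult)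

lemma C_class_power:
  fixes f :: "'a::real_normed_vector \<Rightarrow> 'b::real_normed_algebra_1"
  shows "C_class k f \<Longrightarrow> C_class k (\<lambda>z. f z ^ m)"
  by (induction m) (auto simp: C_class_const intro: C_class_mult)

lemma C_class_inverse:
  fixes f :: "'a::real_normed_vector \<Rightarrow> real"
  assumes "\<And>z. f z \<noteq> 0"
  shows "C_class k f \<Longrightarrow> C_class k (\<lambda>z. inverse (f z))"
proof (induction k)
  case (Suc k)
  have f: "C_class k f" "C_class k (\<lambda>z. inverse (f z))"
    using Suc C_class_SucD by blast+
  show ?case
  proof (rule C_class_SucI)
    show "((\<lambda>z. inverse (f z)) has_derivative
        (\<lambda>v. - (inverse (f z) * dir_deriv f v z * inverse (f z)))) (at z)" for z
      by (rule Deriv.has_derivative_inverse[OF assms C_class_has_derivative[OF Suc.prems]])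
    show "C_class k (\<lambda>z. - (inverse (f z) * dir_deriv f v z * inverse (f z)))" for v
      using C_class_mult[OF C_class_const[of k "-1"]
          C_class_mult[OF C_class_mult[OF f(2)] f(2), of "dir_deriv f v"]] Suc.prems by simp
  qed
qed (use assms in \<open>auto intro: continuous_on_inverse\<close>)

lemma C_class_ln:
  fixes f :: "'a::real_normed_vector \<Rightarrow> real"
  assumes "\<And>z. f z > 0"
  shows "C_class k f \<Longrightarrow> C_class k (\<lambda>z. ln (f z))"
proof (cases k)
  case 0
  then show "C_class k f \<Longrightarrow> ?thesis"
    using assms by (auto intro!: continuous_on_ln simp: less_imp_neq[symmetric] order.strict_implies_not_eq)
next
  case (Suc j)
  assume "C_class k f"
  then have f: "C_class (Suc j) f" by (simp only: Suc)
  show ?thesis unfolding Suc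
  proof (rule C_class_SucI)
    show "((\<lambda>z. ln (f z)) has_derivative (\<lambda>v. dir_deriv f v z * inverse (f z))) (at z)" for z
      using DERIV_compose_FDERIV[where f = ln and g = f, OF DERIV_ln[OF assms] C_class_has_derivative[OF f]] by simp
    have "C_class j (\<lambda>z. inverse (f z))"
      using C_class_inverse[of f j] assms C_class_SucD[OF f] by (metis less_irrefl)
    then show "C_class j (\<lambda>z. dir_deriv f v z * inverse (f z))" for v
      using f by (auto intro: C_class_mult)
  qed
qed

lemma C_class_compose_linear:
  assumes h: "bounded_linear h"
  shows "C_class k f \<Longrightarrow> C_class k (\<lambda>z. h (f z))"
proof (induction k arbitrary: f)
  case 0
  then show ?case
    using continuous_on_compose2[OF linear_continuous_on[OF h, of UNIV], of UNIV f] by simp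
next
  case (Suc k)
  show ?case
    by (rule C_class_SucI[where f' = "\<lambda>z v. h (dir_deriv f v z)"])
       (use Suc in \<open>auto intro!: bounded_linear.has_derivative[OF h] C_class_has_derivative[of k] Suc.IH\<close>)
qed

text \<open>The derivative 2 <z, v> is linear in z for fixed v, so one differentiation already lands
  in \<open>C_class_bounded_linear\<close>.\<close>

lemma C_class_norm_power2: "C_class k (\<lambda>z::'a::real_inner. (norm z)\<^sup>2)"
proof (cases k)
  case 0
  then show ?thesis by (auto intro: continuous_intros)
next
  case (Suc j)
  have "bounded_linear (\<lambda>z::'a. 2 * (z \<bullet> v))" for v
    by (intro bounded_linear_intros)
  then show ?thesis unfolding Suc power2_norm_eq_inner
    by (intro C_class_SucI[where f' = "\<lambda>z v. 2 * (z \<bullet> v)"])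
       (auto intro!: C_class_bounded_linear derivative_eq_intros simp: inner_commute)
qed

section \<open>Hermitian inner product and radial functions\<close>

definition herm :: "complex ^ 'n::finite \<Rightarrow> complex ^ 'n \<Rightarrow> complex"
  where "herm v w = (\<Sum>i\<in>UNIV. v $ i * cnj (w $ i))"

lemma inner_eq_Re_herm: "v \<bullet> w = Re (herm v w)"
  by (simp add: herm_def inner_vec_def inner_complex_def)

lemma herm_scale_left: "herm (c *s v) w = c * herm v w"
  by (simp add: herm_def sum_distrib_left mult_ac)

lemma herm_scale_right: "herm v (c *s w) = cnj c * herm v w"
  by (simp add: herm_def sum_distrib_left mult_ac)

lemma herm_add_left: "herm (u + v) w = herm u w + herm v w"
  by (simp add: herm_def sum.distrib algebra_simps)

lemma herm_diff_left: "herm (u - v) w = herm u w - herm v w"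
  by (simp add: herm_def sum_subtractf algebra_simps)

lemma herm_diff_right: "herm w (u - v) = herm w u - herm w v"
  by (simp add: herm_def sum_subtractf algebra_simps)

lemma herm_commute: "herm w v = cnj (herm v w)"
  by (simp add: herm_def mult.commute)

lemma herm_self: "herm v v = complex_of_real ((norm v)\<^sup>2)"
proof -
  have "Im (herm v v) = 0" by (simp add: herm_def)
  then show ?thesis
    by (simp add: power2_norm_eq_inner inner_eq_Re_herm complex_eq_iff)
qed

lemma norm_cscale: "norm (c *s v) = cmod c * norm (v :: complex ^ 'n::finite)"
proof -
  have "complex_of_real ((norm (c *s v))\<^sup>2) = complex_of_real ((cmod c * norm v)\<^sup>2)"
    unfolding herm_self[symmetric] herm_scale_left herm_scale_right power_mult_distrib of_real_mult
      complex_norm_square by (simp add: mult_ac)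
  then show ?thesis
    by (metis norm_ge_zero mult_nonneg_nonneg of_real_eq_iff power2_eq_iff_nonneg)
qed

text \<open>Rotating v by the conjugate phase of the product makes the product real and nonnegative,
  which reduces the claim to the real Cauchy-Schwarz inequality.\<close>

lemma norm_herm_le: "cmod (herm v w) \<le> norm v * norm w"
proof (cases "herm v w = 0")
  case False
  define u where "u = cnj (sgn (herm v w))"
  have u: "cmod u = 1" using False by (simp add: u_def norm_sgn)
  have "cmod (herm v w) = Re (herm (u *s v) w)"
  proof -
    have "cnj (sgn (herm v w)) * herm v w = of_real (cmod (herm v w))"
      using complex_norm_square[of "herm v w"] False
      by (simp add: sgn_eq field_simps power2_eq_square)
    then show ?thesis by (simp add: herm_scale_left u_def)
  qed
  also have "\<dots> = (u *s v) \<bullet> w" by (simp add: inner_eq_Re_herm)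
  also have "\<dots> \<le> norm (u *s v) * norm w" by (rule norm_cauchy_schwarz)
  finally show ?thesis by (simp add: norm_cscale u)
qed auto

lemma inner_axis_complex:
  "z \<bullet> axis \<beta> 1 = Re (z $ \<beta>)" "z \<bullet> axis \<beta> \<i> = Im (z $ \<beta>)"
  by (simp_all add: inner_axis inner_complex_def)

lemma has_derivative_radial:
  fixes z :: "'a::real_inner"
  assumes "(L has_real_derivative l) (at ((norm z)\<^sup>2))"
  shows "((\<lambda>w. L ((norm w)\<^sup>2)) has_derivative (\<lambda>v. 2 * (z \<bullet> v) * l)) (at z)"
proof -
  have "((\<lambda>w. (norm w)\<^sup>2) has_derivative (\<lambda>v. 2 * (z \<bullet> v))) (at z)"
    unfolding power2_norm_eq_inner by (auto intro!: derivative_eq_intros simp: inner_commute)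
  then show ?thesis
    by (rule DERIV_compose_FDERIV[where f = L and g = "\<lambda>w. (norm w)\<^sup>2", OF assms])
qed

lemma wirt_bar_radial:
  assumes "(L has_real_derivative l) (at ((norm z)\<^sup>2))"
  shows "wirt_bar \<beta> (\<lambda>w. complex_of_real (L ((norm w)\<^sup>2))) z = of_real l * z $ \<beta>"
    and "wirt \<beta> (\<lambda>w. complex_of_real (L ((norm w)\<^sup>2))) z = of_real l * cnj (z $ \<beta>)"
proof -
  have "((\<lambda>w. complex_of_real (L ((norm w)\<^sup>2))) has_derivative
      (\<lambda>v. of_real (2 * (z \<bullet> v) * l))) (at z)"
    by (rule has_derivative_of_real[OF has_derivative_radial[OF assms]])
  note d = dir_deriv_eqI[OF this]
  show "wirt_bar \<beta> (\<lambda>w. complex_of_real (L ((norm w)\<^sup>2))) z = of_real l * z $ \<beta>"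
    "wirt \<beta> (\<lambda>w. complex_of_real (L ((norm w)\<^sup>2))) z = of_real l * cnj (z $ \<beta>)"
    unfolding wirt_bar_def wirt_def d inner_axis_complex by (simp_all add: complex_eq_iff)
qed

text \<open>The complex Hessian of a radial function is L' times the identity plus L'' times the
  rank-one form of z, because the second derivative hits either the coordinate or the radius in L'
  z_\<beta>.\<close>

lemma levi_form_radial:
  fixes z Z :: "complex ^ 'n::finite"
  assumes L1: "\<And>s. s \<ge> 0 \<Longrightarrow> (L has_real_derivative L1 s) (at s)"
    and L2: "\<And>s. s \<ge> 0 \<Longrightarrow> (L1 has_real_derivative L2 s) (at s)"
  shows "levi_form (\<lambda>w. L ((norm w)\<^sup>2)) z Z =
    of_real (L1 ((norm z)\<^sup>2) * (norm Z)\<^sup>2 + L2 ((norm z)\<^sup>2) * (cmod (herm Z z))\<^sup>2)"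
proof -
  let ?s = "(norm z)\<^sup>2"
  have bar: "wirt_bar \<beta> (\<lambda>w. complex_of_real (L ((norm w)\<^sup>2))) =
      (\<lambda>z. of_real (L1 ((norm z)\<^sup>2)) * z $ \<beta>)" for \<beta> :: 'n
    using wirt_bar_radial(1)[OF L1] by auto
  have "((\<lambda>z. complex_of_real (L1 ((norm z)\<^sup>2)) * z $ \<beta>) has_derivative
      (\<lambda>v. of_real (L1 ?s) * v $ \<beta> + of_real (2 * (z \<bullet> v) * L2 ?s) * z $ \<beta>)) (at z)" for \<beta>
    by (rule has_derivative_mult[OF has_derivative_of_real[OF has_derivative_radial[OF L2]]
          bounded_linear_imp_has_derivative[OF bounded_linear_vec_nth]]) simp
  note d = dir_deriv_eqI[OF this]
  have w: "wirt \<alpha> (\<lambda>z. of_real (L1 ((norm z)\<^sup>2)) * z $ \<beta>) z =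
      of_real (L2 ?s) * cnj (z $ \<alpha>) * z $ \<beta> + (if \<alpha> = \<beta> then of_real (L1 ?s) else 0)" for \<alpha> \<beta>
    unfolding wirt_def d inner_axis_complex
    by (simp add: complex_eq_iff axis_def algebra_simps diff_divide_distrib add_divide_distrib)
  have "levi_form (\<lambda>w. L ((norm w)\<^sup>2)) z Z = (\<Sum>\<alpha>\<in>UNIV. \<Sum>\<beta>\<in>UNIV.
      of_real (L2 ?s) * ((Z $ \<alpha> * cnj (z $ \<alpha>)) * (z $ \<beta> * cnj (Z $ \<beta>))) +
      (if \<alpha> = \<beta> then of_real (L1 ?s) * (Z $ \<alpha> * cnj (Z $ \<alpha>)) else 0))"
    unfolding levi_form_def bar w
    by (intro sum.cong refl) (auto simp: algebra_simps)
  also have "\<dots> = of_real (L2 ?s) * (herm Z z * herm z Z) + of_real (L1 ?s) * herm Z Z"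
  proof -
    have "herm Z z * herm z Z =
        (\<Sum>\<alpha>\<in>UNIV. \<Sum>\<beta>\<in>UNIV. (Z $ \<alpha> * cnj (z $ \<alpha>)) * (z $ \<beta> * cnj (Z $ \<beta>)))"
      unfolding herm_def by (rule sum_product)
    then show ?thesis
      by (simp only: sum.distrib sum_distrib_left) (simp add: herm_def sum_distrib_left)
  qed
  also have "herm Z z * herm z Z = of_real ((cmod (herm Z z))\<^sup>2)"
    unfolding herm_commute[of z Z] complex_norm_square ..
  finally show ?thesis by (simp add: herm_self)
qed

section \<open>The functions log (1 + K) for polynomials K with positive coefficients\<close>

definition kpoly :: "nat \<Rightarrow> (nat \<Rightarrow> real) \<Rightarrow> real \<Rightarrow> real"
  where "kpoly m c s = (\<Sum>d=1..m. c d * s ^ d)"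

context
  fixes m :: nat and c :: "nat \<Rightarrow> real"
  assumes m: "m \<ge> 1" and c: "\<And>d. d \<in> {1..m} \<Longrightarrow> c d > 0"
begin

lemma kpoly_nonneg: "s \<ge> 0 \<Longrightarrow> kpoly m c s \<ge> 0"
  unfolding kpoly_def by (intro sum_nonneg) (simp add: c less_imp_le)

lemma kpoly_ge_term: "s \<ge> 0 \<Longrightarrow> d \<in> {1..m} \<Longrightarrow> c d * s ^ d \<le> kpoly m c s"
  unfolding kpoly_def by (rule member_le_sum) (auto simp: c less_imp_le)

lemma smooth_ln_kpoly: "smooth (\<lambda>z::'a::real_inner. ln (1 + kpoly m c ((norm z)\<^sup>2)) / r)"
proof -
  have "C_class k (\<lambda>z::'a. 1 + kpoly m c ((norm z)\<^sup>2))" for k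
    unfolding kpoly_def
    by (intro C_class_add C_class_const C_class_sum C_class_mult C_class_power C_class_norm_power2)
  then have "C_class k (\<lambda>z::'a. ln (1 + kpoly m c ((norm z)\<^sup>2)))" for k
    by (rule C_class_ln[rotated]) (simp add: add_pos_nonneg kpoly_nonneg)
  from C_class_mult[OF this C_class_const[of _ "inverse r"]] show ?thesis
    by (simp add: smooth_def divide_inverse)
qed

text \<open>With s = |z|^2, the Levi form has the eigenvalue L' on the complement of z and L' + s
  L'' along z. Up to the factor 1 / r, the second one multiplied by s is the variance of the
  exponent d under the weights c_d s^d / (1 + K s), where the constant 1 counts as exponent
  0.\<close>

lemma strictly_psh_ln_kpoly:
  assumes r: "r > 0"
  shows "strictly_psh (\<lambda>z::complex ^ 'n::finite. ln (1 + kpoly m c ((norm z)\<^sup>2)) / r)"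
  unfolding strictly_psh_def
proof (intro conjI allI impI)
  show "C_class 2 (\<lambda>z::complex ^ 'n. ln (1 + kpoly m c ((norm z)\<^sup>2)) / r)"
    using smooth_ln_kpoly unfolding smooth_def by blast
  fix z Z :: "complex ^ 'n" assume Z: "Z \<noteq> 0"
  define K where "K = kpoly m c"
  define K1 where "K1 s = (\<Sum>d=1..m. c d * (of_nat d * s ^ (d - 1)))" for s
  define K2 where "K2 s = (\<Sum>d=1..m. c d * (of_nat d * (of_nat (d - 1) * s ^ (d - 1 - 1))))" for s
  have dK: "(K has_real_derivative K1 s) (at s)" and dK1: "(K1 has_real_derivative K2 s) (at s)" for s
    unfolding K_def K1_def K2_def kpoly_def
    by (auto intro!: derivative_eq_intros sum.cong)
  have K0: "K s \<ge> 0" if "s \<ge> 0" for s using kpoly_nonneg[OF that] by (simp add: K_def)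
  define L where "L s = ln (1 + K s) / r" for s
  define L1 where "L1 s = K1 s / (1 + K s) / r" for s
  define L2 where "L2 s = (K2 s * (1 + K s) - K1 s * K1 s) / ((1 + K s) * (1 + K s)) / r" for s
  have dL: "(L has_real_derivative L1 s) (at s)" if "s \<ge> 0" for s
    unfolding L_def L1_def using K0[OF that]
    using r by (auto intro!: derivative_eq_intros dK simp: divide_simps)
  have dL1: "(L1 has_real_derivative L2 s) (at s)" if "s \<ge> 0" for s
    unfolding L1_def L2_def using K0[OF that]
    by (intro DERIV_cdivide DERIV_divide) (auto intro!: derivative_eq_intros dK dK1)
  define s where "s = (norm z)\<^sup>2"
  have s0: "s \<ge> 0" by (simp add: s_def)
  have K1s: "K1 s \<ge> c 1"
  proof -
    have "c 1 * (of_nat 1 * s ^ (1 - 1)) \<le> K1 s" unfolding K1_def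
      by (rule member_le_sum) (use m s0 in \<open>auto intro!: mult_nonneg_nonneg less_imp_le[OF c]\<close>)
    then show ?thesis by simp
  qed
  have c1: "c 1 > 0" using c m by simp
  have L1s: "L1 s > 0" unfolding L1_def using K0[OF s0] K1s c1 r by simp
  have pos: "L1 s + s * L2 s > 0"
  proof -
    have "(K1 s + s * K2 s) * (1 + K s) - s * (K1 s)\<^sup>2 > 0"
    proof (cases "s = 0")
      \<comment> \<open>The variance argument multiplies by s and so says nothing at the origin,
        where the linear coefficient \<open>c 1\<close> gives the sign.\<close>
      case True
      then show ?thesis using K1s c1 K0[of 0] by simp
    next
      case False
      then have sp: "s > 0" using s0 by simp
      have T2: "s * (K1 s + s * K2 s) = (\<Sum>d=1..m. (real d * sqrt (c d * s ^ d))\<^sup>2)"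
        unfolding K1_def K2_def sum_distrib_left sum.distrib[symmetric]
      proof (rule sum.cong[OF refl])
        fix d assume d: "d \<in> {1..m}"
        then obtain e where e: "d = Suc e" by (cases d) auto
        have "s * (c d * (real d * s ^ (d - 1)) + s * (c d * (real d * (real (d - 1) * s ^ (d - 1 - 1)))))
            = c d * real d * (s ^ d + real e * (s ^ 2 * s ^ (e - 1)))"
          by (simp add: e algebra_simps power2_eq_square)
        also have "real e * (s ^ 2 * s ^ (e - 1)) = real e * s ^ d"
          by (cases e) (auto simp: e power2_eq_square)
        finally show "s * (c d * (real d * s ^ (d - 1)) + s * (c d * (real d * (real (d - 1) * s ^ (d - 1 - 1)))))
            = (real d * sqrt (c d * s ^ d))\<^sup>2"
          using c[OF d] s0 by (simp add: power_mult_distrib e power2_eq_square algebra_simps)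
      qed
      have T1: "s * K1 s = (\<Sum>d=1..m. (real d * sqrt (c d * s ^ d)) * sqrt (c d * s ^ d))"
        unfolding K1_def sum_distrib_left
      proof (rule sum.cong[OF refl])
        fix d assume d: "d \<in> {1..m}"
        then obtain e where e: "d = Suc e" by (cases d) auto
        show "s * (c d * (real d * s ^ (d - 1))) = (real d * sqrt (c d * s ^ d)) * sqrt (c d * s ^ d)"
          using c[OF d] s0 by (simp add: e mult.assoc real_sqrt_mult_self)
      qed
      have T0: "K s = (\<Sum>d=1..m. (sqrt (c d * s ^ d))\<^sup>2)"
        unfolding K_def kpoly_def by (intro sum.cong) (auto simp: s0 c less_imp_le)
      have "(s * K1 s)\<^sup>2 \<le> (s * (K1 s + s * K2 s)) * K s"
        unfolding T2 T1 T0 by (rule Cauchy_Schwarz_ineq_sum)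
      \<comment> \<open>Cauchy-Schwarz with K alone may be an equality, for instance when only one
        degree occurs; the summand 1 in 1 + K adds this positive second moment and makes the
        inequality strict.\<close>
      moreover have "s * (K1 s + s * K2 s) > 0"
        unfolding T2 using m sp by (intro sum_pos) (auto simp: less_imp_neq[OF c, symmetric])
      ultimately have "s * ((K1 s + s * K2 s) * (1 + K s) - s * (K1 s)\<^sup>2) > 0"
        by (simp add: algebra_simps power2_eq_square)
      then show ?thesis using sp by (simp add: zero_less_mult_iff)
    qed
    moreover have "L1 s + s * L2 s =
        ((K1 s + s * K2 s) * (1 + K s) - s * (K1 s)\<^sup>2) / (1 + K s)\<^sup>2 / r"
    proof -
      have "x / N / r + s * ((y * N - x * x) / (N * N) / r) = ((x + s * y) * N - s * x\<^sup>2) / N\<^sup>2 / r"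
        if "N \<noteq> 0" for x y N using that r by (simp add: field_simps power2_eq_square)
      then show ?thesis unfolding L1_def L2_def using K0[OF s0] by simp
    qed
    ultimately show ?thesis using K0[OF s0] r by simp
  qed
  have le: "(cmod (herm Z z))\<^sup>2 \<le> (norm Z)\<^sup>2 * s"
    using power_mono[OF norm_herm_le[of Z z] norm_ge_zero, of 2] by (simp add: s_def power_mult_distrib)
  have "0 < L1 s * (norm Z)\<^sup>2 + L2 s * (cmod (herm Z z))\<^sup>2"
  \<comment> \<open>The expression is affine in |<Z, z>|^2, which lies between 0 and s |Z|^2; the
    sign of \<open>L2 s\<close> tells at which end it is smallest, and the two ends correspond to
    the two eigenvalues.\<close>
  proof (cases "L2 s \<ge> 0")
    case True
    then show ?thesis using L1s Z by (intro add_pos_nonneg mult_pos_pos) auto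
  next
    case False
    then have "L2 s * (cmod (herm Z z))\<^sup>2 \<ge> L2 s * ((norm Z)\<^sup>2 * s)"
      using le by (intro mult_left_mono_neg) auto
    moreover have "(L1 s + s * L2 s) * (norm Z)\<^sup>2 > 0" using pos Z by simp
    ultimately show ?thesis by (simp add: algebra_simps)
  qed
  then show "0 < Re (levi_form (\<lambda>z. ln (1 + kpoly m c ((norm z)\<^sup>2)) / r) z Z)"
    using levi_form_radial[of L L1 L2 z Z, OF dL dL1] by (simp add: L_def K_def s_def)
qed

text \<open>The linear term of the polynomial alone bounds |z|^2 on a sublevel set by exp (a r) / c
  1.\<close>

lemma exhaustion_ln_kpoly:
  assumes r: "r > 0"
  shows "exhaustion (\<lambda>z::complex ^ 'n::finite. ln (1 + kpoly m c ((norm z)\<^sup>2)) / r)"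
  unfolding exhaustion_def
proof
  fix a
  let ?f = "\<lambda>z::complex ^ 'n. ln (1 + kpoly m c ((norm z)\<^sup>2)) / r"
  have c1: "c 1 > 0" using c m by simp
  have "C_class 0 ?f" using smooth_ln_kpoly unfolding smooth_def by blast
  then have "closed {z. ?f z \<le> a}"
    by (intro closed_Collect_le) auto
  moreover have "(norm z)\<^sup>2 \<le> exp (a * r) / c 1" if "?f z \<le> a" for z
  proof -
    have "1 + kpoly m c ((norm z)\<^sup>2) > 0" by (simp add: add_pos_nonneg kpoly_nonneg)
    moreover have "ln (1 + kpoly m c ((norm z)\<^sup>2)) \<le> a * r" using that r by (simp add: field_simps)
    ultimately have "1 + kpoly m c ((norm z)\<^sup>2) \<le> exp (a * r)" by (metis exp_le_cancel_iff exp_ln)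
    moreover have "c 1 * ((norm z)\<^sup>2) ^ 1 \<le> kpoly m c ((norm z)\<^sup>2)"
      by (rule kpoly_ge_term) (use m in auto)
    ultimately show ?thesis using c1 by (simp add: field_simps)
  qed
  then have "bounded {z. ?f z \<le> a}"
    unfolding bounded_iff by (auto intro!: exI[of _ "sqrt (exp (a * r) / c 1)"] real_le_rsqrt)
  ultimately show "compact {z. ?f z \<le> a}"
    by (simp add: compact_eq_bounded_closed)
qed

end

section \<open>Unitary matrices\<close>

lemma herm_axis_left: "herm (axis i c) w = c * cnj (w $ i)"
proof -
  have "herm (axis i c) w = (\<Sum>j\<in>UNIV. if j = i then c * cnj (w $ i) else 0)"
    unfolding herm_def by (rule sum.cong) (auto simp: axis_def)
  then show ?thesis by simp
qed

lemma herm_axis_right: "herm v (axis i c) = v $ i * cnj c"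
  unfolding herm_commute[of v] by (simp add: herm_axis_left mult.commute)

lemma matrix_mult_axis: "(U *v axis j 1) $ i = (U :: complex ^ 'n::finite ^ 'm::finite) $ i $ j"
proof -
  have "(U *v axis j 1) $ i = (\<Sum>k\<in>UNIV. if k = j then U $ i $ j else 0)"
    unfolding matrix_vector_mult_def vec_lambda_beta by (rule sum.cong) (auto simp: axis_def)
  then show ?thesis by simp
qed

text \<open>The definition says that the rows are orthonormal; for a square matrix the columns are
  then orthonormal too, and their products are the values of the form on the images of the standard
  basis.\<close>

lemma unitary_matrix_iff_herm:
  "unitary_matrix U \<longleftrightarrow> (\<forall>v w. herm (U *v v) (U *v w) = herm v w)"
proof -
  have entry: "((\<chi> i j. cnj (U $ j $ i)) ** U) $ k $ j = herm (U *v axis j 1) (U *v axis k 1)" for j k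
    by (simp add: herm_def matrix_matrix_mult_def matrix_mult_axis mult.commute)
  have "unitary_matrix U \<longleftrightarrow> (\<chi> i j. cnj (U $ j $ i)) ** U = mat 1"
    unfolding unitary_matrix_def by (rule matrix_left_right_inverse)
  also have "\<dots> \<longleftrightarrow> (\<forall>k j. herm (U *v axis j 1) (U *v axis k 1) = (if k = j then 1 else 0))"
    unfolding vec_eq_iff entry by (simp add: mat_def)
  also have "\<dots> \<longleftrightarrow> (\<forall>v w. herm (U *v v) (U *v w) = herm v w)"
  proof safe
    fix v w :: "complex ^ 'a"
    assume *: "\<forall>k j. herm (U *v axis j 1) (U *v axis k 1) = (if k = j then 1 else 0)"
    have "herm (U *v v) (U *v w) =
        (\<Sum>i\<in>UNIV. \<Sum>j\<in>UNIV. \<Sum>k\<in>UNIV. (v $ j * cnj (w $ k)) * (U $ i $ j * cnj (U $ i $ k)))"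
      unfolding herm_def matrix_vector_mult_def
      by (simp add: sum_product mult_ac)
    also have "\<dots> = (\<Sum>j\<in>UNIV. \<Sum>k\<in>UNIV. (v $ j * cnj (w $ k)) * (\<Sum>i\<in>UNIV. U $ i $ j * cnj (U $ i $ k)))"
      unfolding sum_distrib_left
      by (subst sum.swap, rule sum.cong[OF refl], rule sum.swap)
    also have "\<dots> = (\<Sum>j\<in>UNIV. \<Sum>k\<in>UNIV. if k = j then v $ j * cnj (w $ k) else 0)"
      using * by (intro sum.cong refl) (simp add: herm_def matrix_mult_axis)
    also have "\<dots> = herm v w" by (simp add: herm_def)
    finally show "herm (U *v v) (U *v w) = herm v w" .
  next
    fix k j
    assume "\<forall>v w. herm (U *v v) (U *v w) = herm v w"
    then show "herm (U *v axis j 1) (U *v axis k 1) = (if k = j then 1 else 0)"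
      by (simp add: herm_axis_left) (simp add: axis_def)
  qed
  finally show ?thesis .
qed

lemma herm_unitary: "unitary_matrix U \<Longrightarrow> herm (U *v v) (U *v w) = herm v w"
  by (simp add: unitary_matrix_iff_herm)

lemma norm_unitary: "unitary_matrix U \<Longrightarrow> norm (U *v v) = norm v"
  using herm_unitary[of U v v] unfolding herm_self
  by (metis norm_ge_zero of_real_eq_iff power2_eq_iff_nonneg)

text \<open>Produces unitary matrices from maps, so that symmetries can be given by their action
  instead of by entries.\<close>

lemma unitary_matrix_of_map:
  assumes "\<And>x y. f (x + y) = f x + f y" "\<And>c x. f (c *s x) = c *s f x"
    and "\<And>x y. herm (f x) (f y) = herm x y"
  obtains U where "unitary_matrix U" "\<And>x. U *v x = f x"
proof -
  have "Vector_Spaces.linear (*s) (*s) f"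
    by unfold_locales (use assms in \<open>auto simp: vec.scale_right_distrib vec.scale_left_distrib\<close>)
  then have "matrix f *v x = f x" for x by (rule matrix_works)
  then show thesis
    using that[of "matrix f"] assms(3) by (simp add: unitary_matrix_iff_herm)
qed

lemma unitary_scalar:
  assumes "cmod c = 1"
  obtains U :: "complex ^ 'n::finite ^ 'n" where "unitary_matrix U" "\<And>x. U *v x = c *s x"
proof (rule unitary_matrix_of_map[of "\<lambda>x::complex ^ 'n. c *s x"])
  have "cnj c * c = 1" using assms complex_norm_square[of c] by (simp add: mult.commute)
  then show "herm (c *s x) (c *s y) = herm x y" for x y :: "complex ^ 'n"
    by (simp add: herm_scale_left herm_scale_right)
qed (auto simp: vec.scale_right_distrib mult.commute that)

text \<open>Fixes every vector with vanishing k-th coordinate and reverses the k-th axis; this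
  symmetry will kill off-diagonal metric coefficients.\<close>

lemma unitary_sign_flip:
  obtains U :: "complex ^ 'n::finite ^ 'n" where "unitary_matrix U"
    "\<And>x. U *v x = (\<chi> i. if i = k then - x $ i else x $ i)"
proof (rule unitary_matrix_of_map[of "\<lambda>x::complex ^ 'n. \<chi> i. if i = k then - x $ i else x $ i"])
qed (auto simp: vec_eq_iff herm_def that intro!: sum.cong)

lemma unitary_swap:
  obtains U :: "complex ^ 'n::finite ^ 'n" where "unitary_matrix U"
    "\<And>x. U *v x = (\<chi> i. x $ Transposition.transpose k l i)"
proof (rule unitary_matrix_of_map[of "\<lambda>x::complex ^ 'n. \<chi> i. x $ Transposition.transpose k l i"])
  show "herm (\<chi> i. x $ Transposition.transpose k l i) (\<chi> i. y $ Transposition.transpose k l i) = herm x y"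
    for x y :: "complex ^ 'n"
    unfolding herm_def by (simp, rule sum.reindex_bij_betw) simp
qed (auto simp: vec_eq_iff that)

text \<open>Multiply \<open>z\<close> by a phase making \<open>\<langle>z, w\<rangle>\<close> real, then reflect in the hyperplane orthogonal
  to the difference.\<close>

lemma unitary_transitive:
  fixes z w :: "complex ^ 'n::finite"
  assumes nzw: "norm z = norm w"
  obtains U where "unitary_matrix U" "U *v z = w"
proof -
  obtain c where c: "cmod c = 1" "cnj (c * herm z w) = c * herm z w"
  proof (cases "herm z w = 0")
    case True
    then show thesis using that[of 1] by simp
  next
    case False
    have "cnj (sgn (herm z w)) * herm z w = of_real (cmod (herm z w))"
      using complex_norm_square[of "herm z w"] False
      by (simp add: sgn_eq field_simps power2_eq_square)
    then show thesis using that[of "cnj (sgn (herm z w))"] False by (simp add: norm_sgn)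
  qed
  obtain U0 :: "complex ^ 'n ^ 'n" where U0: "unitary_matrix U0" "\<And>x. U0 *v x = c *s x"
    using unitary_scalar[OF c(1)] by metis
  define v where "v = c *s z - w"
  show thesis
  proof (cases "v = 0")
    case True
    then show thesis using that[of U0] U0 by (simp add: v_def)
  next
    case False
    define V where "V = herm v v"
    have V0: "V \<noteq> 0" using False by (simp add: V_def herm_self)
    have cV: "cnj V = V" by (simp add: V_def herm_self)
    define R where "R x = x - (2 * herm x v / V) *s v" for x
    have hz: "herm (c *s z) w = c * herm z w" and hw: "herm w (c *s z) = c * herm z w"
      using c(2) herm_commute[of w "c *s z"] by (simp_all add: herm_scale_left)
    have nn: "herm (c *s z) (c *s z) = herm w w"
      unfolding herm_self norm_cscale using c(1) nzw by simp
    \<comment> \<open>Since c z and w have equal norms and a real product, |v|^2 = 2 <c z, v>; the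
      reflection therefore subtracts exactly v from c z and returns w.\<close>
    have "V = 2 * herm (c *s z) v"
      unfolding V_def by (simp add: v_def herm_diff_left herm_diff_right nn hz hw)
    then have Rz: "R (c *s z) = w"
      using V0 by (simp add: R_def v_def)
    obtain U1 where U1: "unitary_matrix U1" "\<And>x. U1 *v x = R x"
    proof (rule unitary_matrix_of_map[of R])
      show "R (x + y) = R x + R y" for x y
        by (simp add: R_def herm_add_left vec_eq_iff field_simps add_divide_distrib)
      show "R (d *s x) = d *s R x" for d x
        by (simp add: R_def herm_scale_left vec_eq_iff field_simps)
      show "herm (R x) (R y) = herm x y" for x y
      proof -
        have "herm (R x) (R y) = herm x y - (2 * cnj (herm y v) / V) * herm x v
            - (2 * herm x v / V) * herm v y + (2 * herm x v / V) * (2 * cnj (herm y v) / V) * V"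
          unfolding R_def
          by (simp add: herm_diff_left herm_diff_right herm_scale_left herm_scale_right cV V_def[symmetric]
              algebra_simps)
        then show ?thesis using V0 by (simp add: herm_commute[of v y] field_simps)
      qed
    qed (use that in auto)
    have "unitary_matrix (U1 ** U0)"
      using U0 U1 by (simp add: unitary_matrix_iff_herm matrix_vector_mul_assoc[symmetric])
    moreover have "(U1 ** U0) *v z = w"
      using U0 U1 Rz by (simp add: matrix_vector_mul_assoc[symmetric])
    ultimately show thesis by (rule that)
  qed
qed

section \<open>Unitarily invariant Hermitian metrics\<close>

definition hform :: "'n::finite metric \<Rightarrow> complex ^ 'n \<Rightarrow> complex ^ 'n \<Rightarrow> complex ^ 'n \<Rightarrow> complex"
  where "hform g z v w = (\<Sum>\<alpha>\<in>UNIV. \<Sum>\<beta>\<in>UNIV. g z $ \<alpha> $ \<beta> * v $ \<alpha> * cnj (w $ \<beta>))"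

lemma riem_eq_hform: "riem g z v w = Re (hform g z v w)"
  by (simp add: riem_def hform_def)

lemma hform_scale_left: "hform g z (c *s v) w = c * hform g z v w"
  by (simp add: hform_def sum_distrib_left mult_ac)

lemma hform_scale_right: "hform g z v (c *s w) = cnj c * hform g z v w"
  by (simp add: hform_def sum_distrib_left mult_ac)

lemma hform_axis: "hform g z (axis i c) (axis j d) = g z $ i $ j * c * cnj d"
proof -
  have "hform g z (axis i c) (axis j d) =
      (\<Sum>\<alpha>\<in>UNIV. \<Sum>\<beta>\<in>UNIV. if \<beta> = j then (if \<alpha> = i then g z $ i $ j * c * cnj d else 0) else 0)"
    unfolding hform_def by (intro sum.cong refl) (auto simp: axis_def)
  then show ?thesis by simp
qed

text \<open>Two different indices exist because n is at least 2: e spans the radial line, and p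
  represents all tangential directions, which are interchangeable along that line.\<close>

locale radial_metric =
  fixes g :: "'n::finite metric" and e p :: 'n
  assumes herm_met: "hermitian_metric g" and inv: "unitary_invariant g" and ep: "e \<noteq> p"
begin

text \<open>Invariance is assumed for the real part; replacing w by i w recovers the imaginary part
  of the Hermitian form.\<close>

lemma hform_unitary:
  assumes U: "unitary_matrix U"
  shows "hform g (U *v z) (U *v v) (U *v w) = hform g z v w"
proof -
  have re: "Re (hform g (U *v z) (U *v v) (U *v w)) = Re (hform g z v w)" for w
    using inv U by (simp add: unitary_invariant_def riem_eq_hform)
  have "U *v (\<i> *s w) = \<i> *s (U *v w)" by (rule vector_scalar_commute)
  with re[of w] re[of "\<i> *s w"] show ?thesis
    by (simp add: hform_scale_right complex_eq_iff)
qed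

lemma g_cnj: "g z $ \<beta> $ \<alpha> = cnj (g z $ \<alpha> $ \<beta>)"
  using herm_met unfolding hermitian_metric_def by blast

lemma smooth_g: "C_class k (\<lambda>z. g z $ \<alpha> $ \<beta>)"
  using herm_met unfolding hermitian_metric_def smooth_def by blast

lemma riem_pos: "v \<noteq> 0 \<Longrightarrow> riem g z v v > 0"
  using herm_met unfolding hermitian_metric_def by blast

definition E :: "complex ^ 'n" where "E = axis e 1"
text \<open>The profiles \<open>a\<close> and \<open>b\<close> are defined on the whole real line,
  so that derivatives and continuity at 0 are two-sided.\<close>

definition a :: "real \<Rightarrow> real" where "a x = Re (g (x *\<^sub>R E) $ e $ e)"
definition b :: "real \<Rightarrow> real" where "b x = Re (g (x *\<^sub>R E) $ p $ p)"

lemma norm_E [simp]: "norm E = 1" by (simp add: E_def norm_axis_1)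

text \<open>The reflection of the j-th coordinate fixes z and reverses only the j-th axis, so the
  entry equals its own negative.\<close>

lemma g_offdiag:
  assumes "z $ j = 0" "i \<noteq> j"
  shows "g z $ i $ j = 0" "g z $ j $ i = 0"
proof -
  obtain U :: "complex ^ 'n ^ 'n" where U: "unitary_matrix U"
    "\<And>x. U *v x = (\<chi> i. if i = j then - x $ i else x $ i)"
    by (rule unitary_sign_flip[of j], rule that) simp_all
  have "U *v z = z" using assms by (auto simp: U(2) vec_eq_iff)
  moreover have "U *v axis i 1 = axis i 1" "U *v axis j 1 = axis j (-1)"
    using assms by (auto simp: U(2) vec_eq_iff axis_def)
  ultimately have "hform g z (axis i 1) (axis j (-1)) = hform g z (axis i 1) (axis j 1)"
    using hform_unitary[OF U(1), of z "axis i 1" "axis j 1"] by simp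
  then show "g z $ i $ j = 0" by (simp add: hform_axis)
  then show "g z $ j $ i = 0" using g_cnj[of z j i] by simp
qed

lemma g_diag_eq:
  assumes "z $ i = z $ j"
  shows "g z $ i $ i = g z $ j $ j"
proof -
  obtain U :: "complex ^ 'n ^ 'n" where U: "unitary_matrix U"
    "\<And>x. U *v x = (\<chi> k. x $ Transposition.transpose i j k)"
    by (rule unitary_swap[of i j], rule that) simp_all
  have "U *v z = z" using assms by (auto simp: U(2) vec_eq_iff Transposition.transpose_def)
  moreover have "U *v axis i 1 = axis j 1"
    by (auto simp: U(2) vec_eq_iff axis_def Transposition.transpose_def)
  ultimately have "hform g z (axis j 1) (axis j 1) = hform g z (axis i 1) (axis i 1)"
    using hform_unitary[OF U(1), of z "axis i 1" "axis i 1"] by simp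
  then show ?thesis by (simp add: hform_axis)
qed

lemma g_diag_real: "g z $ i $ i = of_real (Re (g z $ i $ i))"
proof -
  have "Im (g z $ i $ i) = Im (cnj (g z $ i $ i))" using g_cnj by metis
  then show ?thesis by (simp add: complex_eq_iff)
qed

lemma g_on_axis:
  "g (x *\<^sub>R E) $ i $ j = (if i = j then of_real (if i = e then a x else b x) else 0)"
proof -
  have z: "(x *\<^sub>R E) $ k = 0" if "k \<noteq> e" for k using that by (simp add: E_def axis_def)
  show ?thesis
  proof (cases "i = j")
    case True
    then show ?thesis
    proof (cases "i = e")
      case False
      have "g (x *\<^sub>R E) $ i $ i = g (x *\<^sub>R E) $ p $ p"
        by (rule g_diag_eq) (use False ep z in metis)
      also have "\<dots> = of_real (b x)" unfolding b_def by (rule g_diag_real)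
      finally show ?thesis using True False by simp
    next
      case True
      have "g (x *\<^sub>R E) $ e $ e = of_real (a x)" unfolding a_def by (rule g_diag_real)
      then show ?thesis using True \<open>i = j\<close> by simp
    qed
  next
    case False
    then show ?thesis using g_offdiag[OF z, of j i] g_offdiag[OF z, of i j] by auto
  qed
qed

lemma hform_on_axis:
  "hform g (x *\<^sub>R E) v w = of_real (b x) * herm v w + of_real (a x - b x) * (v $ e * cnj (w $ e))"
proof -
  have "hform g (x *\<^sub>R E) v w = (\<Sum>i\<in>UNIV. of_real (if i = e then a x else b x) * v $ i * cnj (w $ i))"
    unfolding hform_def g_on_axis by (rule sum.cong[OF refl]) (simp add: if_distrib[of "\<lambda>x. x * _"] cong: if_cong)
  also have "\<dots> = (\<Sum>i\<in>UNIV. of_real (b x) * (v $ i * cnj (w $ i)) +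
      (if i = e then of_real (a x - b x) * (v $ e * cnj (w $ e)) else 0))"
    by (rule sum.cong[OF refl]) (simp add: algebra_simps)
  finally show ?thesis by (simp add: sum.distrib herm_def sum_distrib_left)
qed

lemma unitary_to_axis: obtains U where "unitary_matrix U" "U *v z = norm z *\<^sub>R E"
  by (rule unitary_transitive[of z "norm z *\<^sub>R E"]) (simp, rule that)

lemma scaleR_E_component: "v $ e = herm v E"
  by (simp add: E_def herm_axis_right)

lemma scaleR_eq_scale: "x *\<^sub>R (v :: complex ^ 'n) = of_real x *s v"
  unfolding vec_eq_iff vector_scaleR_component vector_smult_component by (simp add: scaleR_conv_of_real)

text \<open>Rotating z to the axis turns the e-component of v into <v, z> / |z|. The result no
  longer mentions the rotation and describes the metric off the axis, where transverse derivatives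
  are taken.\<close>

lemma hform_formula:
  assumes "z \<noteq> 0"
  shows "hform g z v w = of_real (b (norm z)) * herm v w +
    of_real ((a (norm z) - b (norm z)) / (norm z)\<^sup>2) * (herm v z * herm z w)"
proof -
  obtain U where U: "unitary_matrix U" "U *v z = norm z *\<^sub>R E" by (rule unitary_to_axis)
  have comp: "(U *v v) $ e = herm v z / of_real (norm z)" for v
  proof -
    have "herm v z = herm (U *v v) (norm z *\<^sub>R E)" using herm_unitary[OF U(1)] U(2) by metis
    then show ?thesis using assms
      by (simp add: scaleR_E_component scaleR_eq_scale herm_scale_right)
  qed
  have "hform g z v w = hform g (norm z *\<^sub>R E) (U *v v) (U *v w)"
    using hform_unitary[OF U(1)] U(2) by metis
  then show ?thesis
    unfolding hform_on_axis herm_unitary[OF U(1)] comp herm_commute[of z w]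
    by (simp add: power2_eq_square mult.assoc)
qed

lemma a0_eq_b0: "a 0 = b 0"
  using g_diag_eq[of 0 e p] by (simp add: a_def b_def)

lemma a_pos: "a x > 0"
  using riem_pos[of "axis e 1" "x *\<^sub>R E"] by (simp add: riem_eq_hform hform_axis a_def)

text \<open>The curvature in the radial direction involves derivatives in the direction i E, which
  leave the real axis but stay in the complex line through E.\<close>

lemma g_radial_line: "g (w *s E) $ e $ e = of_real (a (cmod w))"
proof (cases "w = 0")
  case True
  then show ?thesis using g_on_axis[of 0 e e] by simp
next
  case False
  then have "w *s E \<noteq> 0" by (simp add: E_def vec_eq_iff axis_def)
  then have "hform g (w *s E) E E = of_real (b (norm (w *s E))) * herm E E +
      of_real ((a (norm (w *s E)) - b (norm (w *s E))) / (norm (w *s E))\<^sup>2) *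
        (herm E (w *s E) * herm (w *s E) E)"
    by (rule hform_formula)
  moreover have "herm E E = 1" by (simp add: herm_self)
  moreover have "norm (w *s E) = cmod w" by (simp add: norm_cscale)
  moreover have "hform g (w *s E) E E = g (w *s E) $ e $ e" by (simp add: E_def hform_axis)
  ultimately have "g (w *s E) $ e $ e = of_real (b (cmod w)) +
      of_real ((a (cmod w) - b (cmod w)) / (cmod w)\<^sup>2) * (cnj w * w)"
    by (simp only: herm_scale_left herm_scale_right mult_1_right)
  also have "cnj w * w = of_real ((cmod w)\<^sup>2)"
    by (simp only: complex_norm_square mult.commute)
  also have "of_real ((a (cmod w) - b (cmod w)) / (cmod w)\<^sup>2) * of_real ((cmod w)\<^sup>2) =
      complex_of_real (a (cmod w) - b (cmod w))"
    unfolding of_real_mult[symmetric] using False by simp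
  finally show ?thesis by simp
qed

end

section \<open>The inverse metric\<close>

lemma hform_eq_matrix: "hform g z v w = (\<Sum>\<alpha>\<in>UNIV. v $ \<alpha> * (g z *v (\<chi> \<beta>. cnj (w $ \<beta>))) $ \<alpha>)"
  by (simp add: hform_def matrix_vector_mult_def sum_distrib_left mult_ac)

lemma metric_invertible:
  assumes "hermitian_metric g"
  shows "matrix_inv (g z) ** g z = mat 1" "g z ** matrix_inv (g z) = mat 1"
proof -
  have "x = 0" if x: "g z *v x = 0" for x
  proof (rule ccontr)
    assume "x \<noteq> 0"
    \<comment> \<open>\<open>hform\<close> feeds the conjugate of its second argument to the matrix,
      so the conjugate of a kernel vector is a null vector of the positive form.\<close>
    define v where "v = (\<chi> \<beta>. cnj (x $ \<beta>))"
    have "v \<noteq> 0" using \<open>x \<noteq> 0\<close> by (auto simp: v_def vec_eq_iff)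
    then have "riem g z v v > 0" using assms unfolding hermitian_metric_def by blast
    moreover have "(\<chi> \<beta>. cnj (v $ \<beta>)) = x" by (simp add: v_def vec_eq_iff)
    then have "hform g z v v = 0" using x by (simp add: hform_eq_matrix)
    ultimately show False by (simp add: riem_eq_hform)
  qed
  then have "invertible (g z)"
    by (simp add: invertible_left_inverse matrix_left_invertible_ker)
  then show "matrix_inv (g z) ** g z = mat 1" "g z ** matrix_inv (g z) = mat 1"
    unfolding invertible_def matrix_inv_def by (metis (mono_tags, lifting) someI_ex)+
qed

lemma ginv_row:
  assumes "hermitian_metric g"
  shows "(\<Sum>\<beta>\<in>UNIV. ginv g z \<alpha> \<beta> * g z $ \<gamma> $ \<beta>) = (if \<gamma> = \<alpha> then 1 else 0)"
proof -
  have "(g z ** matrix_inv (g z)) $ \<gamma> $ \<alpha> = (if \<gamma> = \<alpha> then 1 else 0)"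
    unfolding metric_invertible(2)[OF assms] by (simp add: mat_def)
  then show ?thesis
    by (simp add: matrix_matrix_mult_def ginv_def mult.commute)
qed

text \<open>With \<open>u = g\<^sup>-\<^sup>1 \<xi>\<close> the left-hand side is \<open>g(u\<^sup>*, u\<^sup>*) = \<langle>u, \<xi>\<rangle>\<close>; so
  \<open>lam * |u|\<^sup>2 \<le> |u| * |\<xi>|\<close>.\<close>

lemma ginv_bound:
  assumes "hermitian_metric g" and lam: "lam > 0" and le: "\<And>v. lam * (norm v)\<^sup>2 \<le> riem g z v v"
  shows "Re (\<Sum>\<alpha>\<in>UNIV. \<Sum>\<beta>\<in>UNIV. ginv g z \<alpha> \<beta> * \<xi> $ \<alpha> * cnj (\<xi> $ \<beta>)) \<le> (norm \<xi>)\<^sup>2 / lam"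
proof -
  define u where "u = matrix_inv (g z) *v \<xi>"
  define v where "v = (\<chi> \<beta>. cnj (u $ \<beta>))"
  have xi: "g z *v u = \<xi>"
    unfolding u_def by (simp add: matrix_vector_mul_assoc metric_invertible[OF assms(1)])
  have vu: "(\<chi> \<beta>. cnj (v $ \<beta>)) = u" by (simp add: v_def vec_eq_iff)
  have nv: "norm v = norm u" by (simp add: v_def norm_vec_def)
  have S: "(\<Sum>\<alpha>\<in>UNIV. \<Sum>\<beta>\<in>UNIV. ginv g z \<alpha> \<beta> * \<xi> $ \<alpha> * cnj (\<xi> $ \<beta>)) = herm u \<xi>"
    unfolding herm_def u_def matrix_vector_mult_def ginv_def
    by (subst sum.swap) (simp add: sum_distrib_right)
  have "hform g z v v = cnj (herm u \<xi>)"
    unfolding hform_eq_matrix vu xi by (simp add: herm_def v_def)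
  then have R: "riem g z v v = Re (herm u \<xi>)" by (simp add: riem_eq_hform)
  have le1: "Re (herm u \<xi>) \<le> norm u * norm \<xi>"
    using norm_herm_le[of u \<xi>] complex_Re_le_cmod[of "herm u \<xi>"] by linarith
  have "lam * (norm u)\<^sup>2 \<le> norm u * norm \<xi>" using le[of v] R le1 nv by simp
  then have "lam * norm u \<le> norm \<xi>"
    by (cases "norm u = 0") (simp_all add: power2_eq_square mult_ac)
  then have "norm u \<le> norm \<xi> / lam" using lam by (simp add: field_simps)
  then have "norm u * norm \<xi> \<le> (norm \<xi>)\<^sup>2 / lam"
    using mult_right_mono[OF _ norm_ge_zero[of \<xi>]] by (fastforce simp: power2_eq_square)
  then show ?thesis unfolding S using le1 by linarith
qed

section \<open>The radial functions of the metric\<close>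

lemma line_deriv:
  assumes "C_class (Suc k) f"
  shows "((\<lambda>t. f (q + t *\<^sub>R v)) has_vector_derivative dir_deriv f v (q + t *\<^sub>R v)) (at t)"
proof -
  have d: "(f has_derivative (\<lambda>v. dir_deriv f v (q + t *\<^sub>R v'))) (at (q + t *\<^sub>R v'))" for v'
    by (rule C_class_has_derivative[OF assms])
  have "((\<lambda>t. q + t *\<^sub>R v) has_derivative (\<lambda>s. s *\<^sub>R v)) (at t)"
    by (auto intro!: derivative_eq_intros)
  from has_derivative_compose[OF this d]
  have "((\<lambda>t. f (q + t *\<^sub>R v)) has_derivative (\<lambda>s. dir_deriv f (s *\<^sub>R v) (q + t *\<^sub>R v))) (at t)" .
  moreover have "dir_deriv f (s *\<^sub>R v) (q + t *\<^sub>R v) = s *\<^sub>R dir_deriv f v (q + t *\<^sub>R v)" for s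
    by (rule linear_cmul[OF has_derivative_linear[OF d]])
  ultimately show ?thesis
    by (simp add: has_vector_derivative_def)
qed

lemma dir_deriv_vanishing_line:
  assumes "C_class (Suc k) f" and "\<And>t. f (q + t *\<^sub>R v) = 0"
  shows "dir_deriv f v q = 0"
proof -
  have "((\<lambda>t. f (q + t *\<^sub>R v)) has_vector_derivative dir_deriv f v (q + 0 *\<^sub>R v)) (at 0)"
    by (rule line_deriv[OF assms(1)])
  then have "((\<lambda>t::real. 0 :: 'b) has_vector_derivative dir_deriv f v q) (at 0)"
    using assms(2) by simp
  then show ?thesis
    using vector_derivative_unique_at[OF has_vector_derivative_const] by metis
qed

lemma Re_line_deriv:
  assumes "C_class (Suc k) f"
  shows "((\<lambda>t. Re (f (q + t *\<^sub>R v))) has_real_derivative Re (dir_deriv f v (q + t *\<^sub>R v))) (at t)"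
  using has_field_derivative_Re[OF line_deriv[OF assms]] .

lemma Im_dir_deriv:
  assumes "C_class (Suc k) f" "\<And>z. Im (f z) = 0"
  shows "Im (dir_deriv f v z) = 0"
proof -
  have "((\<lambda>t. Im (f (z + t *\<^sub>R v))) has_real_derivative Im (dir_deriv f v (z + 0 *\<^sub>R v))) (at 0)"
    using has_field_derivative_Im[OF line_deriv[OF assms(1)]] .
  then show ?thesis using DERIV_unique[OF _ DERIV_const] by (simp add: assms(2))
qed

text \<open>Caratheodory's description of the derivative: continuity of h suffices. It
  differentiates at 0 the functions below, whose factor y is explicit while h contains the square
  root of t^2 + y^2.\<close>

lemma DERIV_mult_self:
  fixes h :: "real \<Rightarrow> real"
  assumes "isCont h 0"
  shows "((\<lambda>y. h y * y) has_real_derivative h 0) (at 0)"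
  unfolding CARAT_DERIV using assms by (intro exI[of _ h]) simp

section \<open>Closedness and curvature as differential relations for the radial functions\<close>

context radial_metric
begin

lemma C_class_kaehler_form: "C_class k (\<lambda>q. kaehler_form g q v w)"
  unfolding kaehler_form_def riem_def
  by (intro C_class_compose_linear[OF bounded_linear_Re] C_class_sum C_class_mult C_class_const smooth_g)

definition a1 :: "real \<Rightarrow> real"
  where "a1 t = Re (dir_deriv (\<lambda>z. g z $ e $ e) E (t *\<^sub>R E))"
definition a2 :: "real \<Rightarrow> real"
  where "a2 t = Re (dir_deriv (dir_deriv (\<lambda>z. g z $ e $ e) E) E (t *\<^sub>R E))"

lemma C_class_dir_g: "C_class k (dir_deriv (\<lambda>z. g z $ i $ j) v)"
  using smooth_g[of "Suc k" i j] by simp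

lemma a_deriv: "(a has_real_derivative a1 t) (at t)"
  using Re_line_deriv[OF smooth_g[of "Suc 0" e e], of 0 E t] by (simp add: a_def[abs_def] a1_def)

lemma a1_deriv: "(a1 has_real_derivative a2 t) (at t)"
  using Re_line_deriv[OF C_class_dir_g[of "Suc 0" e e E], of 0 E t] by (simp add: a1_def[abs_def] a2_def)

lemma b_deriv0: "\<exists>d. (b has_real_derivative d) (at t)"
  using Re_line_deriv[OF smooth_g[of "Suc 0" p p], of 0 E t] by (auto simp: b_def[abs_def])

lemma isCont_a: "isCont a t" and isCont_b: "isCont b t" and isCont_a1: "isCont a1 t"
  using a_deriv b_deriv0 a1_deriv DERIV_isCont by blast+

lemma norm_axis_plane:
  assumes "cmod c = 1"
  shows "norm (t *\<^sub>R E + y *\<^sub>R axis p c) = sqrt (t\<^sup>2 + y\<^sup>2)"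
proof -
  have "c \<bullet> c = 1" using assms by (simp add: norm_eq_1)
  then have "(norm (t *\<^sub>R E + y *\<^sub>R axis p c))\<^sup>2 = t\<^sup>2 + y\<^sup>2"
    unfolding power2_norm_eq_inner E_def
    using ep by (simp add: inner_add_left inner_add_right inner_axis_axis power2_eq_square)
  then show ?thesis by (metis norm_ge_zero real_sqrt_unique)
qed

text \<open>These are the mixed radial-tangential coefficients just off the axis. They vanish
  linearly in the displacement y, with slope (a - b) / t at y = 0 up to the phase.\<close>

lemma hform_plane:
  assumes c: "cmod c = 1" and t: "t > 0"
  shows "hform g (t *\<^sub>R E + y *\<^sub>R axis p c) (axis p 1) E =
      of_real ((a (sqrt (t\<^sup>2 + y\<^sup>2)) - b (sqrt (t\<^sup>2 + y\<^sup>2))) / (t\<^sup>2 + y\<^sup>2) * y * t) * cnj c" (is ?A)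
    and "hform g (t *\<^sub>R E + y *\<^sub>R axis p c) E (axis p 1) =
      of_real ((a (sqrt (t\<^sup>2 + y\<^sup>2)) - b (sqrt (t\<^sup>2 + y\<^sup>2))) / (t\<^sup>2 + y\<^sup>2) * y * t) * c" (is ?B)
proof -
  let ?z = "t *\<^sub>R E + y *\<^sub>R axis p c"
  have n: "norm ?z = sqrt (t\<^sup>2 + y\<^sup>2)" by (rule norm_axis_plane[OF c])
  have "t\<^sup>2 + y\<^sup>2 > 0" using t by (simp add: add_pos_nonneg)
  then have z: "?z \<noteq> 0" using n by fastforce
  have n2: "(norm ?z)\<^sup>2 = t\<^sup>2 + y\<^sup>2" by (simp add: n)
  have h: "herm (axis p 1) E = 0" "herm E (axis p 1) = 0"
    using ep unfolding E_def herm_axis_left by (simp_all add: axis_def)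
  have h2: "herm (axis p 1) ?z = of_real y * cnj c" "herm ?z (axis p 1) = of_real y * c"
      "herm E ?z = of_real t" "herm ?z E = of_real t"
    using ep unfolding E_def herm_axis_left herm_axis_right
    by (simp_all add: axis_def scaleR_conv_of_real[where 'a = complex])
  show ?A ?B
    using hform_formula[OF z, of "axis p 1" E] hform_formula[OF z, of E "axis p 1"]
    by (simp_all add: h h2 n n2 mult_ac)
qed

text \<open>Closedness is evaluated at t E on the triple E, e_p, i e_p. The derivative along E of
  the area form in the e_p-plane is b', and each of the other two terms is the slope -(a - b) / t of
  a mixed coefficient.\<close>

lemma b_deriv:
  assumes K: "kaehler_metric g" and t: "t > 0"
  shows "(b has_real_derivative 2 * (a t - b t) / t) (at t)"
proof -
  let ?P = "axis p 1 :: complex ^ 'n" and ?Q = "axis p \<i> :: complex ^ 'n"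
  let ?z = "t *\<^sub>R E"
  define D1 where "D1 = dir_deriv (\<lambda>q. kaehler_form g q ?P ?Q) E ?z"
  define D2 where "D2 = dir_deriv (\<lambda>q. kaehler_form g q ?Q E) ?P ?z"
  define D3 where "D3 = dir_deriv (\<lambda>q. kaehler_form g q E ?P) ?Q ?z"
  have sum0: "D1 + D2 + D3 = 0"
    using K unfolding kaehler_metric_def D1_def D2_def D3_def by blast
  have QP: "?Q = \<i> *s ?P" "\<i> *s ?Q = (-1) *s ?P" by (auto simp: vec_eq_iff axis_def)
  have k1: "kaehler_form g q ?P ?Q = Re (g q $ p $ p)" for q
    by (simp add: kaehler_form_def riem_eq_hform hform_scale_left hform_axis)
  have k2: "kaehler_form g q ?Q E = - Re (hform g q ?P E)" for q
    unfolding kaehler_form_def riem_eq_hform QP(2) hform_scale_left by simp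
  have k3: "kaehler_form g q E ?P = - Im (hform g q E ?P)" for q
    by (simp add: kaehler_form_def riem_eq_hform hform_scale_left)
  have line: "((\<lambda>s. kaehler_form g (q + s *\<^sub>R u) v w) has_real_derivative
      dir_deriv (\<lambda>q. kaehler_form g q v w) u (q + s *\<^sub>R u)) (at s)" for q u v w s
    unfolding has_real_derivative_iff_has_vector_derivative
    by (rule line_deriv[OF C_class_kaehler_form[of "Suc 0"]])
  define h where "h y = - ((a (sqrt (t\<^sup>2 + y\<^sup>2)) - b (sqrt (t\<^sup>2 + y\<^sup>2))) / (t\<^sup>2 + y\<^sup>2) * t)" for y
  have "isCont h 0"
    unfolding h_def using t
    by (intro continuous_intros isCont_o2[OF _ isCont_a] isCont_o2[OF _ isCont_b]) simp_all
  then have hd: "((\<lambda>y. h y * y) has_real_derivative h 0) (at 0)" by (rule DERIV_mult_self)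
  have "((\<lambda>y. kaehler_form g (?z + y *\<^sub>R ?P) ?Q E) has_real_derivative D2) (at 0)"
    using line[of ?z ?P ?Q E 0] by (simp add: D2_def)
  moreover have "kaehler_form g (?z + y *\<^sub>R ?P) ?Q E = h y * y" for y
    unfolding k2 hform_plane(1)[OF norm_one t] h_def by (simp add: mult_ac)
  ultimately have D2: "D2 = h 0" using DERIV_unique[OF _ hd] by simp
  have "((\<lambda>y. kaehler_form g (?z + y *\<^sub>R ?Q) E ?P) has_real_derivative D3) (at 0)"
    using line[of ?z ?Q E ?P 0] by (simp add: D3_def)
  moreover have "kaehler_form g (?z + y *\<^sub>R ?Q) E ?P = h y * y" for y
    unfolding k3 hform_plane(2)[OF norm_ii t] h_def by (simp add: mult_ac)
  ultimately have D3: "D3 = h 0" using DERIV_unique[OF _ hd] by simp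
  have "(b has_real_derivative D1) (at t)"
    using line[of 0 E ?P ?Q t] by (simp add: D1_def k1 b_def[abs_def])
  moreover have "h 0 = - ((a t - b t) / t)"
    using t by (simp add: h_def power2_eq_square)
  then have "D1 = 2 * ((a t - b t) / t)"
    using sum0 D2 D3 by linarith
  then have "D1 = 2 * (a t - b t) / t" by simp
  ultimately show ?thesis by simp
qed

text \<open>With Z = W = E, four times the curvature is the right side minus the left side: the
  coefficient g_ee is radial on the complex line through E, so its Laplacian there is a'' + a' / t,
  and the first derivatives of the off-diagonal coefficients vanish.\<close>

lemma curvature_ineq:
  assumes nb: "nonneg_bisectional g" and t: "t > 0"
  shows "a2 t + a1 t / t \<le> (a1 t)\<^sup>2 / a t"
proof -
  let ?z = "t *\<^sub>R E" and ?I = "axis e \<i> :: complex ^ 'n"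
  let ?\<phi> = "\<lambda>z. g z $ e $ e"
  let ?DE = "dir_deriv ?\<phi> E" and ?DI = "dir_deriv ?\<phi> ?I"
  have I: "?I = \<i> *s E" by (auto simp: vec_eq_iff axis_def E_def)
  have line_pt: "?z + y *\<^sub>R ?I = Complex t y *s E" for y
    by (auto simp: vec_eq_iff axis_def E_def complex_eq_iff)
  have r: "cmod (Complex t y) = sqrt (t\<^sup>2 + y\<^sup>2)" for y by (simp add: complex_norm)
  have pos: "t\<^sup>2 + y\<^sup>2 > 0" for y using t by (simp add: add_pos_nonneg)
  \<comment> \<open>At height y over t the radius r = sqrt (t^2 + y^2) has derivative y / r. So
    \<open>h y * y\<close> is the derivative of the coefficient in direction i E, and
    \<open>h 0\<close> is its second derivative at the axis.\<close>
  define h where "h y = a1 (sqrt (t\<^sup>2 + y\<^sup>2)) / sqrt (t\<^sup>2 + y\<^sup>2)" for y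
  have DI: "Re (?DI (?z + y *\<^sub>R ?I)) = h y * y" for y
  proof -
    have "((\<lambda>y. Re (?\<phi> (?z + y *\<^sub>R ?I))) has_real_derivative Re (?DI (?z + y *\<^sub>R ?I))) (at y)"
      by (rule Re_line_deriv[OF smooth_g[of "Suc 0"]])
    then have "((\<lambda>y. a (sqrt (t\<^sup>2 + y\<^sup>2))) has_real_derivative Re (?DI (?z + y *\<^sub>R ?I))) (at y)"
      by (simp add: line_pt g_radial_line r)
    moreover have "((\<lambda>y. a (sqrt (t\<^sup>2 + y\<^sup>2))) has_real_derivative h y * y) (at y)"
    proof -
      have "((\<lambda>y. sqrt (t\<^sup>2 + y\<^sup>2)) has_real_derivative y / sqrt (t\<^sup>2 + y\<^sup>2)) (at y)"
        using pos[of y] by (auto intro!: derivative_eq_intros simp: field_simps)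
      from DERIV_chain2[where f = a, OF a_deriv this] show ?thesis
        by (simp add: h_def)
    qed
    ultimately show ?thesis by (rule DERIV_unique)
  qed
  have "isCont h 0"
    unfolding h_def using t by (intro continuous_intros isCont_o2[OF _ isCont_a1]) simp_all
  then have hd: "((\<lambda>y. h y * y) has_real_derivative h 0) (at 0)" by (rule DERIV_mult_self)
  have "((\<lambda>y. Re (?DI (?z + y *\<^sub>R ?I))) has_real_derivative Re (dir_deriv ?DI ?I (?z + 0 *\<^sub>R ?I))) (at 0)"
    by (rule Re_line_deriv[OF C_class_dir_g[of "Suc 0"]])
  then have DII: "Re (dir_deriv ?DI ?I ?z) = a1 t / t"
    unfolding DI using DERIV_unique[OF _ hd] t by (simp add: h_def)
  have DI0: "?DI ?z = 0"
  proof -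
    have "Re (?DI ?z) = 0" using DI[of 0] by simp
    moreover have "Im (?DI ?z) = 0"
      by (rule Im_dir_deriv[OF smooth_g[of "Suc 0"]]) (use g_diag_real in \<open>metis Im_complex_of_real\<close>)
    ultimately show ?thesis by (simp add: complex_eq_iff)
  qed
  have imE: "Im (?DE z) = 0" and imI: "Im (?DI z) = 0" for z
    by (rule Im_dir_deriv[OF smooth_g[of "Suc 0"]], use g_diag_real in \<open>metis Im_complex_of_real\<close>)+
  have im2: "Im (dir_deriv ?DE v z) = 0" "Im (dir_deriv ?DI v z) = 0" for v z
    by (rule Im_dir_deriv[OF C_class_dir_g[of "Suc 0"]], rule imE imI)+
  have DE: "?DE ?z = of_real (a1 t)" using imE[of ?z] by (simp add: a1_def complex_eq_iff)
  have dd: "dir_deriv (wirt_bar e ?\<phi>) v ?z = (dir_deriv ?DE v ?z + \<i> * dir_deriv ?DI v ?z) / 2" for v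
  proof (rule dir_deriv_eqI)
    show "(wirt_bar e ?\<phi> has_derivative (\<lambda>v. (dir_deriv ?DE v ?z + \<i> * dir_deriv ?DI v ?z) / 2)) (at ?z)"
      unfolding wirt_bar_def[abs_def] E_def[symmetric]
      by (auto intro!: derivative_eq_intros C_class_has_derivative[OF C_class_dir_g[of "Suc 0"]])
  qed
  \<comment> \<open>All second derivatives of the real coefficient g_ee are real, so the mixed ones
    enter with a factor i and drop out of the real part.\<close>
  have W2: "Re (wirt e (wirt_bar e ?\<phi>) ?z) = (a2 t + a1 t / t) / 4"
    unfolding wirt_def[of e "wirt_bar e ?\<phi>"] E_def[symmetric] dd using im2[of _ ?z] DII by (simp add: a2_def)
  have W1: "wirt e ?\<phi> ?z = of_real (a1 t / 2)" "wirt_bar e ?\<phi> ?z = of_real (a1 t / 2)"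
    unfolding wirt_def wirt_bar_def E_def[symmetric] by (simp_all add: DE DI0)
  have off: "wirt e (\<lambda>q. g q $ e $ \<nu>) ?z = 0" "wirt_bar e (\<lambda>q. g q $ \<nu> $ e) ?z = 0" if "\<nu> \<noteq> e" for \<nu>
  proof -
    have comp: "(?z + s *\<^sub>R E) $ \<nu> = 0" "(?z + s *\<^sub>R ?I) $ \<nu> = 0" for s
      using that by (simp_all add: E_def axis_def)
    have "dir_deriv (\<lambda>q. g q $ e $ \<nu>) E ?z = 0" "dir_deriv (\<lambda>q. g q $ e $ \<nu>) ?I ?z = 0"
      "dir_deriv (\<lambda>q. g q $ \<nu> $ e) E ?z = 0" "dir_deriv (\<lambda>q. g q $ \<nu> $ e) ?I ?z = 0"
      by (rule dir_deriv_vanishing_line[OF smooth_g[of "Suc 0"]],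
          rule g_offdiag[OF comp(1)] g_offdiag[OF comp(2)], use that in simp)+
    then show "wirt e (\<lambda>q. g q $ e $ \<nu>) ?z = 0" "wirt_bar e (\<lambda>q. g q $ \<nu> $ e) ?z = 0"
      by (simp_all add: wirt_def wirt_bar_def E_def)
  qed
  have gi: "ginv g ?z e e = of_real (1 / a t)"
  proof -
    have "(\<Sum>\<beta>\<in>UNIV. ginv g ?z e \<beta> * g ?z $ e $ \<beta>) = 1" by (simp add: ginv_row[OF herm_met])
    moreover have "(\<Sum>\<beta>\<in>UNIV. ginv g ?z e \<beta> * g ?z $ e $ \<beta>) =
        (\<Sum>\<beta>\<in>UNIV. if \<beta> = e then ginv g ?z e e * of_real (a t) else 0)"
      by (rule sum.cong) (auto simp: g_on_axis)
    ultimately show ?thesis using a_pos[of t] by (simp add: field_simps)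
  qed
  have S: "(\<Sum>\<mu>\<in>UNIV. \<Sum>\<nu>\<in>UNIV. ginv g ?z \<mu> \<nu> * wirt e (\<lambda>q. g q $ e $ \<nu>) ?z * wirt_bar e (\<lambda>q. g q $ \<mu> $ e) ?z)
      = (\<Sum>\<mu>\<in>UNIV. \<Sum>\<nu>\<in>UNIV. if \<nu> = e then if \<mu> = e then
          ginv g ?z e e * wirt e ?\<phi> ?z * wirt_bar e ?\<phi> ?z else 0 else 0)"
    by (intro sum.cong refl) (auto simp: off)
  have "curv g ?z e e e e = - wirt e (wirt_bar e ?\<phi>) ?z + of_real ((a1 t)\<^sup>2 / a t / 4)"
    unfolding curv_def S by (simp add: gi W1 power2_eq_square)
  then have "Re (curv g ?z e e e e) = - ((a2 t + a1 t / t) / 4) + (a1 t)\<^sup>2 / a t / 4"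
    by (simp only: plus_complex.simps uminus_complex.simps Re_complex_of_real W2)
  moreover have "bisectional g ?z E E = curv g ?z e e e e"
  proof -
    have "bisectional g ?z E E = (\<Sum>\<alpha>\<in>UNIV. \<Sum>\<beta>\<in>UNIV. \<Sum>\<gamma>\<in>UNIV. \<Sum>\<delta>\<in>UNIV.
        if \<delta> = e then if \<gamma> = e then if \<beta> = e then if \<alpha> = e then curv g ?z e e e e else 0 else 0 else 0 else 0)"
      unfolding bisectional_def by (intro sum.cong refl) (auto simp: E_def axis_def)
    then show ?thesis by simp
  qed
  moreover have "Re (bisectional g ?z E E) \<ge> 0" using nb unfolding nonneg_bisectional_def by blast
  ultimately show ?thesis by simp
qed

end

section \<open>Lengths of paths\<close>

lemma riem_nonneg: "hermitian_metric g \<Longrightarrow> riem g z v v \<ge> 0"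
proof (cases "v = 0")
  case True
  then show ?thesis by (simp add: riem_def)
next
  case False
  moreover assume "hermitian_metric g"
  ultimately show ?thesis unfolding hermitian_metric_def by (simp add: less_imp_le)
qed

lemma gdist_bdd_below:
  assumes "hermitian_metric g"
  shows "bdd_below {L. \<exists>\<gamma>. valid_path \<gamma> \<and> pathstart \<gamma> = x \<and> pathfinish \<gamma> = y \<and>
    ((\<lambda>t. sqrt (riem g (\<gamma> t) (vector_derivative \<gamma> (at t)) (vector_derivative \<gamma> (at t))))
      has_integral L) {0..1}}"
  by (intro bdd_belowI[of _ 0]) (auto elim!: has_integral_nonneg simp: riem_nonneg[OF assms])

text \<open>The infimum in \<open>gdist\<close> ranges over paths whose length integral exists; this
  shows that straight segments are among them.\<close>

lemma linepath_length:
  fixes g :: "'n::finite metric" and x y :: "complex ^ 'n"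
  assumes "hermitian_metric g"
  defines "f \<equiv> \<lambda>t. sqrt (riem g (linepath x y t) (y - x) (y - x))"
  shows "f integrable_on {0..1}"
    and "((\<lambda>t. sqrt (riem g (linepath x y t) (vector_derivative (linepath x y) (at t))
        (vector_derivative (linepath x y) (at t)))) has_integral (integral {0..1} f)) {0..1}"
proof -
  have "continuous_on UNIV (\<lambda>z. g z $ \<alpha> $ \<beta>)" for \<alpha> \<beta>
    using assms(1) unfolding hermitian_metric_def smooth_def by (metis C_class.simps(1))
  then have cont: "continuous_on {0..1} (\<lambda>t. g (linepath x y t) $ \<alpha> $ \<beta>)" for \<alpha> \<beta>
    using continuous_on_compose2[OF _ continuous_on_linepath[of "{0..1}" x y], of UNIV "\<lambda>z. g z $ \<alpha> $ \<beta>"] by simp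
  show i: "f integrable_on {0..1}"
    unfolding f_def riem_def
    by (intro integrable_continuous_real continuous_intros cont)
  have "vector_derivative (linepath x y) (at t) = y - x" for t
    by (rule vector_derivative_at) (rule has_vector_derivative_linepath_within)
  then show "((\<lambda>t. sqrt (riem g (linepath x y t) (vector_derivative (linepath x y) (at t))
        (vector_derivative (linepath x y) (at t)))) has_integral (integral {0..1} f)) {0..1}"
    using integrable_integral[OF i] by (simp add: f_def)
qed

lemma gdist_le_linepath:
  assumes "hermitian_metric g"
  shows "gdist g x y \<le> integral {0..1} (\<lambda>t. sqrt (riem g (linepath x y t) (y - x) (y - x)))"
  unfolding gdist_def
  by (rule cInf_lower[OF _ gdist_bdd_below[OF assms]])
     (auto intro!: exI[of _ "linepath x y"] linepath_length assms)

text \<open>After the last time at distance at least 1 from x the path stays in the unit ball about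
  x, where its speed is at least \<epsilon> times the Euclidean speed; the displacement from there
  to x is at least 1.\<close>

lemma path_length_ge:
  fixes \<gamma> :: "real \<Rightarrow> complex ^ 'n::finite"
  assumes g: "hermitian_metric g" and \<gamma>: "valid_path \<gamma>" and far: "dist (pathstart \<gamma>) x \<ge> 1"
    and fin: "pathfinish \<gamma> = x"
    and low: "\<And>z v. dist z x < 1 \<Longrightarrow> \<epsilon> * norm v \<le> sqrt (riem g z v v)" and eps: "\<epsilon> > 0"
    and L: "((\<lambda>t. sqrt (riem g (\<gamma> t) (vector_derivative \<gamma> (at t)) (vector_derivative \<gamma> (at t))))
      has_integral L) {0..1}"
  shows "\<epsilon> \<le> L"
proof -
  define f where "f t = sqrt (riem g (\<gamma> t) (vector_derivative \<gamma> (at t)) (vector_derivative \<gamma> (at t)))" for t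
  have cont: "continuous_on {0..1} \<gamma>" using valid_path_imp_path[OF \<gamma>] by (simp add: path_def)
  obtain S where S: "finite S" "\<gamma> C1_differentiable_on {0..1} - S"
    using \<gamma> unfolding valid_path_def piecewise_C1_differentiable_on_def by blast
  define T where "T = {0..1} \<inter> (\<lambda>t. dist (\<gamma> t) x) -` {1..}"
  have "closed T"
    unfolding T_def
    by (intro continuous_closed_preimage continuous_intros cont)
  then have "compact T"
    using compact_Int_closed[of "{0..1::real}" T] by (simp add: T_def Int_assoc[symmetric])
  moreover have "0 \<in> T" using far by (simp add: T_def pathstart_def)
  ultimately obtain \<tau> where \<tau>: "\<tau> \<in> T" "\<And>t. t \<in> T \<Longrightarrow> t \<le> \<tau>"
    using compact_attains_sup[of T] by blast
  have \<tau>1: "0 \<le> \<tau>" "\<tau> \<le> 1" "dist (\<gamma> \<tau>) x \<ge> 1" using \<tau>(1) by (auto simp: T_def)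
  have after: "dist (\<gamma> t) x < 1" if "\<tau> < t" "t < 1" for t
    using \<tau>(2)[of t] that \<tau>1 by (force simp: T_def)
  have "(\<lambda>t. vector_derivative \<gamma> (at t)) integrable_on {\<tau>..1}"
    and "integral {\<tau>..1} (\<lambda>t. vector_derivative \<gamma> (at t)) = \<gamma> 1 - \<gamma> \<tau>"
  proof -
    have "((\<lambda>t. vector_derivative \<gamma> (at t)) has_integral (\<gamma> 1 - \<gamma> \<tau>)) {\<tau>..1}"
    proof (rule fundamental_theorem_of_calculus_interior_strong[OF S(1) \<tau>1(2)])
      show "continuous_on {\<tau>..1} \<gamma>" using cont by (rule continuous_on_subset) (use \<tau>1 in auto)
      show "(\<gamma> has_vector_derivative vector_derivative \<gamma> (at t)) (at t)" if "t \<in> {\<tau><..<1} - S" for t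
        using S(2) that \<tau>1 by (auto simp: C1_differentiable_on_eq vector_derivative_works)
    qed
    then show "(\<lambda>t. vector_derivative \<gamma> (at t)) integrable_on {\<tau>..1}"
      "integral {\<tau>..1} (\<lambda>t. vector_derivative \<gamma> (at t)) = \<gamma> 1 - \<gamma> \<tau>"
      by (auto simp: integral_unique)
  qed note d = this
  have fi: "f integrable_on {0..1}" and fL: "integral {0..1} f = L"
    using L by (auto simp: f_def[abs_def] integral_unique)
  have f\<tau>: "f integrable_on {\<tau>..1}"
    by (rule integrable_on_subinterval[OF fi]) (use \<tau>1 in auto)
  \<comment> \<open>The lower bound on the metric holds strictly inside the unit ball, hence on the
    open interval; integrals over the open and the closed interval agree.\<close>
  have "norm (integral {\<tau><..<1} (\<lambda>t. vector_derivative \<gamma> (at t))) \<le> integral {\<tau><..<1} (\<lambda>t. f t / \<epsilon>)"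
  proof (rule integral_norm_bound_integral)
    show "(\<lambda>t. vector_derivative \<gamma> (at t)) integrable_on {\<tau><..<1}"
      using d(1) by (simp add: integrable_on_Icc_iff_Ioo)
    show "(\<lambda>t. f t / \<epsilon>) integrable_on {\<tau><..<1}"
      using integrable_on_cmult_right[OF f\<tau>, of "1 / \<epsilon>"] by (simp add: integrable_on_Icc_iff_Ioo)
    show "norm (vector_derivative \<gamma> (at t)) \<le> f t / \<epsilon>" if "t \<in> {\<tau><..<1}" for t
      using low[OF after, of t "vector_derivative \<gamma> (at t)"] that eps by (simp add: f_def field_simps)
  qed
  then have "norm (\<gamma> 1 - \<gamma> \<tau>) \<le> integral {\<tau>..1} f / \<epsilon>"
    using d(2) by (simp add: integral_open_interval_real)
  also have "integral {\<tau>..1} f \<le> integral {0..1} f"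
    by (rule integral_subset_le[OF _ f\<tau> fi]) (use \<tau>1 in \<open>auto simp: f_def riem_nonneg[OF g]\<close>)
  finally have "norm (\<gamma> 1 - \<gamma> \<tau>) \<le> L / \<epsilon>" using eps fL by (simp add: divide_right_mono)
  moreover have "norm (\<gamma> 1 - \<gamma> \<tau>) \<ge> 1"
    using \<tau>1(3) fin by (simp add: dist_norm pathfinish_def norm_minus_commute)
  ultimately have "1 \<le> L / \<epsilon>" by linarith
  then show ?thesis using eps by (simp add: field_simps)
qed

lemma gdist_ge:
  fixes x y :: "complex ^ 'n::finite"
  assumes g: "hermitian_metric g" and far: "dist y x \<ge> 1"
    and low: "\<And>z v. dist z x < 1 \<Longrightarrow> \<epsilon> * norm v \<le> sqrt (riem g z v v)" and eps: "\<epsilon> > 0"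
  shows "\<epsilon> \<le> gdist g y x"
  unfolding gdist_def
proof (rule cInf_greatest)
  show "{L. \<exists>\<gamma>. valid_path \<gamma> \<and> pathstart \<gamma> = y \<and> pathfinish \<gamma> = x \<and>
    ((\<lambda>t. sqrt (riem g (\<gamma> t) (vector_derivative \<gamma> (at t)) (vector_derivative \<gamma> (at t))))
      has_integral L) {0..1}} \<noteq> {}"
    using linepath_length(2)[OF g, of y x] valid_path_linepath pathstart_linepath pathfinish_linepath by blast
qed (use path_length_ge[OF g _ _ _ low eps] far in blast)

section \<open>Consequences of curvature and completeness\<close>

locale radial_kaehler = radial_metric g e p for g :: "'n::finite metric" and e p :: 'n +
  assumes kaehler: "kaehler_metric g" and nonneg: "nonneg_bisectional g" and complete: "complete_metric g"
begin

definition eta :: "real \<Rightarrow> real" where "eta t = t * a1 t / a t"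

lemma cont_a: "continuous_on S a" and cont_b: "continuous_on S b" and cont_a1: "continuous_on S a1"
  by (simp_all add: continuous_at_imp_continuous_on isCont_a isCont_b isCont_a1)

text \<open>The derivative is t / a times the defect in the curvature inequality. That inequality is
  available for t > 0, so the left endpoint 0 is reached by continuity.\<close>

lemma eta_antimono:
  assumes "0 \<le> x" "x \<le> y"
  shows "eta y \<le> eta x"
  using assms(2)
proof (rule DERIV_nonpos_imp_decreasing_open)
  fix t assume t: "x < t" "t < y"
  then have t0: "t > 0" using assms by simp
  have "(eta has_real_derivative ((a1 t + t * a2 t) * a t - t * a1 t * a1 t) / (a t * a t)) (at t)"
    unfolding eta_def using a_pos[of t]
    by (auto intro!: derivative_eq_intros a_deriv a1_deriv)
  moreover have "((a1 t + t * a2 t) * a t - t * a1 t * a1 t) / (a t * a t) \<le> 0"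
  proof -
    have "((a1 t + t * a2 t) * a t - t * a1 t * a1 t) / (a t * a t) =
        t / a t * (a2 t + a1 t / t - (a1 t)\<^sup>2 / a t)"
      using a_pos[of t] t0 by (simp add: field_simps power2_eq_square)
    moreover have "t / a t * (a2 t + a1 t / t - (a1 t)\<^sup>2 / a t) \<le> 0"
      using curvature_ineq[OF nonneg t0] a_pos[of t] t0 by (intro mult_nonneg_nonpos) auto
    ultimately show ?thesis by simp
  qed
  ultimately show "\<exists>d. (eta has_real_derivative d) (at t) \<and> d \<le> 0" by blast
next
  show "continuous_on {x..y} eta"
    unfolding eta_def using a_pos
    by (intro continuous_intros cont_a cont_a1) (simp add: less_imp_neq[symmetric])
qed

lemma a1_nonpos: "t \<ge> 0 \<Longrightarrow> t * a1 t \<le> 0"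
  using eta_antimono[of 0 t] a_pos[of t] by (simp add: eta_def field_simps)

lemma a_antimono: "0 \<le> x \<Longrightarrow> x \<le> y \<Longrightarrow> a y \<le> a x"
proof -
  assume "0 \<le> x" "x \<le> y"
  from this(2) show ?thesis
  proof (rule DERIV_nonpos_imp_decreasing_open[OF _ _ cont_a])
    fix t assume t: "x < t" "t < y"
    then have "a1 t \<le> 0" using a1_nonpos[of t] \<open>0 \<le> x\<close> by (simp add: mult_le_0_iff)
    then show "\<exists>d. (a has_real_derivative d) (at t) \<and> d \<le> 0" using a_deriv by blast
  qed
qed

text \<open>The relation for b' says that t^2 b has derivative 2 t a, so b t is the mean of a over
  [0, t] with weight 2 x / t^2. As a mean of a decreasing function it lies between a t and a 0; the
  proof expresses this by two monotone functions that vanish at 0.\<close>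

lemma b_bounds:
  assumes "t \<ge> 0"
  shows "a t \<le> b t" "b t \<le> a 0"
proof -
  have "a t \<le> b t \<and> b t \<le> a 0"
  proof (cases "t = 0")
    case True
    then show ?thesis using a0_eq_b0 by simp
  next
    case False
    then have t: "0 < t" using assms by simp
    have "0\<^sup>2 * (b 0 - a 0) \<le> t\<^sup>2 * (b t - a t)"
    proof (rule DERIV_nonneg_imp_increasing_open[OF less_imp_le[OF t]])
      fix x assume x: "0 < x" "x < t"
      have "((\<lambda>x. x\<^sup>2 * (b x - a x)) has_real_derivative - (x * (x * a1 x))) (at x)"
        using x by (auto intro!: derivative_eq_intros b_deriv[OF kaehler] a_deriv
            simp: power2_eq_square field_simps)
      moreover have "- (x * (x * a1 x)) \<ge> 0"
        using x a1_nonpos[of x] by (simp add: mult_nonneg_nonpos)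
      ultimately show "\<exists>d. ((\<lambda>x. x\<^sup>2 * (b x - a x)) has_real_derivative d) (at x) \<and> d \<ge> 0" by blast
    qed (intro continuous_intros cont_a cont_b)
    moreover have "t\<^sup>2 * (b t - a 0) \<le> 0\<^sup>2 * (b 0 - a 0)"
    proof (rule DERIV_nonpos_imp_decreasing_open[OF less_imp_le[OF t]])
      fix x assume x: "0 < x" "x < t"
      have "((\<lambda>x. x\<^sup>2 * (b x - a 0)) has_real_derivative 2 * x * (a x - a 0)) (at x)"
        using x by (auto intro!: derivative_eq_intros b_deriv[OF kaehler]
            simp: power2_eq_square field_simps)
      moreover have "2 * x * (a x - a 0) \<le> 0"
        using x a_antimono[of 0 x] by (intro mult_nonneg_nonpos) auto
      ultimately show "\<exists>d. ((\<lambda>x. x\<^sup>2 * (b x - a 0)) has_real_derivative d) (at x) \<and> d \<le> 0" by blast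
    qed (intro continuous_intros cont_b)
    ultimately show ?thesis using t by (simp add: zero_le_mult_iff mult_le_0_iff)
  qed
  then show "a t \<le> b t" "b t \<le> a 0" by auto
qed

text \<open>The form is b |v|^2 minus the nonnegative number b - a times the squared radial part of
  v, and by Cauchy-Schwarz that part is at most |v|^2.\<close>

lemma riem_bounds:
  shows "a (norm z) * (norm v)\<^sup>2 \<le> riem g z v v" "riem g z v v \<le> b (norm z) * (norm v)\<^sup>2"
proof -
  have "a (norm z) * (norm v)\<^sup>2 \<le> riem g z v v \<and> riem g z v v \<le> b (norm z) * (norm v)\<^sup>2"
  proof (cases "z = 0")
    case True
    then show ?thesis
      using hform_on_axis[of 0 v v] a0_eq_b0 by (simp add: riem_eq_hform herm_self)
  next
    case False
    have "hform g z v v = of_real (b (norm z) * (norm v)\<^sup>2 +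
        (a (norm z) - b (norm z)) / (norm z)\<^sup>2 * (cmod (herm v z))\<^sup>2)"
      unfolding hform_formula[OF False] herm_self herm_commute[of z v] complex_norm_square[symmetric]
      by simp
    then have r: "riem g z v v = b (norm z) * (norm v)\<^sup>2 -
        (b (norm z) - a (norm z)) / (norm z)\<^sup>2 * (cmod (herm v z))\<^sup>2"
      unfolding riem_eq_hform by (simp only: Re_complex_of_real) (simp add: diff_divide_distrib algebra_simps)
    have c: "(b (norm z) - a (norm z)) / (norm z)\<^sup>2 \<ge> 0" using b_bounds(1)[of "norm z"] by simp
    have "(cmod (herm v z))\<^sup>2 \<le> (norm v)\<^sup>2 * (norm z)\<^sup>2"
      using power_mono[OF norm_herm_le[of v z] norm_ge_zero, of 2] by (simp add: power_mult_distrib)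
    then have "(b (norm z) - a (norm z)) / (norm z)\<^sup>2 * (cmod (herm v z))\<^sup>2 \<le>
        (b (norm z) - a (norm z)) / (norm z)\<^sup>2 * ((norm v)\<^sup>2 * (norm z)\<^sup>2)"
      using c by (rule mult_left_mono)
    also have "\<dots> = (b (norm z) - a (norm z)) * (norm v)\<^sup>2" using False by simp
    finally show ?thesis using r mult_nonneg_nonneg[OF c, of "(cmod (herm v z))\<^sup>2"]
      by (simp add: algebra_simps)
  qed
  then show "a (norm z) * (norm v)\<^sup>2 \<le> riem g z v v" "riem g z v v \<le> b (norm z) * (norm v)\<^sup>2" by auto
qed

lemma riem_E: "riem g (x *\<^sub>R E) (c *\<^sub>R E) (c *\<^sub>R E) = c\<^sup>2 * a x"
  unfolding riem_eq_hform scaleR_eq_scale[of c] hform_scale_left hform_scale_right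
  by (simp add: E_def hform_axis a_def power2_eq_square)

text \<open>If \<open>eta x0 = - 2 - 2 * \<delta> < - 2\<close> then \<open>(t * sqrt (a t))' \<le> - \<delta> * sqrt (a t)\<close> for
  \<open>t \<ge> x0\<close>, so the radial ray has finite length and runs off to infinity.\<close>

lemma eta_ge:
  assumes x0: "x0 > 0"
  shows "eta x0 \<ge> -2"
proof (rule ccontr)
  assume "\<not> eta x0 \<ge> -2"
  define \<delta> where "\<delta> = (- 2 - eta x0) / 2"
  have \<delta>: "\<delta> > 0" "eta x0 = - 2 - 2 * \<delta>" using \<open>\<not> eta x0 \<ge> -2\<close> by (simp_all add: \<delta>_def field_simps)
  \<comment> \<open>T is positive for t > 0, and past x0 its decrease dominates the length element
    sqrt a dt. It therefore bounds distances along the ray and converges along it.\<close>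
  define T where "T t = t * sqrt (a t) / \<delta>" for t
  define T1 where "T1 t = (sqrt (a t) + t * (a1 t / (2 * sqrt (a t)))) / \<delta>" for t
  have dT: "(T has_real_derivative T1 t) (at t)" for t
    unfolding T_def T1_def using a_pos[of t] \<delta>
    by (auto intro!: derivative_eq_intros a_deriv simp: field_simps)
  have T1: "sqrt (a t) \<le> - T1 t" if "t \<ge> x0" for t
  proof -
    have "eta t \<le> - 2 - 2 * \<delta>" using eta_antimono[of x0 t] x0 that \<delta>(2) by simp
    then have "sqrt (a t) * (1 + eta t / 2) \<le> sqrt (a t) * (- \<delta>)"
      using a_pos[of t] by (intro mult_left_mono) auto
    then have "sqrt (a t) \<le> - (sqrt (a t) * (1 + eta t / 2) / \<delta>)"
      unfolding minus_divide_left using \<delta>(1) by (subst pos_le_divide_eq) auto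
    moreover have "T1 t = sqrt (a t) * (1 + eta t / 2) / \<delta>"
    proof -
      have "t * (a1 t / (2 * sqrt (a t))) = sqrt (a t) * (eta t / 2)"
        using a_pos[of t] by (simp add: eta_def field_simps)
      then show ?thesis unfolding T1_def by (simp add: algebra_simps)
    qed
    ultimately show ?thesis by simp
  qed
  have contT1: "continuous_on {0..1} (\<lambda>s. T1 (l s))" if "continuous_on {0..1} l" for l
    unfolding T1_def using that a_pos \<delta>
    by (intro continuous_intros continuous_on_compose2[OF cont_a[of UNIV]]
        continuous_on_compose2[OF cont_a1[of UNIV]]) (auto simp: less_imp_neq[symmetric])
  have d: "gdist g (x *\<^sub>R E) (y *\<^sub>R E) \<le> \<bar>T y - T x\<bar>" if xy: "x \<ge> x0" "y \<ge> x0" for x y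
  proof -
    define l where "l s = (1 - s) * x + s * y" for s
    have l: "linepath (x *\<^sub>R E) (y *\<^sub>R E) s = l s *\<^sub>R E" for s
      by (simp add: linepath_def l_def algebra_simps)
    have lx: "l s \<ge> x0" if "s \<in> {0..1}" for s
      using convex_bound_le[of "- x" "- x0" "- y" "1 - s" s] xy that by (simp add: l_def)
    have "((\<lambda>s. T1 (l s) * (y - x)) has_integral (T (l 1) - T (l 0))) {0..1}"
    proof (rule fundamental_theorem_of_calculus)
      show "((\<lambda>s. T (l s)) has_vector_derivative T1 (l s) * (y - x)) (at s within {0..1})" for s
        unfolding has_real_derivative_iff_has_vector_derivative[symmetric]
        by (rule has_field_derivative_at_within, rule DERIV_chain2[where f = T, OF dT])
           (auto simp: l_def intro!: derivative_eq_intros)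
    qed simp
    then have I: "((\<lambda>s. T1 (l s) * (y - x)) has_integral (T y - T x)) {0..1}" by (simp add: l_def)
    \<comment> \<open>T decreases past x0, so the sign of the increment depends on the order of x
      and y; passing to absolute values gives one bound for both orders.\<close>
    have J: "((\<lambda>s. - (T1 (l s) * \<bar>y - x\<bar>)) has_integral (\<bar>T y - T x\<bar>)) {0..1}"
      (is "(?h has_integral _) _")
    proof (cases "y \<ge> x")
      case True
      have "T y - T x \<le> 0"
      proof (rule has_integral_le[OF I has_integral_0])
        show "T1 (l s) * (y - x) \<le> 0" if "s \<in> {0..1}" for s
          using T1[OF lx[OF that]] a_pos[of "l s"] True
          by (intro mult_nonpos_nonneg) (auto intro: order_trans[of "T1 (l s)" "- sqrt (a (l s))"])
      qed
      then show ?thesis using has_integral_neg[OF I] True by simp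
    next
      case False
      have "0 \<le> T y - T x"
      proof (rule has_integral_le[OF has_integral_0 I])
        show "0 \<le> T1 (l s) * (y - x)" if "s \<in> {0..1}" for s
          using T1[OF lx[OF that]] a_pos[of "l s"] False
          by (intro mult_nonpos_nonpos) (auto intro: order_trans[of "T1 (l s)" "- sqrt (a (l s))"])
      qed
      then show ?thesis using I False by (simp add: algebra_simps)
    qed
    have f: "sqrt (riem g (linepath (x *\<^sub>R E) (y *\<^sub>R E) s) (y *\<^sub>R E - x *\<^sub>R E) (y *\<^sub>R E - x *\<^sub>R E))
        = \<bar>y - x\<bar> * sqrt (a (l s))" for s
      unfolding l scaleR_left_diff_distrib[symmetric] riem_E by (simp add: real_sqrt_mult)
    have "gdist g (x *\<^sub>R E) (y *\<^sub>R E) \<le> integral {0..1} (\<lambda>s. \<bar>y - x\<bar> * sqrt (a (l s)))"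
      using gdist_le_linepath[OF herm_met, of "x *\<^sub>R E" "y *\<^sub>R E"] unfolding f .
    also have "\<dots> \<le> \<bar>T y - T x\<bar>"
    proof (rule has_integral_le[OF integrable_integral J])
      show "(\<lambda>s. \<bar>y - x\<bar> * sqrt (a (l s))) integrable_on {0..1}"
        using linepath_length(1)[OF herm_met, of "x *\<^sub>R E" "y *\<^sub>R E"] unfolding f .
      show "\<bar>y - x\<bar> * sqrt (a (l s)) \<le> - (T1 (l s) * \<bar>y - x\<bar>)" if "s \<in> {0..1}" for s
        using mult_left_mono[OF T1[OF lx[OF that]], of "\<bar>y - x\<bar>"] by (simp add: mult.commute)
    qed
    finally show ?thesis .
  qed
  define \<sigma> where "\<sigma> m = (x0 + real m) *\<^sub>R E" for m :: nat
  have "decseq (\<lambda>m. T (x0 + real m))"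
  proof (rule decseq_SucI)
    fix m
    have "x0 + real m < x0 + real (Suc m)" by simp
    then show "T (x0 + real (Suc m)) \<le> T (x0 + real m)"
    proof (rule DERIV_nonpos_imp_nonincreasing[OF less_imp_le])
      fix t assume "x0 + real m \<le> t"
      then have "T1 t \<le> 0" using T1[of t] a_pos[of t] by (auto intro: order_trans[of "T1 t" "- sqrt (a t)"])
      then show "\<exists>y. DERIV T t :> y \<and> y \<le> 0" using dT by blast
    qed
  qed
  moreover have "\<forall>m. 0 \<le> T (x0 + real m)"
    using x0 \<delta> a_pos by (simp add: T_def less_imp_le)
  ultimately obtain l where "(\<lambda>m. T (x0 + real m)) \<longlonglongrightarrow> l"
    using decseq_convergent[where X = "\<lambda>m. T (x0 + real m)" and B = 0] by blast
  then have "convergent (\<lambda>m. T (x0 + real m))" by (rule convergentI)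
  then have cau: "Cauchy (\<lambda>m. T (x0 + real m))" by (rule convergent_Cauchy)
  have "\<exists>N. \<forall>m\<ge>N. \<forall>k\<ge>N. gdist g (\<sigma> m) (\<sigma> k) < \<epsilon>" if "\<epsilon> > 0" for \<epsilon>
  proof -
    obtain N where "\<forall>m\<ge>N. \<forall>k\<ge>N. dist (T (x0 + real m)) (T (x0 + real k)) < \<epsilon>"
      using cau \<open>\<epsilon> > 0\<close> unfolding Cauchy_def by blast
    then have N: "\<And>m k. m \<ge> N \<Longrightarrow> k \<ge> N \<Longrightarrow> dist (T (x0 + real m)) (T (x0 + real k)) < \<epsilon>"
      by blast
    have "gdist g (\<sigma> m) (\<sigma> k) < \<epsilon>" if "m \<ge> N" "k \<ge> N" for m k
      using d[of "x0 + real m" "x0 + real k"] N[OF that]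
      by (simp add: \<sigma>_def dist_real_def abs_minus_commute)
    then show ?thesis by blast
  qed
  then obtain x where x: "(\<lambda>k. gdist g (\<sigma> k) x) \<longlonglongrightarrow> 0"
    using complete unfolding complete_metric_def by meson
  \<comment> \<open>Points within Euclidean distance 1 of the alleged limit x have norm at most |x|
    + 1, and a is decreasing, so the metric there is at least \<epsilon>^2 times the Euclidean one.
    By \<open>gdist_ge\<close> the far points of the sequence stay at distance \<epsilon> from
    x.\<close>
  define \<epsilon> where "\<epsilon> = sqrt (a (norm x + 1))"
  have \<epsilon>: "\<epsilon> > 0" using a_pos by (simp add: \<epsilon>_def)
  have low: "\<epsilon> * norm v \<le> sqrt (riem g z v v)" if "dist z x < 1" for z v
  proof -
    have "norm z \<le> norm x + 1" using that norm_triangle_ineq2[of z x] by (simp add: dist_norm)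
    then have "a (norm x + 1) * (norm v)\<^sup>2 \<le> a (norm z) * (norm v)\<^sup>2"
      by (intro mult_right_mono a_antimono) auto
    also have "\<dots> \<le> riem g z v v" by (rule riem_bounds)
    finally have "sqrt (a (norm x + 1) * (norm v)\<^sup>2) \<le> sqrt (riem g z v v)" by simp
    then show ?thesis by (simp add: \<epsilon>_def real_sqrt_mult)
  qed
  have "\<forall>\<^sub>F k in sequentially. \<epsilon> \<le> gdist g (\<sigma> k) x"
    using eventually_ge_at_top[of "nat \<lceil>norm x + 1\<rceil>"]
  proof eventually_elim
    case (elim k)
    then have "norm x + 1 \<le> real k" by linarith
    then have "1 \<le> norm (\<sigma> k) - norm x" using x0 by (simp add: \<sigma>_def)
    also have "\<dots> \<le> dist (\<sigma> k) x" by (simp add: dist_norm norm_triangle_ineq2)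
    finally show ?case by (rule gdist_ge[OF herm_met _ low \<epsilon>])
  qed
  then have "\<epsilon> \<le> 0" by (intro tendsto_lowerbound[OF x]) simp_all
  then show False using \<epsilon> by simp
qed

text \<open>Beyond 1 the function x^2 a has derivative x a (2 + eta), which is nonnegative; up to 1
  the monotonicity of a is enough. This is the origin of the constant \<kappa> = a 1.\<close>

lemma a_lower: "a 1 / (1 + t\<^sup>2) \<le> a t" if "t \<ge> 0"
proof (cases "t \<le> 1")
  case True
  then have "a 1 \<le> a t" using that by (intro a_antimono)
  moreover have "a 1 / (1 + t\<^sup>2) \<le> a 1" using a_pos[of 1] by (simp add: divide_le_eq add_pos_nonneg mult_le_cancel_left1)
  ultimately show ?thesis by linarith
next
  case False
  then have "1 \<le> t" by simp
  then have "1\<^sup>2 * a 1 \<le> t\<^sup>2 * a t"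
  proof (rule DERIV_nonneg_imp_increasing_open)
    fix x :: real assume x: "1 < x" "x < t"
    have "((\<lambda>x. x\<^sup>2 * a x) has_real_derivative 2 * x * a x + x\<^sup>2 * a1 x) (at x)"
      by (auto intro!: derivative_eq_intros a_deriv)
    moreover have "2 * x * a x + x\<^sup>2 * a1 x = x * a x * (2 + eta x)"
      using a_pos[of x] by (simp add: eta_def field_simps power2_eq_square)
    moreover have "x * a x * (2 + eta x) \<ge> 0"
      using eta_ge[of x] a_pos[of x] x by simp
    ultimately show "\<exists>d. ((\<lambda>x. x\<^sup>2 * a x) has_real_derivative d) (at x) \<and> d \<ge> 0" by metis
  qed (intro continuous_intros cont_a)
  moreover have "0 < a t" by (rule a_pos)
  ultimately have "a 1 \<le> (1 + t\<^sup>2) * a t" by (simp add: algebra_simps)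
  then show ?thesis by (simp add: divide_le_eq add_pos_nonneg mult.commute)
qed

end

section \<open>Invariance of Lebesgue measure under isometries\<close>

lemma nn_integral_lborel_translate:
  fixes h :: "'a::euclidean_space \<Rightarrow> ennreal"
  assumes "h \<in> borel_measurable borel"
  shows "(\<integral>\<^sup>+x. h (c + x) \<partial>lborel) = (\<integral>\<^sup>+x. h x \<partial>lborel)"
proof -
  have "(\<integral>\<^sup>+x. h x \<partial>lborel) = (\<integral>\<^sup>+x. h x \<partial>distr lborel borel ((+) c))"
    by (simp only: lborel_distr_plus)
  also have "\<dots> = (\<integral>\<^sup>+x. h (c + x) \<partial>lborel)"
    by (rule nn_integral_distr) (use assms in simp_all)
  finally show ?thesis by simp
qed

text \<open>Uniqueness of Haar measure: both sides of
  \<open>\<integral>\<integral> h (f x + y) k y dx dy = \<integral>\<integral> h y k (y - f x) dy dx\<close>, with \<open>k\<close> the indicator of the unit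
  ball, are computed by translation invariance.\<close>

lemma nn_integral_lborel_isometry:
  fixes f :: "'a::euclidean_space \<Rightarrow> 'a" and h :: "'a \<Rightarrow> ennreal"
  assumes lin: "linear f" and iso: "\<And>x. norm (f x) = norm x" and h: "h \<in> borel_measurable borel"
  shows "(\<integral>\<^sup>+x. h (f x) \<partial>lborel) = (\<integral>\<^sup>+x. h x \<partial>lborel)"
proof -
  have "inj f"
    using linear_injective_0[OF lin] iso by (metis norm_eq_zero)
  then have "surj f" by (rule linear_inj_imp_surj[OF lin])
  then obtain f' where f': "\<And>y. f (f' y) = y" by (metis surjD)
  have f_m[measurable]: "f \<in> borel_measurable borel"
    by (intro borel_measurable_continuous_onI linear_continuous_on linear_conv_bounded_linear[THEN iffD1] lin)
  note h[measurable]
  define k :: "'a \<Rightarrow> ennreal" where "k x = indicator (ball 0 1) x" for x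
  have k_m[measurable]: "k \<in> borel_measurable borel" unfolding k_def by (intro borel_measurable_indicator) simp
  define B where "B = (\<integral>\<^sup>+x. k x \<partial>lborel)"
  have "emeasure lborel (ball (0::'a) 1) = B" by (simp add: B_def k_def)
  moreover have "emeasure lborel (ball (0::'a) 1) > 0" by (simp add: emeasure_ball unit_ball_vol_pos)
  ultimately have B: "B \<noteq> 0" "B \<noteq> \<infinity>"
    using emeasure_lborel_ball_finite[of "0::'a" 1] by auto
  define N where "N = (\<integral>\<^sup>+x. h (f x) \<partial>lborel)"
  have 1: "(\<integral>\<^sup>+x. h (f x + y) \<partial>lborel) = N" for y
  proof -
    have "(\<integral>\<^sup>+x. h (f x + y) \<partial>lborel) = (\<integral>\<^sup>+x. h (f (f' y + x)) \<partial>lborel)"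
      by (simp add: linear_add[OF lin] f' add.commute)
    also have "\<dots> = N" unfolding N_def
      by (rule nn_integral_lborel_translate[of "\<lambda>x. h (f x)"]) measurable
    finally show ?thesis .
  qed
  \<comment> \<open>f preserves distances, so y - f x lies in the unit ball exactly when x lies in
    the unit ball about the preimage of y.\<close>
  have 2: "(\<integral>\<^sup>+x. k (y - f x) \<partial>lborel) = B" for y
  proof -
    have "k (y - f x) = k (- f' y + x)" for x
    proof -
      have "norm (y - f x) = norm (f (f' y - x))" by (simp add: linear_diff[OF lin] f')
      also have "\<dots> = norm (- f' y + x)" by (simp add: iso norm_minus_commute)
      finally show ?thesis by (simp add: k_def indicator_def)
    qed
    then show ?thesis unfolding B_def using nn_integral_lborel_translate[OF k_m, of "- f' y"] by simp
  qed
  have "N * B = (\<integral>\<^sup>+y. (\<integral>\<^sup>+x. h (f x + y) * k y \<partial>lborel) \<partial>lborel)"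
    by (simp add: nn_integral_multc nn_integral_cmult 1 B_def)
  also have "\<dots> = (\<integral>\<^sup>+x. (\<integral>\<^sup>+y. h (f x + y) * k y \<partial>lborel) \<partial>lborel)"
    by (rule lborel_pair.Fubini'[symmetric]) measurable
  also have "\<dots> = (\<integral>\<^sup>+x. (\<integral>\<^sup>+y. h y * k (y - f x) \<partial>lborel) \<partial>lborel)"
  proof (rule nn_integral_cong)
    fix x
    have "(\<integral>\<^sup>+y. h (f x + y) * k (f x + y - f x) \<partial>lborel) = (\<integral>\<^sup>+y. h y * k (y - f x) \<partial>lborel)"
      by (rule nn_integral_lborel_translate) measurable
    then show "(\<integral>\<^sup>+y. h (f x + y) * k y \<partial>lborel) = (\<integral>\<^sup>+y. h y * k (y - f x) \<partial>lborel)" by simp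
  qed
  also have "\<dots> = (\<integral>\<^sup>+y. (\<integral>\<^sup>+x. h y * k (y - f x) \<partial>lborel) \<partial>lborel)"
    by (rule lborel_pair.Fubini') measurable
  also have "\<dots> = (\<integral>\<^sup>+x. h x \<partial>lborel) * B"
    by (simp add: nn_integral_cmult nn_integral_multc 2)
  finally have "B * N = B * (\<integral>\<^sup>+x. h x \<partial>lborel)" by (simp add: mult.commute)
  then show ?thesis using B by (simp add: ennreal_mult_cancel_left N_def)
qed

section \<open>The Riemannian volume\<close>

lemma inner_real_frame: "v \<bullet> real_frame (Inl i) = Re (v $ i)" "v \<bullet> real_frame (Inr i) = Im (v $ i)"
  by (simp_all add: real_frame_def inner_axis_complex)

lemma real_frame_expand: "v = (\<Sum>a\<in>UNIV. (v \<bullet> real_frame a) *\<^sub>R real_frame a)"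
proof -
  have "(\<Sum>a\<in>UNIV. (v \<bullet> real_frame a) *\<^sub>R real_frame a) =
      (\<Sum>i\<in>UNIV. Re (v $ i) *\<^sub>R axis i 1) + (\<Sum>i\<in>UNIV. Im (v $ i) *\<^sub>R axis i \<i>)"
    by (subst UNIV_Plus_UNIV[symmetric], subst sum.Plus)
       (simp_all add: inner_real_frame, simp_all add: real_frame_def)
  also have "\<dots> = v"
  proof (subst vec_eq_iff, intro allI)
    fix j
    have "(\<Sum>i\<in>UNIV. Re (v $ i) *\<^sub>R axis i 1) $ j = (\<Sum>i\<in>UNIV. if i = j then complex_of_real (Re (v $ j)) else 0)"
      unfolding sum_component by (rule sum.cong) (auto simp: axis_def scaleR_conv_of_real[where 'a = complex])
    moreover have "(\<Sum>i\<in>UNIV. Im (v $ i) *\<^sub>R axis i \<i>) $ j = (\<Sum>i\<in>UNIV. if i = j then Im (v $ j) * \<i> else 0)"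
      unfolding sum_component by (rule sum.cong) (auto simp: axis_def scaleR_conv_of_real[where 'a = complex])
    ultimately show "((\<Sum>i\<in>UNIV. Re (v $ i) *\<^sub>R axis i 1) + (\<Sum>i\<in>UNIV. Im (v $ i) *\<^sub>R axis i \<i>)) $ j = v $ j"
      by (simp add: complex_eq_iff)
  qed
  finally show ?thesis by simp
qed

lemma inner_real_frame_real_frame: "real_frame a \<bullet> real_frame b = (if a = b then 1 else 0)"
  by (cases a; cases b) (auto simp: real_frame_def inner_axis_axis inner_complex_def)

lemma norm_real_frame: "norm (real_frame a) = 1"
  using inner_real_frame_real_frame[of a a] by (simp add: norm_eq_1)

lemma riem_sum:
  "riem g z (\<Sum>a\<in>A. x a *\<^sub>R f a) (\<Sum>b\<in>B. y b *\<^sub>R h b) = (\<Sum>a\<in>A. \<Sum>b\<in>B. x a * riem g z (f a) (h b) * y b)"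
proof -
  have l: "linear (\<lambda>v. riem g z v w)" for w
    by (rule linearI) (simp_all add: riem_def sum_distrib_left sum.distrib algebra_simps)
  have r: "linear (\<lambda>w. riem g z v w)" for v
    by (rule linearI) (simp_all add: riem_def sum_distrib_left sum.distrib algebra_simps)
  have L: "riem g z (\<Sum>a\<in>A. x a *\<^sub>R f a) w = (\<Sum>a\<in>A. x a * riem g z (f a) w)" for w
    by (simp add: linear_sum[OF l] linear_cmul[OF l])
  have R: "riem g z v (\<Sum>b\<in>B. y b *\<^sub>R h b) = (\<Sum>b\<in>B. riem g z v (h b) * y b)" for v
    by (simp add: linear_sum[OF r] linear_cmul[OF r] mult.commute)
  show ?thesis unfolding L by (simp add: R sum_distrib_left mult.assoc)
qed

lemma bounded_linear_matrix: "bounded_linear ((*v) (U :: complex ^ 'n::finite ^ 'n))"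
  by (rule linear_conv_bounded_linear[THEN iffD1], rule linearI)
     (simp_all add: vec_eq_iff matrix_vector_mult_def scaleR_sum_right distrib_left sum.distrib)

section \<open>Unitary invariance of the volume measure\<close>

context radial_metric
begin

text \<open>M is the real matrix of U in the coordinate frame. It is orthogonal, and the Gram
  matrices at z and U z are congruent by M, so their determinants differ by the square of det M,
  which is 1.\<close>

lemma det_gram_unitary:
  assumes U: "unitary_matrix U"
  shows "det (gram g (U *v z)) = det (gram g z)"
proof -
  define M :: "real ^ ('n + 'n) ^ ('n + 'n)" where "M = (\<chi> a b. (U *v real_frame b) \<bullet> real_frame a)"
  have exp: "U *v real_frame b = (\<Sum>a\<in>UNIV. M $ a $ b *\<^sub>R real_frame a)" for b
    using real_frame_expand[of "U *v real_frame b"] by (simp add: M_def)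
  have inner: "(U *v v) \<bullet> (U *v w) = v \<bullet> w" for v w
    by (simp add: inner_eq_Re_herm herm_unitary[OF U])
  have "transpose M ** M = mat 1"
  proof -
    have "(transpose M ** M) $ a $ b = (U *v real_frame a) \<bullet> (U *v real_frame b)" for a b
      unfolding exp[of b] inner_sum_right
      by (simp add: matrix_matrix_mult_def transpose_def M_def mult.commute)
    then show ?thesis by (simp add: vec_eq_iff inner inner_real_frame_real_frame mat_def)
  qed
  then have "det (transpose M) * det M = 1" by (metis det_mul det_I)
  moreover have "gram g z = transpose M ** gram g (U *v z) ** M"
  proof -
    have "gram g z $ a $ b = (transpose M ** gram g (U *v z) ** M) $ a $ b" for a b
    proof -
      have "gram g z $ a $ b = riem g (U *v z) (U *v real_frame a) (U *v real_frame b)"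
        using hform_unitary[OF U] by (simp add: gram_def riem_eq_hform)
      also have "\<dots> = (\<Sum>c\<in>UNIV. \<Sum>d\<in>UNIV. M $ c $ a * gram g (U *v z) $ c $ d * M $ d $ b)"
        unfolding exp riem_sum by (simp add: gram_def)
      also have "\<dots> = (transpose M ** gram g (U *v z) ** M) $ a $ b"
        unfolding matrix_matrix_mult_def transpose_def
        by (subst sum.swap) (simp add: sum_distrib_right)
      finally show ?thesis .
    qed
    then show ?thesis by (simp add: vec_eq_iff)
  qed
  ultimately show ?thesis by (simp add: det_mul)
qed

definition dens :: "complex ^ 'n \<Rightarrow> real" where "dens z = sqrt (det (gram g z))"

lemma riem_vol_dens: "riem_vol g = density lborel (\<lambda>z. ennreal (dens z))"
  by (simp add: riem_vol_def dens_def)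

lemma dens_unitary: "unitary_matrix U \<Longrightarrow> dens (U *v z) = dens z"
  by (simp add: dens_def det_gram_unitary)

lemma continuous_dens: "continuous_on UNIV dens"
proof -
  have "continuous_on UNIV (\<lambda>z. gram g z $ i $ j)" for i j
    using smooth_g[of 0] unfolding gram_def riem_def vec_lambda_beta C_class.simps
    by (intro continuous_on_Re continuous_on_sum continuous_on_mult continuous_on_const)
  then show ?thesis
    unfolding dens_def det_def
    by (intro continuous_on_real_sqrt continuous_on_sum continuous_on_mult continuous_on_const continuous_on_prod)
qed

lemma dens_measurable [measurable]: "dens \<in> borel_measurable borel"
  by (rule borel_measurable_continuous_onI[OF continuous_dens])

lemma space_riem_vol [simp]: "space (riem_vol g) = UNIV" and sets_riem_vol [simp, measurable_cong]: "sets (riem_vol g) = sets borel"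
  by (simp_all add: riem_vol_dens)

lemma nn_integral_riem_vol:
  "h \<in> borel_measurable borel \<Longrightarrow> (\<integral>\<^sup>+z. h z \<partial>riem_vol g) = (\<integral>\<^sup>+z. ennreal (dens z) * h z \<partial>lborel)"
  unfolding riem_vol_dens by (rule nn_integral_density) simp_all

lemma matrix_measurable [measurable]: "(*v) (U :: complex ^ 'n ^ 'n) \<in> borel_measurable borel"
  by (intro borel_measurable_continuous_onI linear_continuous_on bounded_linear_matrix)

lemma nn_integral_unitary:
  assumes U: "unitary_matrix U" and h: "h \<in> borel_measurable borel"
  shows "(\<integral>\<^sup>+z. h (U *v z) \<partial>riem_vol g) = (\<integral>\<^sup>+z. h z \<partial>riem_vol g)"
proof -
  note h[measurable]
  have "(\<integral>\<^sup>+z. h (U *v z) \<partial>riem_vol g) = (\<integral>\<^sup>+z. ennreal (dens (U *v z)) * h (U *v z) \<partial>lborel)"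
    by (simp add: nn_integral_riem_vol dens_unitary[OF U])
  also have "\<dots> = (\<integral>\<^sup>+z. ennreal (dens z) * h z \<partial>lborel)"
    by (rule nn_integral_lborel_isometry[where h = "\<lambda>z. ennreal (dens z) * h z"])
       (use bounded_linear_matrix in \<open>auto simp: norm_unitary[OF U] bounded_linear.linear\<close>)
  finally show ?thesis by (simp add: nn_integral_riem_vol)
qed

lemma riem_vol_unitary:
  assumes U: "unitary_matrix U"
  shows "distr (riem_vol g) borel ((*v) U) = riem_vol g"
proof (rule measure_eqI)
  fix A assume "A \<in> sets (distr (riem_vol g) borel ((*v) U))"
  then have A[measurable]: "A \<in> sets borel" by simp
  have "emeasure (distr (riem_vol g) borel ((*v) U)) A = (\<integral>\<^sup>+z. indicator A (U *v z) \<partial>riem_vol g)"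
    using nn_integral_distr[of "(*v) U" "riem_vol g" borel "indicator A"] by simp
  also have "\<dots> = (\<integral>\<^sup>+z. indicator A z \<partial>riem_vol g)"
    by (rule nn_integral_unitary[OF U]) simp
  finally show "emeasure (distr (riem_vol g) borel ((*v) U)) A = emeasure (riem_vol g) A" by simp
qed simp

end

section \<open>Global bounds for the metric and its volume density\<close>

context radial_kaehler
begin

lemma metric_lower: "a 1 / (1 + (norm z)\<^sup>2) * (norm v)\<^sup>2 \<le> riem g z v v"
proof -
  have "a 1 / (1 + (norm z)\<^sup>2) * (norm v)\<^sup>2 \<le> a (norm z) * (norm v)\<^sup>2"
    by (intro mult_right_mono a_lower) auto
  also have "\<dots> \<le> riem g z v v" by (rule riem_bounds)
  finally show ?thesis .
qed

lemma metric_upper: "riem g z v v \<le> a 0 * (norm v)\<^sup>2"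
proof -
  have "riem g z v v \<le> b (norm z) * (norm v)\<^sup>2" by (rule riem_bounds)
  also have "\<dots> \<le> a 0 * (norm v)\<^sup>2" by (intro mult_right_mono b_bounds) auto
  finally show ?thesis .
qed

text \<open>By invariance z may be taken on the axis, where the Gram matrix is diagonal with 2n
  entries between the metric bounds; the square root in the density halves the exponent 2n.\<close>

lemma dens_bounds: "(a 1 / (1 + (norm z)\<^sup>2)) ^ CARD('n) \<le> dens z" "dens z \<le> a 0 ^ CARD('n)"
proof -
  let ?x = "norm z" and ?l = "a 1 / (1 + (norm z)\<^sup>2)"
  obtain U where U: "unitary_matrix U" "U *v z = ?x *\<^sub>R E" by (rule unitary_to_axis)
  define G where "G = gram g (?x *\<^sub>R E)"
  have "det G = (\<Prod>i\<in>UNIV. G $ i $ i)"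
  proof (rule det_diagonal)
    fix i j :: "'n + 'n" assume "i \<noteq> j"
    then show "G $ i $ j = 0"
      by (cases i; cases j) (auto simp: G_def gram_def real_frame_def riem_eq_hform hform_axis g_on_axis)
  qed
  moreover have nx: "norm (?x *\<^sub>R E) = ?x" by simp
  have lo: "?l \<le> G $ i $ i" for i
    using metric_lower[of "?x *\<^sub>R E" "real_frame i"] unfolding nx
    by (simp add: G_def gram_def norm_real_frame)
  have hi: "G $ i $ i \<le> a 0" for i
    using metric_upper[of "?x *\<^sub>R E" "real_frame i"]
    by (simp add: G_def gram_def norm_real_frame)
  have l0: "?l \<ge> 0" using a_pos[of 1] by simp
  have "?l ^ CARD('n + 'n) \<le> (\<Prod>i\<in>UNIV. G $ i $ i)"
    using prod_mono[of UNIV "\<lambda>_. ?l" "\<lambda>i. G $ i $ i"] lo l0 by simp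
  moreover have "(\<Prod>i\<in>UNIV. G $ i $ i) \<le> a 0 ^ CARD('n + 'n)"
    using prod_mono[of UNIV "\<lambda>i. G $ i $ i" "\<lambda>_. a 0"] hi order_trans[OF l0 lo] by simp
  moreover have "CARD('n + 'n) = CARD('n) * 2" by simp
  ultimately have d: "(?l ^ CARD('n))\<^sup>2 \<le> det G" "det G \<le> (a 0 ^ CARD('n))\<^sup>2"
    by (simp_all only: power_mult)
  have "dens z = sqrt (det G)"
    using dens_unitary[OF U(1), of z] U(2) by (simp add: dens_def G_def)
  then show "?l ^ CARD('n) \<le> dens z" "dens z \<le> a 0 ^ CARD('n)"
    using d l0 a_pos[of 0] by (auto intro: real_le_rsqrt real_le_lsqrt simp: less_imp_le)
qed

lemma dens_pos: "dens z > 0"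
proof -
  have "0 < (a 1 / (1 + (norm z)\<^sup>2)) ^ CARD('n)" using a_pos[of 1] by (simp add: add_pos_nonneg)
  then show ?thesis using dens_bounds(1)[of z] by linarith
qed

end

section \<open>Entire functions and their homogeneous parts\<close>

lemma entire_dir_deriv:
  assumes "entire F"
  shows entire_has_derivative: "(F has_derivative (\<lambda>v. dir_deriv F v z)) (at z)"
    and entire_dir_deriv_scale: "dir_deriv F (c *s v) z = c * dir_deriv F v z"
proof -
  obtain L where L: "(F has_derivative L) (at z)" "\<And>c v. L (c *s v) = c * L v"
    using assms unfolding entire_def by blast
  have "dir_deriv F v z = L v" for v by (rule dir_deriv_eqI[OF L(1)])
  then show "(F has_derivative (\<lambda>v. dir_deriv F v z)) (at z)"
    "dir_deriv F (c *s v) z = c * dir_deriv F v z"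
    using L by simp_all
qed

lemma entireI:
  assumes "\<And>z. (F has_derivative L z) (at z)" "\<And>z c v. L z (c *s v) = c * L z v"
  shows "entire F"
  unfolding entire_def
proof
  fix z show "\<exists>L. (F has_derivative L) (at z) \<and> (\<forall>c v. L (c *s v) = c * L v)"
    using assms by (intro exI[of _ "L z"]) simp
qed

lemma entire_continuous: "entire F \<Longrightarrow> continuous_on S F"
  by (intro continuous_at_imp_continuous_on ballI has_derivative_continuous[OF entire_has_derivative])

lemma entire_const: "entire (\<lambda>z. c)"
  by (rule entireI[where L = "\<lambda>_ _. 0"]) auto

lemma entire_component: "entire (\<lambda>z. z $ i)"
  by (rule entireI[where L = "\<lambda>_ v. v $ i"]) (auto intro: bounded_linear_imp_has_derivative bounded_linear_vec_nth)

lemma entire_add: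
  assumes "entire F" "entire G" shows "entire (\<lambda>z. F z + G z)"
  by (rule entireI[OF has_derivative_add[OF entire_has_derivative[OF assms(1)] entire_has_derivative[OF assms(2)]]])
     (simp add: entire_dir_deriv_scale assms algebra_simps)

lemma entire_mult:
  assumes "entire F" "entire G" shows "entire (\<lambda>z. F z * G z)"
  by (rule entireI[OF has_derivative_mult[OF entire_has_derivative[OF assms(1)] entire_has_derivative[OF assms(2)]]])
     (simp add: entire_dir_deriv_scale assms algebra_simps)

lemma entire_power: "entire F \<Longrightarrow> entire (\<lambda>z. F z ^ m)"
  by (induction m) (auto intro: entire_const entire_mult)

lemma entire_sum: "(\<And>i. i \<in> I \<Longrightarrow> entire (f i)) \<Longrightarrow> entire (\<lambda>z. \<Sum>i\<in>I. f i z)"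
  by (induction I rule: infinite_finite_induct) (auto intro: entire_const entire_add)

lemma entire_prod: "(\<And>i. i \<in> I \<Longrightarrow> entire (f i)) \<Longrightarrow> entire (\<lambda>z. \<Prod>i\<in>I. f i z)"
  by (induction I rule: infinite_finite_induct) (auto intro: entire_const entire_mult)

lemma entire_linear_compose:
  assumes F: "entire F" and f: "bounded_linear f" "\<And>c v. f (c *s v) = c *s f v"
  shows "entire (\<lambda>z. F (f z))"
proof (rule entireI)
  show "((\<lambda>z. F (f z)) has_derivative (\<lambda>v. dir_deriv F (f v) (f z))) (at z)" for z
    by (rule has_derivative_compose[OF bounded_linear_imp_has_derivative[OF f(1)] entire_has_derivative[OF F]])
  show "dir_deriv F (f (c *s v)) (f z) = c * dir_deriv F (f v) (f z)" for z c v
    by (simp add: f(2) entire_dir_deriv_scale[OF F])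
qed

lemma bounded_linear_scale_vec: "bounded_linear (\<lambda>w::complex. w *s (v :: complex ^ 'n::finite))"
  by (rule linear_conv_bounded_linear[THEN iffD1], rule linearI)
     (simp_all add: vec_eq_iff algebra_simps)

text \<open>Restriction to complex lines turns complex Frechet differentiability into holomorphy in
  one variable, which is how Cauchy theory enters.\<close>

lemma entire_line_deriv:
  fixes u v :: "complex ^ 'n::finite"
  assumes F: "entire F"
  shows "((\<lambda>w. F (u + w *s v)) has_field_derivative dir_deriv F v (u + w *s v)) (at w)"
proof -
  have "((\<lambda>w. u + w *s v) has_derivative (\<lambda>h. h *s v)) (at w)"
    using has_derivative_add[OF has_derivative_const bounded_linear_imp_has_derivative[OF bounded_linear_scale_vec]]
    by simp
  from has_derivative_compose[OF this entire_has_derivative[OF F]]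
  have "((\<lambda>w. F (u + w *s v)) has_derivative (\<lambda>h. dir_deriv F (h *s v) (u + w *s v))) (at w)" .
  then show ?thesis
    unfolding has_field_derivative_def entire_dir_deriv_scale[OF F]
    by (simp only: mult.commute[of _ "dir_deriv F v (u + w *s v)"])
qed

lemma entire_line_holomorphic: "entire F \<Longrightarrow> (\<lambda>w. F (u + w *s v)) holomorphic_on S"
  unfolding holomorphic_on_def field_differentiable_def
  by (intro ballI exI) (rule has_field_derivative_at_within, rule entire_line_deriv)

lemma entire_ray_holomorphic: "entire F \<Longrightarrow> (\<lambda>w. F (w *s v)) holomorphic_on S"
  using entire_line_holomorphic[of F 0 v S] by simp

text \<open>The homogeneous part of degree d, read off as a Taylor coefficient on the complex line
  through z. This makes sense for every entire function; that the part is a polynomial is shown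
  later, for functions with finitely many parts.\<close>

definition tay :: "(complex ^ 'n::finite \<Rightarrow> complex) \<Rightarrow> nat \<Rightarrow> complex ^ 'n \<Rightarrow> complex"
  where "tay F d z = (deriv ^^ d) (\<lambda>w. F (w *s z)) 0 / fact d"

lemma tay_scale:
  assumes "entire F" shows "tay F d (w *s z) = w ^ d * tay F d z"
proof -
  have "(deriv ^^ d) (\<lambda>x. (\<lambda>w. F (w *s z)) (w * x)) 0 = w ^ d * (deriv ^^ d) (\<lambda>w. F (w *s z)) (w * 0)"
    by (rule higher_deriv_compose_linear[OF entire_ray_holomorphic[OF assms, of z UNIV] open_UNIV open_UNIV]) auto
  then show ?thesis by (simp add: tay_def mult.commute)
qed

lemma tay_sums:
  assumes "entire F" shows "(\<lambda>d. tay F d z) sums F z"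
  \<comment> \<open>The disc of radius 2 is chosen to contain the point 1, where the ray passes
    through z.\<close>
  using holomorphic_power_series[OF entire_ray_holomorphic[OF assms], of 1 0 2 z] by (simp add: tay_def)

lemma tay_add:
  assumes "entire F" "entire G" shows "tay (\<lambda>z. F z + G z) d z = tay F d z + tay G d z"
  using higher_deriv_add[OF entire_ray_holomorphic[OF assms(1)] entire_ray_holomorphic[OF assms(2)] open_UNIV UNIV_I]
  by (simp add: tay_def add_divide_distrib)

lemma tay_cmult:
  assumes "entire F" shows "tay (\<lambda>z. c * F z) d z = c * tay F d z"
  using higher_deriv_cmult[OF entire_ray_holomorphic[OF assms] UNIV_I open_UNIV]
  by (simp add: tay_def)

lemma tay_eqI:
  assumes "\<And>w. F (w *s z) = (\<Sum>d\<le>N. c d * w ^ d)"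
  shows "tay F d z = (if d \<le> N then c d else 0)"
proof -
  define p where "p = (\<Sum>k\<le>N. monom (c k) k)"
  have "F (w *s z) = poly p w" for w
    by (simp add: assms p_def poly_sum poly_monom)
  then have "tay F d z = (deriv ^^ d) (poly p) 0 / fact d" by (simp add: tay_def)
  also have "(deriv ^^ d) (poly p) = poly ((pderiv ^^ d) p)"
  proof (induction d)
    case (Suc d)
    have "deriv (poly q) = poly (pderiv q)" for q :: "complex poly"
      by (auto intro: DERIV_imp_deriv poly_DERIV)
    then show ?case using Suc by simp
  qed simp
  also have "poly ((pderiv ^^ d) p) 0 = fact d * coeff p d"
    by (simp add: poly_0_coeff_0 coeff_higher_pderiv pochhammer_fact)
  finally show ?thesis by (simp add: p_def coeff_sum)
qed

section \<open>Homogeneous parts as circle averages\<close>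

definition circ :: "real \<Rightarrow> complex" where "circ t = exp (2 * of_real pi * \<i> * of_real t)"

lemma norm_circ [simp]: "cmod (circ t) = 1"
  by (simp add: circ_def norm_exp_eq_Re)

lemma continuous_circ [continuous_intros]: "continuous_on S f \<Longrightarrow> continuous_on S (\<lambda>x. circ (f x))"
  unfolding circ_def by (intro continuous_intros)

text \<open>Cauchy's formula on the unit circle presents the homogeneous part as a Fourier
  coefficient of the circle action; its continuity and the square-mean bound rest on this.\<close>

lemma tay_integral:
  assumes F: "entire F"
  shows "tay F d z = integral {0..1} (\<lambda>t. F (circ t *s z) * cnj (circ t) ^ d)"
proof -
  have "((\<lambda>u. F (u *s z) / (u - 0) ^ Suc d) has_contour_integral
      ((2 * pi * \<i>) / fact d * (deriv ^^ d) (\<lambda>w. F (w *s z)) 0)) (circlepath 0 1)"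
    by (intro Cauchy_has_contour_integral_higher_derivative_circlepath
        holomorphic_on_imp_continuous_on entire_ray_holomorphic F) auto
  then have "((\<lambda>t. F (circlepath 0 1 t *s z) / (circlepath 0 1 t - 0) ^ Suc d *
      vector_derivative (circlepath 0 1) (at t within {0..1})) has_integral
      (2 * pi * \<i>) * tay F d z) {0..1}"
    by (simp add: has_contour_integral_def tay_def)
  moreover have "circlepath 0 1 t = circ t" for t
    by (simp add: circlepath circ_def)
  moreover have "vector_derivative (circlepath 0 1) (at t within {0..1}) = 2 * pi * \<i> * circ t"
    if "t \<in> {0..1}" for t
    using that vector_derivative_circlepath01[of t 0 1] by (simp add: circ_def)
  ultimately have "((\<lambda>t. F (circ t *s z) / circ t ^ Suc d * (2 * pi * \<i> * circ t)) has_integral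
      (2 * pi * \<i>) * tay F d z) {0..1}"
    by (elim has_integral_eq[rotated]) simp
  moreover have "F (circ t *s z) / circ t ^ Suc d * (2 * pi * \<i> * circ t) =
      (2 * pi * \<i>) * (F (circ t *s z) * cnj (circ t) ^ d)" for t
  proof -
    have "circ t \<noteq> 0" using norm_circ[of t] by fastforce
    moreover have "circ t * cnj (circ t) = 1" using complex_norm_square[of "circ t"] by simp
    then have "circ t ^ d * cnj (circ t) ^ d = 1" by (simp add: power_mult_distrib[symmetric])
    ultimately show ?thesis by (simp add: field_simps)
  qed
  ultimately have "((\<lambda>t. (2 * pi * \<i>) * (F (circ t *s z) * cnj (circ t) ^ d)) has_integral
      (2 * pi * \<i>) * tay F d z) {0..1}" by simp
  note * = has_integral_mult_right[OF this, of "inverse (2 * pi * \<i>)"]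
  have "((\<lambda>t. F (circ t *s z) * cnj (circ t) ^ d) has_integral tay F d z) {0..1}"
  proof -
    have "inverse (2 * pi * \<i>) * ((2 * pi * \<i>) * x) = x" for x by (simp add: field_simps)
    with * show ?thesis by simp
  qed
  then show ?thesis by (simp add: integral_unique)
qed

lemma continuous_on_cscale [continuous_intros]:
  fixes f :: "'a::topological_space \<Rightarrow> complex" and h :: "'a \<Rightarrow> complex ^ 'n::finite"
  assumes "continuous_on S f" "continuous_on S h"
  shows "continuous_on S (\<lambda>x. f x *s h x)"
  unfolding vector_scalar_mult_def by (intro continuous_intros assms)

lemma continuous_F_circ:
  assumes F: "entire F"
  shows "continuous_on S (\<lambda>(z, t). F (circ t *s z))"
  unfolding split_def
  by (intro continuous_on_compose2[OF entire_continuous[OF F, of UNIV]] continuous_intros) auto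

lemma continuous_tay:
  assumes F: "entire F" shows "continuous_on S (tay F d)"
proof -
  have "continuous_on (S \<times> cbox 0 1) (\<lambda>(z, t). F (circ t *s z) * cnj (circ t) ^ d)"
    using continuous_F_circ[OF F] unfolding split_def by (intro continuous_intros) auto
  from integral_continuous_on_param[OF this] show ?thesis
    by (simp add: tay_integral[OF F, abs_def])
qed

text \<open>The integral of \<open>|f - c|\<^sup>2\<close> is nonnegative, where \<open>c\<close> is the mean of \<open>f\<close>.\<close>

lemma tay_norm_le:
  assumes F: "entire F"
  shows "(cmod (tay F d z))\<^sup>2 \<le> integral {0..1} (\<lambda>t. (cmod (F (circ t *s z)))\<^sup>2)"
proof -
  define f where "f t = F (circ t *s z) * cnj (circ t) ^ d" for t
  define c where "c = tay F d z"
  have Fc: "continuous_on {0..1} (\<lambda>t. F (circ t *s z))"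
    by (intro continuous_on_compose2[OF entire_continuous[OF F, of UNIV]] continuous_intros) auto
  then have cont: "continuous_on {0..1} f" unfolding f_def by (intro continuous_intros)
  have I: "(f has_integral c) {0..1}"
    using integrable_integral[OF integrable_continuous_real[OF cont]]
    by (simp add: c_def tay_integral[OF F] f_def[abs_def])
  have nf: "cmod (f t) = cmod (F (circ t *s z))" for t
    by (simp add: f_def norm_mult norm_power)
  have J: "((\<lambda>t. (cmod (f t))\<^sup>2) has_integral integral {0..1} (\<lambda>t. (cmod (f t))\<^sup>2)) {0..1}"
    by (intro integrable_integral integrable_continuous_real continuous_intros cont)
  have K: "((\<lambda>t. Re (f t * cnj c)) has_integral Re (c * cnj c)) {0..1}"
    by (rule has_integral_Re[OF has_integral_mult_left[OF I]])
  have eq: "(cmod (f t))\<^sup>2 - 2 * Re (f t * cnj c) + (cmod c)\<^sup>2 = (cmod (f t - c))\<^sup>2" for t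
    unfolding cmod_power2 by (simp add: power2_eq_square algebra_simps)
  have cc: "Re (c * cnj c) = (cmod c)\<^sup>2"
    unfolding cmod_power2 by (simp add: power2_eq_square)
  have "((\<lambda>t. (cmod c)\<^sup>2) has_integral (cmod c)\<^sup>2) {0..1::real}"
    using has_integral_const_real[of "(cmod c)\<^sup>2" 0 1] by simp
  from has_integral_add[OF has_integral_diff[OF J has_integral_mult_right[OF K, of 2]] this]
  have "((\<lambda>t. (cmod (f t - c))\<^sup>2) has_integral
      integral {0..1} (\<lambda>t. (cmod (f t))\<^sup>2) - 2 * (cmod c)\<^sup>2 + (cmod c)\<^sup>2) {0..1}"
    unfolding eq cc .
  then have "0 \<le> integral {0..1} (\<lambda>t. (cmod (f t))\<^sup>2) - 2 * (cmod c)\<^sup>2 + (cmod c)\<^sup>2"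
    by (rule has_integral_nonneg) simp
  then show ?thesis by (simp add: nf c_def)
qed

lemma entire_deriv_bound:
  assumes F: "entire F" and r: "r > 0"
    and B: "\<And>w. cmod w = r \<Longrightarrow> cmod (F (z + w *s v)) \<le> B"
  shows "cmod (dir_deriv F v z) \<le> B / r"
proof -
  have "cmod ((deriv ^^ 1) (\<lambda>w. F (z + w *s v)) 0) \<le> fact 1 * B / r ^ 1"
    by (rule Cauchy_inequality)
       (use B r in \<open>auto intro!: entire_line_holomorphic F holomorphic_on_imp_continuous_on\<close>)
  moreover have "deriv (\<lambda>w. F (z + w *s v)) 0 = dir_deriv F v z"
    using DERIV_imp_deriv[OF entire_line_deriv[OF F, of z v 0]] by simp
  ultimately show ?thesis by simp
qed

section \<open>Homogeneous polynomials\<close>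

lemma finite_exponents: "finite {m :: 'n::finite \<Rightarrow> nat. sum m UNIV = d}"
proof (rule finite_subset)
  show "{m :: 'n \<Rightarrow> nat. sum m UNIV = d} \<subseteq>
      {f. \<forall>x. (x \<in> UNIV \<longrightarrow> f x \<in> {..d}) \<and> (x \<notin> UNIV \<longrightarrow> f x = 0)}"
  proof
    fix m :: "'n \<Rightarrow> nat" assume "m \<in> {m. sum m UNIV = d}"
    moreover have "m i \<le> sum m UNIV" for i by (rule member_le_sum) auto
    ultimately show "m \<in> {f. \<forall>x. (x \<in> UNIV \<longrightarrow> f x \<in> {..d}) \<and> (x \<notin> UNIV \<longrightarrow> f x = 0)}"
      by simp
  qed
  show "finite {f. \<forall>x. (x \<in> (UNIV :: 'n set) \<longrightarrow> f x \<in> {..d}) \<and> (x \<notin> (UNIV :: 'n set) \<longrightarrow> f x = 0)}"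
    by (rule finite_set_of_finite_funs) auto
qed

lemma hom_polyI: "(\<And>z. F z = (\<Sum>m | sum m UNIV = d. c m * (\<Prod>i\<in>UNIV. (z $ i) ^ m i))) \<Longrightarrow> F \<in> hom_poly d"
  unfolding hom_poly_def by auto

lemma hom_poly_entire: "F \<in> hom_poly d \<Longrightarrow> entire F"
  unfolding hom_poly_def
  by (auto intro!: entire_sum entire_mult entire_const entire_prod entire_power entire_component)

lemma hom_poly_scale: "F \<in> hom_poly d \<Longrightarrow> F (w *s z) = w ^ d * F z"
  unfolding hom_poly_def
  by (auto simp: power_mult_distrib prod.distrib power_sum[symmetric] sum_distrib_left mult_ac intro!: sum.cong)

lemma hom_poly_zero: "(\<lambda>z. 0) \<in> hom_poly d"
  by (rule hom_polyI[where c = "\<lambda>_. 0"]) simp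

lemma hom_poly_add: "F \<in> hom_poly d \<Longrightarrow> G \<in> hom_poly d \<Longrightarrow> (\<lambda>z. F z + G z) \<in> hom_poly d"
proof -
  assume "F \<in> hom_poly d" "G \<in> hom_poly d"
  then obtain c c' where
    "F = (\<lambda>z. \<Sum>m | sum m UNIV = d. c m * (\<Prod>i\<in>UNIV. (z $ i) ^ m i))"
    "G = (\<lambda>z. \<Sum>m | sum m UNIV = d. c' m * (\<Prod>i\<in>UNIV. (z $ i) ^ m i))"
    unfolding hom_poly_def by blast
  then show ?thesis
    by (intro hom_polyI[where c = "\<lambda>m. c m + c' m"]) (simp add: sum.distrib algebra_simps)
qed

lemma hom_poly_cmult: "F \<in> hom_poly d \<Longrightarrow> (\<lambda>z. k * F z) \<in> hom_poly d"
proof -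
  assume "F \<in> hom_poly d"
  then obtain c where "F = (\<lambda>z. \<Sum>m | sum m UNIV = d. c m * (\<Prod>i\<in>UNIV. (z $ i) ^ m i))"
    unfolding hom_poly_def by blast
  then show ?thesis
    by (intro hom_polyI[where c = "\<lambda>m. k * c m"]) (simp add: sum_distrib_left mult.assoc)
qed

lemma hom_poly_sum: "(\<And>i. i \<in> I \<Longrightarrow> f i \<in> hom_poly d) \<Longrightarrow> (\<lambda>z. \<Sum>i\<in>I. f i z) \<in> hom_poly d"
  by (induction I rule: infinite_finite_induct) (auto intro: hom_poly_zero hom_poly_add)

lemma monomial_hom_poly:
  assumes "sum m UNIV = d" shows "(\<lambda>z. \<Prod>i\<in>UNIV. (z $ i) ^ m i) \<in> hom_poly d"
proof (rule hom_polyI[where c = "\<lambda>m'. if m' = m then 1 else 0"])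
  fix z :: "complex ^ 'a"
  have "(\<Sum>m' | sum m' UNIV = d. (if m' = m then 1 else 0) * (\<Prod>i\<in>UNIV. (z $ i) ^ m' i)) =
      (\<Sum>m' | sum m' UNIV = d. if m' = m then \<Prod>i\<in>UNIV. (z $ i) ^ m i else 0)"
    by (rule sum.cong) auto
  then show "(\<Prod>i\<in>UNIV. (z $ i) ^ m i) = (\<Sum>m' | sum m' UNIV = d. (if m' = m then 1 else 0) * (\<Prod>i\<in>UNIV. (z $ i) ^ m' i))"
    using assms by (simp add: finite_exponents)
qed

lemma hom_poly_mult_component:
  assumes "F \<in> hom_poly d" shows "(\<lambda>z. z $ i * F z) \<in> hom_poly (Suc d)"
proof -
  obtain c where c: "F = (\<lambda>z. \<Sum>m | sum m UNIV = d. c m * (\<Prod>i\<in>UNIV. (z $ i) ^ m i))"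
    using assms unfolding hom_poly_def by blast
  have "(\<lambda>z. \<Prod>j\<in>UNIV. (z $ j) ^ (m(i := Suc (m i))) j) \<in> hom_poly (Suc d)" if "sum m UNIV = d" for m
  proof (rule monomial_hom_poly)
    have "sum (m(i := Suc (m i))) UNIV = (\<Sum>j\<in>UNIV. m j + (if j = i then 1 else 0))"
      by (rule sum.cong) auto
    then show "sum (m(i := Suc (m i))) UNIV = Suc d" using that by (simp add: sum.distrib)
  qed
  then have "(\<lambda>z. \<Sum>m | sum m UNIV = d. c m * (\<Prod>j\<in>UNIV. (z $ j) ^ (m(i := Suc (m i))) j)) \<in> hom_poly (Suc d)"
    by (intro hom_poly_sum hom_poly_cmult) auto
  moreover have "(\<Prod>j\<in>UNIV. (z $ j) ^ (m(i := Suc (m i))) j) = z $ i * (\<Prod>j\<in>UNIV. (z $ j) ^ m j)"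
    for z :: "complex ^ 'a" and m
  proof -
    have "(\<Prod>j\<in>UNIV. (z $ j) ^ (m(i := Suc (m i))) j) = (\<Prod>j\<in>UNIV. (if j = i then z $ i else 1) * (z $ j) ^ m j)"
      by (rule prod.cong) auto
    then show ?thesis by (simp add: prod.distrib)
  qed
  ultimately show ?thesis by (simp add: c sum_distrib_left mult_ac)
qed

section \<open>Recognising polynomials in several variables\<close>

definition polyfun_vec :: "(complex ^ 'n::finite \<Rightarrow> complex) \<Rightarrow> bool"
  where "polyfun_vec F \<longleftrightarrow> (\<exists>N p. (\<forall>d. p d \<in> hom_poly d) \<and> F = (\<lambda>z. \<Sum>d\<le>N. p d z))"

lemma polyfun_vec_hom_poly: "F \<in> hom_poly d \<Longrightarrow> polyfun_vec F"
  unfolding polyfun_vec_def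
  by (rule exI[of _ d], rule exI[of _ "\<lambda>k. if k = d then F else (\<lambda>z. 0)"])
     (auto simp: hom_poly_zero fun_eq_iff if_distribR)

lemma polyfun_vec_const: "polyfun_vec (\<lambda>z. c)"
proof (rule polyfun_vec_hom_poly[of _ 0])
  have "sum m UNIV = 0 \<longleftrightarrow> m = (\<lambda>_. 0)" for m :: "'a \<Rightarrow> nat" by (auto simp: fun_eq_iff)
  then show "(\<lambda>z::complex ^ 'a. c) \<in> hom_poly 0"
    by (intro hom_polyI[where c = "\<lambda>_. c"]) simp
qed

lemma polyfun_vec_add:
  assumes "polyfun_vec F" "polyfun_vec G" shows "polyfun_vec (\<lambda>z. F z + G z)"
proof -
  obtain N p where F: "\<And>d. p d \<in> hom_poly d" "F = (\<lambda>z. \<Sum>d\<le>N. p d z)"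
    using assms(1) unfolding polyfun_vec_def by blast
  obtain M r where G: "\<And>d. r d \<in> hom_poly d" "G = (\<lambda>z. \<Sum>d\<le>M. r d z)"
    using assms(2) unfolding polyfun_vec_def by blast
  define s where "s d z = (if d \<le> N then p d z else 0) + (if d \<le> M then r d z else 0)" for d z
  have "s d \<in> hom_poly d" for d
    unfolding s_def by (rule hom_poly_add) (cases "d \<le> N"; cases "d \<le> M"; simp add: F G hom_poly_zero)+
  moreover have "F z + G z = (\<Sum>d\<le>max N M. s d z)" for z
  proof -
    have "(\<Sum>d\<le>max N M. if d \<le> N then p d z else 0) = F z"
      unfolding F by (rule sum.mono_neutral_cong_right) auto
    moreover have "(\<Sum>d\<le>max N M. if d \<le> M then r d z else 0) = G z"
      unfolding G by (rule sum.mono_neutral_cong_right) auto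
    ultimately show ?thesis by (simp add: s_def sum.distrib)
  qed
  ultimately show ?thesis unfolding polyfun_vec_def by blast
qed

lemma polyfun_vec_sum: "(\<And>i. i \<in> I \<Longrightarrow> polyfun_vec (f i)) \<Longrightarrow> polyfun_vec (\<lambda>z. \<Sum>i\<in>I. f i z)"
  by (induction I rule: infinite_finite_induct) (auto intro: polyfun_vec_const polyfun_vec_add)

lemma polyfun_vec_cmult:
  assumes "polyfun_vec F" shows "polyfun_vec (\<lambda>z. k * F z)"
proof -
  obtain N p where F: "\<And>d. p d \<in> hom_poly d" "F = (\<lambda>z. \<Sum>d\<le>N. p d z)"
    using assms(1) unfolding polyfun_vec_def by blast
  show ?thesis unfolding F sum_distrib_left
    by (intro polyfun_vec_sum polyfun_vec_hom_poly[OF hom_poly_cmult[OF F(1)]])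
qed

lemma polyfun_vec_mult_component:
  assumes "polyfun_vec F" shows "polyfun_vec (\<lambda>z. z $ i * F z)"
proof -
  obtain N p where F: "\<And>d. p d \<in> hom_poly d" "F = (\<lambda>z. \<Sum>d\<le>N. p d z)"
    using assms(1) unfolding polyfun_vec_def by blast
  show ?thesis unfolding F sum_distrib_left
    by (intro polyfun_vec_sum polyfun_vec_hom_poly[OF hom_poly_mult_component[OF F(1)]])
qed

lemma polyfun_vec_poly_mult:
  assumes "polyfun_vec F" shows "polyfun_vec (\<lambda>z. poly q (z $ i) * F z)"
proof (induction q)
  case (pCons c q)
  have "polyfun_vec (\<lambda>z. c * F z + z $ i * (poly q (z $ i) * F z))"
    by (intro polyfun_vec_add polyfun_vec_cmult polyfun_vec_mult_component pCons assms)
  then show ?case by (simp add: algebra_simps)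
qed (simp add: polyfun_vec_const)

text \<open>The basis polynomials \<open>l j\<close> depend on D alone, so a whole family of
  polynomials of degree at most D is interpolated by the same formula from the values at 0, ...,
  D.\<close>

lemma lagrange_interpolation:
  obtains l :: "nat \<Rightarrow> complex poly" where
    "\<And>f w. degree f \<le> D \<Longrightarrow> poly f w = (\<Sum>j\<le>D. poly (l j) w * poly f (of_nat j))"
proof -
  define l0 :: "nat \<Rightarrow> complex poly" where "l0 j = (\<Prod>i\<in>{..D} - {j}. [:- of_nat i, 1:])" for j
  define l where "l j = smult (inverse (poly (l0 j) (of_nat j))) (l0 j)" for j
  have deg: "degree (l j) \<le> D" if "j \<le> D" for j
  proof -
    have "degree (l0 j) \<le> (\<Sum>i\<in>{..D} - {j}. degree [:- of_nat i, 1 :: complex:])"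
      unfolding l0_def by (rule order_trans[OF degree_prod_sum_le]) simp_all
    also have "\<dots> = D" using that by simp
    finally show ?thesis unfolding l_def using degree_smult_le order_trans by blast
  qed
  have val: "poly (l j) (of_nat k) = (if j = k then 1 else 0)" if "j \<le> D" "k \<le> D" for j k
  proof -
    have "poly (l0 j) (of_nat j) \<noteq> 0" by (auto simp: l0_def poly_prod)
    moreover have "poly (l0 j) (of_nat k) = 0" if "j \<noteq> k"
      using that \<open>k \<le> D\<close> by (auto simp: l0_def poly_prod intro!: bexI[of _ k])
    ultimately show ?thesis by (auto simp: l_def)
  qed
  have "poly f w = (\<Sum>j\<le>D. poly (l j) w * poly f (of_nat j))" if f: "degree f \<le> D" for f w
  proof -
    define h where "h = (\<Sum>j\<le>D. smult (poly f (of_nat j)) (l j))"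
    have "f = h"
    proof (rule poly_eqI_degree[of "of_nat ` {..D}"])
      show "poly f x = poly h x" if "x \<in> of_nat ` {..D}" for x
      proof -
        from that obtain k where k: "x = of_nat k" "k \<le> D" by blast
        have "poly h x = (\<Sum>j\<le>D. if j = k then poly f x else 0)"
          unfolding h_def k poly_sum by (intro sum.cong) (auto simp: val k)
        then show ?thesis using k by simp
      qed
      have "card (of_nat ` {..D} :: complex set) = Suc D"
        by (subst card_image) (auto simp: inj_on_def)
      moreover have "degree h \<le> D" unfolding h_def
        by (intro degree_sum_le) (auto intro: order_trans[OF degree_smult_le] deg)
      ultimately show "degree f < card (of_nat ` {..D} :: complex set)" "degree h < card (of_nat ` {..D} :: complex set)"
        using f by simp_all
    qed
    then have "poly f w = poly h w" by simp
    then show ?thesis by (simp add: h_def poly_sum mult.commute)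
  qed
  then show thesis by (rule that)
qed

definition upd :: "complex ^ 'n::finite \<Rightarrow> 'n \<Rightarrow> complex \<Rightarrow> complex ^ 'n"
  where "upd z i w = (\<chi> j. if j = i then w else z $ j)"

lemma upd_component: "upd z i w $ j = (if j = i then w else z $ j)"
  by (simp add: upd_def)

lemma upd_simps: "upd (upd z i v) i w = upd z i w" "i \<noteq> j \<Longrightarrow> upd (upd z j v) i w = upd (upd z i w) j v"
  "upd z i (z $ i) = z"
  by (auto simp: upd_def vec_eq_iff)

text \<open>Interpolating in one variable writes F as a combination of its restrictions to z_i = 0,
  ..., D, which no longer depend on z_i; the coefficients are polynomials in z_i. The common bound D
  fixes the number of nodes.\<close>

lemma separately_poly_imp_polyfun_vec:
  fixes F :: "complex ^ 'n::finite \<Rightarrow> complex"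
  assumes "\<And>z i. \<exists>f. degree f \<le> D \<and> (\<forall>w. F (upd z i w) = poly f w)"
  shows "polyfun_vec F"
proof -
  obtain l :: "nat \<Rightarrow> complex poly" where
    l: "\<And>f w. degree f \<le> D \<Longrightarrow> poly f w = (\<Sum>j\<le>D. poly (l j) w * poly f (of_nat j))"
    using lagrange_interpolation[of D] by blast
  \<comment> \<open>The induction runs over a finite set S of variables that determine the value of
    F.\<close>
  have *: "polyfun_vec F" if "finite S" "\<And>z z'. (\<forall>i\<in>S. z $ i = z' $ i) \<Longrightarrow> F z = F z'"
    "\<And>z i. \<exists>f. degree f \<le> D \<and> (\<forall>w. F (upd z i w) = poly f w)" for S and F :: "complex ^ 'n \<Rightarrow> complex"
    using that
  proof (induction S arbitrary: F)
    case empty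
    then have "F = (\<lambda>z. F 0)" by auto
    then show ?case using polyfun_vec_const[of "F 0"] by metis
  next
    case (insert i S)
    have G: "polyfun_vec (\<lambda>z. F (upd z i (of_nat j)))" for j
    proof (rule insert.IH)
      show "F (upd z i (of_nat j)) = F (upd z' i (of_nat j))" if "\<forall>i\<in>S. z $ i = z' $ i" for z z'
        by (rule insert.prems(1)) (use that in \<open>auto simp: upd_component\<close>)
      show "\<exists>f. degree f \<le> D \<and> (\<forall>w. F (upd (upd z k w) i (of_nat j)) = poly f w)" for z k
      proof (cases "k = i")
        case True
        then show ?thesis
          by (intro exI[of _ "[:F (upd z i (of_nat j)):]"]) (simp add: upd_simps)
      next
        case False
        then show ?thesis
          using insert.prems(2)[of "upd z i (of_nat j)" k] by (simp add: upd_simps(2))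
      qed
    qed
    have "F z = (\<Sum>j\<le>D. poly (l j) (z $ i) * F (upd z i (of_nat j)))" for z
    proof -
      obtain f where f: "degree f \<le> D" "\<And>w. F (upd z i w) = poly f w"
        using insert.prems(2)[of z i] by blast
      have "F z = poly f (z $ i)" using f(2)[of "z $ i"] by (simp add: upd_simps)
      also have "\<dots> = (\<Sum>j\<le>D. poly (l j) (z $ i) * poly f (of_nat j))" by (rule l[OF f(1)])
      finally show ?thesis unfolding f(2) .
    qed
    then have "F = (\<lambda>z. \<Sum>j\<le>D. poly (l j) (z $ i) * F (upd z i (of_nat j)))" by (rule ext)
    moreover have "polyfun_vec (\<lambda>z. \<Sum>j\<le>D. poly (l j) (z $ i) * F (upd z i (of_nat j)))"
      by (intro polyfun_vec_sum polyfun_vec_poly_mult G)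
    ultimately show ?case by metis
  qed
  show ?thesis
  proof (rule *[of UNIV])
    show "F z = F z'" if "\<forall>i\<in>UNIV. z $ i = z' $ i" for z z'
      using that by (metis UNIV_I vec_eq_iff)
  qed (use assms in auto)
qed

text \<open>Liouville's theorem in each variable.\<close>

lemma entire_growth_polyfun_vec:
  fixes F :: "complex ^ 'n::finite \<Rightarrow> complex"
  assumes F: "entire F" and B: "\<And>z. cmod (F z) \<le> C * (1 + norm z) ^ D"
  shows "polyfun_vec F"
proof (rule separately_poly_imp_polyfun_vec[where D = D])
  fix z and i :: 'n
  define u where "u = upd z i 0"
  have upd: "upd z i w = u + w *s axis i 1" for w
    by (auto simp: u_def upd_def vec_eq_iff axis_def)
  define f where "f w = F (upd z i w)" for w
  have hol: "f holomorphic_on UNIV" unfolding f_def upd by (rule entire_line_holomorphic[OF F])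
  have C0: "C \<ge> 0" using order_trans[OF norm_ge_zero B[of 0]] by simp
  have bound: "cmod (f w) \<le> (C * (2 + norm u) ^ D) * cmod w ^ D" if "1 \<le> cmod w" for w
  proof -
    have "norm (u + w *s axis i 1) \<le> norm u + cmod w"
      using norm_triangle_ineq[of u "w *s axis i 1"] by (simp add: norm_cscale norm_axis_1)
    then have "1 + norm (u + w *s axis i 1) \<le> (2 + norm u) * cmod w"
      using that mult_left_mono[OF that, of "norm u"] by (simp add: algebra_simps)
    then have "(1 + norm (u + w *s axis i 1)) ^ D \<le> ((2 + norm u) * cmod w) ^ D"
      by (intro power_mono) auto
    then have "C * (1 + norm (u + w *s axis i 1)) ^ D \<le> C * ((2 + norm u) * cmod w) ^ D"
      by (intro mult_left_mono C0)
    then show ?thesis using B[of "u + w *s axis i 1"]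
      by (simp add: f_def upd power_mult_distrib mult.assoc)
  qed
  have "f w = (\<Sum>k\<le>D. (deriv ^^ k) f 0 / fact k * w ^ k)" for w
    by (rule Liouville_polynomial[OF hol bound])
  then have "f w = poly (\<Sum>k\<le>D. monom ((deriv ^^ k) f 0 / fact k) k) w" for w
    by (simp add: poly_sum poly_monom)
  moreover have "degree (\<Sum>k\<le>D. monom ((deriv ^^ k) f 0 / fact k) k) \<le> D"
    by (intro degree_sum_le) (auto intro: order_trans[OF degree_monom_le])
  ultimately show "\<exists>f. degree f \<le> D \<and> (\<forall>w. F (upd z i w) = poly f w)"
    unfolding f_def by blast
qed

lemma tay_hom_poly_sum:
  assumes "\<And>d. d \<le> N \<Longrightarrow> p d \<in> hom_poly d"
  shows "tay (\<lambda>z. \<Sum>d\<le>N. p d z) d z = (if d \<le> N then p d z else 0)"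
  by (rule tay_eqI) (simp add: hom_poly_scale[OF assms] mult.commute)

lemma polyfun_vec_tay:
  assumes "polyfun_vec F" shows "tay F d \<in> hom_poly d"
proof -
  obtain N p where F: "\<And>d. p d \<in> hom_poly d" "F = (\<lambda>z. \<Sum>d\<le>N. p d z)"
    using assms(1) unfolding polyfun_vec_def by blast
  have "tay F d = (\<lambda>z. if d \<le> N then p d z else 0)"
    unfolding F(2) by (rule ext) (rule tay_hom_poly_sum[OF F(1)])
  then show ?thesis using F(1) hom_poly_zero by (cases "d \<le> N") simp_all
qed

lemma homogeneous_bound:
  fixes P :: "complex ^ 'n::finite \<Rightarrow> complex"
  assumes "continuous_on UNIV P" and hom: "\<And>w z. P (w *s z) = w ^ d * P z"
  obtains C where "C \<ge> 0" "\<And>z. cmod (P z) \<le> C * norm z ^ d"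
proof -
  have "compact (P ` sphere 0 1)"
    by (rule compact_continuous_image[OF continuous_on_subset[OF assms(1)]]) auto
  then obtain C where C': "C > 0" "\<forall>x\<in>P ` sphere 0 1. cmod x \<le> C"
    using compact_imp_bounded[of "P ` sphere 0 1"] unfolding bounded_pos by blast
  have C: "cmod (P z) \<le> C" if "norm z = 1" for z
    using C'(2) that by auto
  have "cmod (P z) \<le> C * norm z ^ d" for z
  proof (cases "z = 0")
    case True
    show ?thesis
    proof (cases d)
      case 0
      \<comment> \<open>For d = 0 homogeneity at w = 0 reads P 0 = 0^0 P u = P u for every u, so the
        bound on the sphere applies; \<open>undefined\<close> merely names some index.\<close>
      have "P z = P (0 *s axis undefined 1)" using True by simp
      also have "\<dots> = P (axis undefined 1)" using hom[of 0 "axis undefined 1"] 0 by simp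
      finally show ?thesis using 0 C[of "axis undefined 1"] by (simp add: norm_axis_1)
    next
      case (Suc k)
      then show ?thesis using hom[of 0 z] True C'(1) by simp
    qed
  next
    case False
    define y where "y = of_real (inverse (norm z)) *s z"
    have "norm y = 1" using False by (simp add: y_def norm_cscale norm_inverse)
    moreover have "z = of_real (norm z) *s y"
      using False by (simp add: y_def vector_smult_assoc flip: of_real_mult)
    then have "P z = of_real (norm z) ^ d * P y" using hom by metis
    ultimately show ?thesis
      using C[of y] by (simp add: norm_mult norm_power mult.commute mult_right_mono)
  qed
  then show thesis using that[of C] C'(1) by simp
qed

lemma hom_poly_bound:
  assumes "F \<in> hom_poly d"
  obtains C where "C \<ge> 0" "\<And>z. cmod (F z) \<le> C * norm z ^ d"
  by (rule homogeneous_bound[OF entire_continuous[OF hom_poly_entire[OF assms]] hom_poly_scale[OF assms]], rule that)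

text \<open>The parts are so far only continuous and homogeneous, but that already bounds part d by
  a multiple of |z|^d. A finite sum of such bounds is polynomial growth, so Liouville makes F a
  polynomial and its parts homogeneous polynomials.\<close>

lemma tay_finite_imp_hom_poly:
  assumes F: "entire F" and D: "\<And>d. d > D \<Longrightarrow> tay F d = (\<lambda>z. 0)"
  shows "F = (\<lambda>z. \<Sum>d\<le>D. tay F d z)" "tay F d \<in> hom_poly d"
proof -
  have sum: "F z = (\<Sum>d\<le>D. tay F d z)" for z
  proof (rule sums_unique2[OF tay_sums[OF F]])
    show "(\<lambda>d. tay F d z) sums (\<Sum>d\<le>D. tay F d z)"
      by (rule sums_finite) (auto simp: D)
  qed
  then show "F = (\<lambda>z. \<Sum>d\<le>D. tay F d z)" by (rule ext)
  have "\<forall>d. \<exists>C. C \<ge> 0 \<and> (\<forall>z. cmod (tay F d z) \<le> C * norm z ^ d)"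
    by (intro allI, rule homogeneous_bound[OF continuous_tay[OF F] tay_scale[OF F]]) blast
  from choice[OF this] obtain C where C: "\<And>d. C d \<ge> 0" "\<And>d z. cmod (tay F d z) \<le> C d * norm z ^ d"
    by blast
  have "cmod (F z) \<le> (\<Sum>d\<le>D. C d) * (1 + norm z) ^ D" for z
  proof -
    have "cmod (F z) \<le> (\<Sum>d\<le>D. cmod (tay F d z))" using norm_sum[of "\<lambda>d. tay F d z" "{..D}"] by (simp only: sum[of z])
    also have "\<dots> \<le> (\<Sum>d\<le>D. C d * (1 + norm z) ^ D)"
    proof (rule sum_mono)
      fix d assume "d \<in> {..D}"
      have "norm z ^ d \<le> (1 + norm z) ^ d" by (intro power_mono) auto
      also have "\<dots> \<le> (1 + norm z) ^ D" using \<open>d \<in> {..D}\<close> by (intro power_increasing) auto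
      finally show "cmod (tay F d z) \<le> C d * (1 + norm z) ^ D"
        using C(2)[of d z] mult_left_mono[OF _ C(1)[of d]] by (meson order_trans)
    qed
    finally show ?thesis by (simp add: sum_distrib_right)
  qed
  then show "tay F d \<in> hom_poly d" by (intro polyfun_vec_tay entire_growth_polyfun_vec[OF F])
qed

section \<open>Integrals of radial weights\<close>

lemma two_power_power2: "((2::real) ^ j)\<^sup>2 = 4 ^ j"
  unfolding power2_eq_square power_mult_distrib[symmetric] by simp

lemma emeasure_ball_vec:
  assumes "r \<ge> 0"
  shows "emeasure lborel (ball (0 :: complex ^ 'n::finite) r) =
    ennreal (unit_ball_vol (real (2 * CARD('n))) * (r\<^sup>2) ^ CARD('n))"
  using assms by (simp add: emeasure_ball power_mult[symmetric] mult.commute)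

lemma dyadic_shell:
  fixes x :: real
  assumes "1 \<le> x"
  obtains k where "2 ^ k \<le> x" "x < 2 ^ Suc k"
proof -
  obtain m where m: "x < 2 ^ m" using real_arch_pow[of 2 x] by auto
  define l where "l = (LEAST m. x < 2 ^ m)"
  have l: "x < 2 ^ l" unfolding l_def using m by (rule LeastI)
  then obtain k where k: "l = Suc k" using assms by (cases l) auto
  have "\<not> x < 2 ^ k" using not_less_Least[of k "\<lambda>m. x < 2 ^ m"] k by (simp add: l_def)
  then show thesis using that[of k] l k by simp
qed

text \<open>The ball of radius 2^(k+1) has volume of order 4^(k n), while the integrand on the k-th
  dyadic shell is at most 4^(-k (n+1)); the contributions are dominated by a geometric series of
  ratio 1/4.\<close>

lemma integral_power_finite:
  "(\<integral>\<^sup>+z. ennreal (1 / (1 + (norm (z :: complex ^ 'n::finite))\<^sup>2) ^ (CARD('n) + 1)) \<partial>lborel) < \<infinity>"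
proof -
  let ?n = "CARD('n)"
  define V where "V = unit_ball_vol (real (2 * ?n))"
  have V: "V \<ge> 0" by (simp add: V_def unit_ball_vol_nonneg)
  define B :: "nat \<Rightarrow> (complex ^ 'n) set" where "B k = ball 0 (2 ^ Suc k)" for k
  have eB: "emeasure lborel (B k) = ennreal (V * (4 ^ Suc k) ^ ?n)" for k
    unfolding B_def V_def
    by (subst emeasure_ball_vec) (simp_all add: two_power_power2 del: power_Suc)
  have "(\<integral>\<^sup>+z. ennreal (1 / (1 + (norm (z :: complex ^ 'n))\<^sup>2) ^ (?n + 1)) \<partial>lborel) \<le>
      (\<integral>\<^sup>+z. indicator (ball 0 1) z + (\<Sum>k. ennreal ((1 / 4 ^ k) ^ (?n + 1)) * indicator (B k) z) \<partial>lborel)"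
  proof (rule nn_integral_mono)
    fix z :: "complex ^ 'n"
    let ?f = "ennreal (1 / (1 + (norm z)\<^sup>2) ^ (?n + 1))"
    show "?f \<le> indicator (ball 0 1) z + (\<Sum>k. ennreal ((1 / 4 ^ k) ^ (?n + 1)) * indicator (B k) z)"
    proof (cases "norm z < 1")
      case True
      have "(1 + (norm z)\<^sup>2) ^ (?n + 1) \<ge> 1" by (rule one_le_power) simp
      then have "?f \<le> 1" by (simp add: ennreal_le_1 divide_le_eq_1)
      then show ?thesis using True by (simp add: add_increasing2)
    next
      case False
      then obtain k where k: "2 ^ k \<le> norm z" "norm z < 2 ^ Suc k" using dyadic_shell[of "norm z"] by auto
      have "(2 ^ k)\<^sup>2 \<le> (norm z)\<^sup>2" using k(1) by (intro power_mono) auto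
      then have "4 ^ k \<le> 1 + (norm z)\<^sup>2" by (simp add: two_power_power2)
      then have "1 / (1 + (norm z)\<^sup>2) \<le> 1 / 4 ^ k"
        by (intro divide_left_mono mult_pos_pos) (simp_all add: add_pos_nonneg)
      then have "(1 / (1 + (norm z)\<^sup>2)) ^ (?n + 1) \<le> (1 / 4 ^ k) ^ (?n + 1)" by (intro power_mono) auto
      then have "?f \<le> ennreal ((1 / 4 ^ k) ^ (?n + 1)) * indicator (B k) z"
        using k(2) by (simp add: B_def power_one_over ennreal_leI)
      also have "\<dots> \<le> (\<Sum>k. ennreal ((1 / 4 ^ k) ^ (?n + 1)) * indicator (B k) z)"
      proof -
        have "u k \<le> (\<Sum>k. u k)" for u :: "nat \<Rightarrow> ennreal"
          using sum_le_suminf[of u "{k}"] by simp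
        then show ?thesis .
      qed
      finally show ?thesis by (simp add: add_increasing)
    qed
  qed
  also have "\<dots> = emeasure lborel (ball (0 :: complex ^ 'n) 1) +
      (\<Sum>k. ennreal ((1 / 4 ^ k) ^ (?n + 1)) * emeasure lborel (B k))"
  proof -
    have [measurable]: "B k \<in> sets borel" for k by (simp add: B_def)
    define u where "u k z = ennreal ((1 / 4 ^ k) ^ (?n + 1)) * indicator (B k) z" for k z
    have um: "u k \<in> borel_measurable lborel" for k
      unfolding u_def by (intro borel_measurable_times_ennreal borel_measurable_const borel_measurable_indicator) simp
    have u: "(\<integral>\<^sup>+z. u k z \<partial>lborel) = ennreal ((1 / 4 ^ k) ^ (?n + 1)) * emeasure lborel (B k)" for k
      unfolding u_def by (rule nn_integral_cmult_indicator) simp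
    have "(\<integral>\<^sup>+z. indicator (ball (0 :: complex ^ 'n) 1) z \<partial>lborel) = emeasure lborel (ball (0 :: complex ^ 'n) 1)"
      by (subst nn_integral_indicator) simp_all
    moreover have "(\<integral>\<^sup>+z. indicator (ball (0 :: complex ^ 'n) 1) z + (\<Sum>k. u k z) \<partial>lborel) =
        (\<integral>\<^sup>+z. indicator (ball (0 :: complex ^ 'n) 1) z \<partial>lborel) + (\<integral>\<^sup>+z. (\<Sum>k. u k z) \<partial>lborel)"
      by (rule nn_integral_add[OF borel_measurable_indicator borel_measurable_suminf_order[OF um]]) simp
    moreover have "(\<integral>\<^sup>+z. (\<Sum>k. u k z) \<partial>lborel) = (\<Sum>k. \<integral>\<^sup>+z. u k z \<partial>lborel)"
      by (rule nn_integral_suminf[OF um])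
    ultimately have "(\<integral>\<^sup>+z. indicator (ball (0 :: complex ^ 'n) 1) z + (\<Sum>k. u k z) \<partial>lborel) =
        emeasure lborel (ball (0 :: complex ^ 'n) 1) + (\<Sum>k. ennreal ((1 / 4 ^ k) ^ (?n + 1)) * emeasure lborel (B k))"
      by (simp only: u)
    then show ?thesis unfolding u_def .
  qed
  also have "(\<lambda>k. ennreal ((1 / 4 ^ k) ^ (?n + 1)) * emeasure lborel (B k)) =
      (\<lambda>k. ennreal (V * 4 ^ ?n * (1 / 4) ^ k))"
  proof
    fix k
    have "(1 / 4 ^ k) ^ (?n + 1) * (V * (4 ^ Suc k) ^ ?n) = V * 4 ^ ?n * (1 / 4 :: real) ^ k"
      by (simp add: power_mult_distrib power_one_over field_simps)
    then show "ennreal ((1 / 4 ^ k) ^ (?n + 1)) * emeasure lborel (B k) = ennreal (V * 4 ^ ?n * (1 / 4) ^ k)"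
      unfolding eB by (simp add: ennreal_mult[symmetric] V)
  qed
  also have "emeasure lborel (ball (0 :: complex ^ 'n) 1) + (\<Sum>k. ennreal (V * 4 ^ ?n * (1 / 4) ^ k)) < \<infinity>"
  proof -
    have "(\<Sum>k. ennreal (V * 4 ^ ?n * (1 / 4) ^ k)) \<noteq> top"
      using V by (intro ennreal_suminf_neq_top summable_mult summable_geometric) auto
    then show ?thesis
      using emeasure_lborel_ball_finite[of "0 :: complex ^ 'n" 1] by (simp add: less_top)
  qed
  finally show ?thesis .
qed

text \<open>Logarithmic divergence: the lower bound is of size |z|^(-2n), and every dyadic shell has
  at least half the volume of its outer ball, so each shell contributes at least c V / 2.\<close>

lemma shell_integral_infinite:
  fixes f :: "complex ^ 'n::finite \<Rightarrow> ennreal"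
  assumes c: "c > 0"
    and f: "\<And>z k. 2 ^ k \<le> norm z \<Longrightarrow> norm z < 2 ^ Suc k \<Longrightarrow> ennreal (c / (4 ^ Suc k) ^ CARD('n)) \<le> f z"
  shows "(\<integral>\<^sup>+z. f z \<partial>lborel) = \<infinity>"
proof -
  let ?n = "CARD('n)"
  define V where "V = unit_ball_vol (real (2 * ?n))"
  have V: "V > 0" by (simp add: V_def unit_ball_vol_pos)
  define A :: "nat \<Rightarrow> (complex ^ 'n) set" where "A k = ball 0 (2 ^ Suc k) - ball 0 (2 ^ k)" for k
  have A_iff: "z \<in> A k \<longleftrightarrow> 2 ^ k \<le> norm z \<and> norm z < 2 ^ Suc k" for z k
    by (auto simp: A_def)
  have A_m [measurable]: "A k \<in> sets borel" for k by (simp add: A_def)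
  have eA: "ennreal (V * (4 ^ Suc k) ^ ?n / 2) \<le> emeasure lborel (A k)" for k
  proof -
    have e: "emeasure lborel (ball (0 :: complex ^ 'n) (2 ^ j)) = ennreal (V * (4 ^ j) ^ ?n)" for j
      unfolding V_def
      by (subst emeasure_ball_vec) (simp_all add: two_power_power2 del: power_Suc)
    have "emeasure lborel (A k) = ennreal (V * (4 ^ Suc k) ^ ?n) - ennreal (V * (4 ^ k) ^ ?n)"
      unfolding A_def
      by (subst emeasure_Diff) (auto simp: e subset_ball simp del: power_Suc intro!: subset_ball)
    also have "\<dots> = ennreal (V * (4 ^ Suc k) ^ ?n - V * (4 ^ k) ^ ?n)"
      using V by (simp add: ennreal_minus)
    finally have eq: "emeasure lborel (A k) = ennreal (V * (4 ^ Suc k) ^ ?n - V * (4 ^ k) ^ ?n)" .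
    have "(2::real) \<le> 4 ^ 1" by simp
    also have "\<dots> \<le> 4 ^ ?n" by (rule power_increasing) (simp_all add: Suc_leI)
    finally have "2 * (4 ^ k) ^ ?n \<le> ((4::real) ^ Suc k) ^ ?n"
      by (simp add: power_mult_distrib mult_right_mono)
    then have "V * (2 * (4 ^ k) ^ ?n) \<le> V * ((4::real) ^ Suc k) ^ ?n"
      using V by (intro mult_left_mono) auto
    then show ?thesis unfolding eq by (intro ennreal_leI) simp
  qed
  define I where "I = (\<integral>\<^sup>+z. f z \<partial>lborel)"
  have "ennreal (real N * (c * V / 2)) \<le> I" for N
  proof -
    have "ennreal (real N * (c * V / 2)) = ennreal (real N) * ennreal (c * V / 2)"
      by (rule ennreal_mult) (use c V in simp_all)
    also have "\<dots> = (\<Sum>k<N. ennreal (c * V / 2))"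
      by (simp add: ennreal_of_nat_eq_real_of_nat)
    also have "\<dots> \<le> (\<Sum>k<N. ennreal (c / (4 ^ Suc k) ^ ?n) * emeasure lborel (A k))"
    proof (rule sum_mono)
      fix k
      have "ennreal (c * V / 2) = ennreal (c / (4 ^ Suc k) ^ ?n) * ennreal (V * (4 ^ Suc k) ^ ?n / 2)"
        using c V by (simp add: ennreal_mult[symmetric])
      also have "\<dots> \<le> ennreal (c / (4 ^ Suc k) ^ ?n) * emeasure lborel (A k)"
        by (intro mult_left_mono eA) simp
      finally show "ennreal (c * V / 2) \<le> ennreal (c / (4 ^ Suc k) ^ ?n) * emeasure lborel (A k)" .
    qed
    also have "\<dots> = (\<integral>\<^sup>+z. (\<Sum>k<N. ennreal (c / (4 ^ Suc k) ^ ?n) * indicator (A k) z) \<partial>lborel)"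
      by (subst nn_integral_sum) (simp_all add: nn_integral_cmult del: power_Suc)
    also have "\<dots> \<le> I"
      unfolding I_def
    proof (rule nn_integral_mono)
      fix z
      show "(\<Sum>k<N. ennreal (c / (4 ^ Suc k) ^ ?n) * indicator (A k) z) \<le> f z"
      proof (cases "\<exists>k. z \<in> A k")
        case True
        then obtain k where k: "z \<in> A k" by blast
        have uniq: "j = k" if "z \<in> A j" for j
        proof -
          have "(2::real) ^ j < 2 ^ Suc k" "(2::real) ^ k < 2 ^ Suc j"
            using k that unfolding A_iff by linarith+
          then have "j < Suc k" "k < Suc j"
            by (auto dest!: power_less_imp_less_exp[rotated] simp del: power_Suc)
          then show ?thesis by simp
        qed
        have "(\<Sum>j<N. ennreal (c / (4 ^ Suc j) ^ ?n) * indicator (A j) z) =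
            (\<Sum>j<N. if j = k then ennreal (c / (4 ^ Suc k) ^ ?n) else 0)"
        proof (rule sum.cong[OF refl])
          fix j
          show "ennreal (c / (4 ^ Suc j) ^ ?n) * indicator (A j) z =
              (if j = k then ennreal (c / (4 ^ Suc k) ^ ?n) else 0)"
            using k uniq[of j] by (cases "z \<in> A j") auto
        qed
        also have "\<dots> \<le> ennreal (c / (4 ^ Suc k) ^ ?n)" by simp
        also have "\<dots> \<le> f z" using k unfolding A_iff by (intro f) blast+
        finally show ?thesis .
      next
        case False
        then show ?thesis by simp
      qed
    qed
    finally show ?thesis .
  qed
  then have "I = \<infinity>"
  proof (cases I)
    case (real r)
    obtain N where "r < real N * (c * V / 2)"
      using reals_Archimedean3[of "c * V / 2" ] c V by auto
    moreover have "real N * (c * V / 2) \<le> r"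
      using \<open>\<And>N. ennreal (real N * (c * V / 2)) \<le> I\<close>[of N] real by (simp add: ennreal_le_iff)
    ultimately show ?thesis by simp
  qed simp
  then show ?thesis by (simp add: I_def)
qed

section \<open>The weighted space\<close>

context radial_kaehler
begin

text \<open>Taken in the extended nonnegative reals, so that divergence is a value and square
  integrability an inequality.\<close>

definition wint :: "nat \<Rightarrow> (complex ^ 'n \<Rightarrow> real) \<Rightarrow> ennreal"
  where "wint q f = (\<integral>\<^sup>+z. ennreal (f z / (1 + (norm z)\<^sup>2) ^ q) \<partial>riem_vol g)"

lemma one_norm_pos: "1 + (norm z)\<^sup>2 > 0" by (simp add: add_pos_nonneg)

lemma wint_mono: "(\<And>z. f z \<le> h z) \<Longrightarrow> wint q f \<le> wint q h"
  unfolding wint_def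
  by (intro nn_integral_mono ennreal_leI divide_right_mono) (simp_all add: less_imp_le[OF one_norm_pos])

lemma wint_measurable:
  assumes [measurable]: "f \<in> borel_measurable borel"
  shows "(\<lambda>z. ennreal (f z / (1 + (norm z)\<^sup>2) ^ q)) \<in> borel_measurable borel"
  by measurable

lemma wint_measurable':
  assumes "f \<in> borel_measurable borel"
  shows "(\<lambda>z. ennreal (f z / (1 + (norm z)\<^sup>2) ^ q)) \<in> borel_measurable (riem_vol g)"
  using wint_measurable[OF assms] by (subst measurable_cong_sets[OF sets_riem_vol refl])

lemma wint_cmult:
  assumes "f \<in> borel_measurable borel" "c \<ge> 0"
  shows "wint q (\<lambda>z. c * f z) = ennreal c * wint q f"
proof -
  have "wint q (\<lambda>z. c * f z) = (\<integral>\<^sup>+z. ennreal c * ennreal (f z / (1 + (norm z)\<^sup>2) ^ q) \<partial>riem_vol g)"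
    unfolding wint_def by (simp add: ennreal_mult'[OF assms(2), symmetric])
  also have "\<dots> = ennreal c * wint q f"
    unfolding wint_def by (rule nn_integral_cmult[OF wint_measurable'[OF assms(1)]])
  finally show ?thesis .
qed

lemma wint_add:
  assumes "f \<in> borel_measurable borel" "h \<in> borel_measurable borel" "\<And>z. f z \<ge> 0" "\<And>z. h z \<ge> 0"
  shows "wint q (\<lambda>z. f z + h z) = wint q f + wint q h"
proof -
  have "wint q (\<lambda>z. f z + h z) = (\<integral>\<^sup>+z. ennreal (f z / (1 + (norm z)\<^sup>2) ^ q) + ennreal (h z / (1 + (norm z)\<^sup>2) ^ q) \<partial>riem_vol g)"
    unfolding wint_def add_divide_distrib
    by (subst ennreal_plus) (simp_all add: assms less_imp_le[OF one_norm_pos])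
  also have "\<dots> = wint q f + wint q h"
    unfolding wint_def
    by (rule nn_integral_add[OF wint_measurable' wint_measurable']) (rule assms)+
  finally show ?thesis .
qed

lemma wint_sum_finite:
  assumes "finite A" "\<And>i. i \<in> A \<Longrightarrow> f i \<in> borel_measurable borel" "\<And>i z. f i z \<ge> 0"
    and "\<And>i. i \<in> A \<Longrightarrow> wint q (f i) < \<infinity>"
  shows "wint q (\<lambda>z. \<Sum>i\<in>A. f i z) < \<infinity>"
  using assms(1,2,4)
proof (induction A)
  case empty
  then show ?case by (simp add: wint_def)
next
  case (insert i A)
  have "(\<lambda>z. \<Sum>i\<in>A. f i z) \<in> borel_measurable borel"
    using insert by (intro borel_measurable_sum) auto
  then show ?case
    using insert by (simp add: wint_add assms(3) sum_nonneg)
qed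

lemma wint_unitary:
  assumes "unitary_matrix U" "f \<in> borel_measurable borel"
  shows "wint q (\<lambda>z. f (U *v z)) = wint q f"
  using nn_integral_unitary[OF assms(1) wint_measurable[OF assms(2)], of q]
  by (simp add: wint_def norm_unitary[OF assms(1)])

section \<open>Square integrable degrees for the exponent n + 2\<close>

context
  fixes q :: nat
  assumes q: "q = CARD('n) + 2"
begin

text \<open>The density is bounded and one power of 1 + |z|^2 cancels, which leaves the exponent n +
  1, above the integrability threshold n in real dimension 2n. The exponent is written
  \<open>2 * 1\<close> to match the general form \<open>2 * d\<close>.\<close>

lemma wint_norm2_finite: "wint q (\<lambda>z. (norm z) ^ (2 * 1)) < \<infinity>"
proof -
  let ?n = "CARD('n)"
  have "wint q (\<lambda>z. (norm z) ^ (2 * 1)) =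
      (\<integral>\<^sup>+z. ennreal (dens z) * ennreal ((norm z) ^ (2 * 1) / (1 + (norm z)\<^sup>2) ^ q) \<partial>lborel)"
    unfolding wint_def by (rule nn_integral_riem_vol) measurable
  also have "\<dots> \<le> (\<integral>\<^sup>+z. ennreal (a 0 ^ ?n) * ennreal (1 / (1 + (norm (z :: complex ^ 'n))\<^sup>2) ^ (?n + 1)) \<partial>lborel)"
  proof (intro nn_integral_mono mult_mono ennreal_leI)
    fix z :: "complex ^ 'n"
    show "dens z \<le> a 0 ^ ?n" by (rule dens_bounds)
    have "(norm z)\<^sup>2 / (1 + (norm z)\<^sup>2) ^ q \<le> (1 + (norm z)\<^sup>2) / (1 + (norm z)\<^sup>2) ^ q"
      by (intro divide_right_mono) (simp_all add: less_imp_le[OF one_norm_pos])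
    also have "\<dots> = 1 / (1 + (norm z)\<^sup>2) ^ (?n + 1)"
      using one_norm_pos[of z] by (simp add: q)
    finally show "(norm z) ^ (2 * 1) / (1 + (norm z)\<^sup>2) ^ q \<le> 1 / (1 + (norm z)\<^sup>2) ^ (?n + 1)" by simp
  qed simp_all
  also have "\<dots> = ennreal (a 0 ^ ?n) * (\<integral>\<^sup>+z. ennreal (1 / (1 + (norm (z :: complex ^ 'n))\<^sup>2) ^ (?n + 1)) \<partial>lborel)"
    by (rule nn_integral_cmult) measurable
  also have "\<dots> < \<infinity>"
    using integral_power_finite[where 'n = 'n] by (simp add: ennreal_mult_less_top)
  finally show ?thesis .
qed

text \<open>In degree q the weight is compensated for |z| \<ge> 1 up to the factor 2^(-q). What
  remains is the lower bound (a 1 / (1 + |z|^2))^n of the density, whose integral diverges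
  logarithmically.\<close>

lemma wint_normq_infinite: "wint q (\<lambda>z. (norm z) ^ (2 * q)) = \<infinity>"
proof -
  let ?n = "CARD('n)"
  have "wint q (\<lambda>z. (norm z) ^ (2 * q)) =
      (\<integral>\<^sup>+z. ennreal (dens z) * ennreal ((norm z) ^ (2 * q) / (1 + (norm z)\<^sup>2) ^ q) \<partial>lborel)"
    unfolding wint_def by (rule nn_integral_riem_vol) measurable
  also have "\<dots> = \<infinity>"
  proof (rule shell_integral_infinite)
    show "(a 1 / 2) ^ ?n * (1 / 2) ^ q > 0" using a_pos[of 1] by simp
    fix z :: "complex ^ 'n" and k :: nat
    assume k: "2 ^ k \<le> norm z" "norm z < 2 ^ Suc k"
    have "(1::real) \<le> 2 ^ k" by simp
    then have n1: "1 \<le> norm z" using k by linarith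
    then have n1': "1 \<le> (norm z)\<^sup>2" by simp
    have "(norm z)\<^sup>2 \<le> (2 ^ Suc k)\<^sup>2" using k by (intro power_mono) auto
    also have "(2 ^ Suc k)\<^sup>2 = (4::real) ^ Suc k" by (rule two_power_power2)
    finally have u: "1 + (norm z)\<^sup>2 \<le> 2 * 4 ^ Suc k" using n1' by linarith
    have "a 1 / (2 * 4 ^ Suc k) \<le> a 1 / (1 + (norm z)\<^sup>2)"
      using u a_pos[of 1] one_norm_pos[of z] by (intro divide_left_mono) auto
    then have "(a 1 / (2 * 4 ^ Suc k)) ^ ?n \<le> (a 1 / (1 + (norm z)\<^sup>2)) ^ ?n"
      using a_pos[of 1] by (intro power_mono) auto
    also have "\<dots> \<le> dens z" by (rule dens_bounds)
    finally have d: "(a 1 / (2 * 4 ^ Suc k)) ^ ?n \<le> dens z" .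
    have "1 / 2 \<le> (norm z)\<^sup>2 / (1 + (norm z)\<^sup>2)"
      using n1' one_norm_pos[of z] by (simp add: field_simps)
    then have "(1 / 2) ^ q \<le> ((norm z)\<^sup>2 / (1 + (norm z)\<^sup>2)) ^ q" by (intro power_mono) auto
    then have w: "(1 / 2) ^ q \<le> (norm z) ^ (2 * q) / (1 + (norm z)\<^sup>2) ^ q"
      by (simp add: power_divide power_mult)
    have "ennreal ((a 1 / 2) ^ ?n * (1 / 2) ^ q / (4 ^ Suc k) ^ ?n) =
        ennreal ((a 1 / (2 * 4 ^ Suc k)) ^ ?n) * ennreal ((1 / 2) ^ q)"
      using a_pos[of 1] by (simp add: ennreal_mult[symmetric] power_divide power_mult_distrib mult_ac)
        (simp flip: power_mult_distrib)
    also have "\<dots> \<le> ennreal (dens z) * ennreal ((norm z) ^ (2 * q) / (1 + (norm z)\<^sup>2) ^ q)"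
      by (intro mult_mono ennreal_leI d w) simp_all
    finally show "ennreal ((a 1 / 2) ^ ?n * (1 / 2) ^ q / (4 ^ Suc k) ^ ?n) \<le>
        ennreal (dens z) * ennreal ((norm z) ^ (2 * q) / (1 + (norm z)\<^sup>2) ^ q)" .
  qed
  finally show ?thesis .
qed

text \<open>Since |z|^(2 j) is at most |z|^2 + |z|^(2 d), the square integrable degrees have no
  gaps.\<close>

lemma wint_norm_interpolate:
  assumes "1 \<le> j" "j \<le> d" "wint q (\<lambda>z. (norm z) ^ (2 * d)) < \<infinity>"
  shows "wint q (\<lambda>z. (norm z) ^ (2 * j)) < \<infinity>"
proof -
  have "(norm z) ^ (2 * j) \<le> (norm z) ^ (2 * 1) + (norm z) ^ (2 * d)" for z :: "complex ^ 'n"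
  proof (cases "norm z \<le> 1")
    case True
    then have "(norm z) ^ (2 * j) \<le> (norm z) ^ (2 * 1)" using assms by (intro power_decreasing) auto
    then show ?thesis by (simp add: add_increasing2)
  next
    case False
    then have "(norm z) ^ (2 * j) \<le> (norm z) ^ (2 * d)" using assms by (intro power_increasing) auto
    then show ?thesis by (simp add: add_increasing)
  qed
  then have "wint q (\<lambda>z. (norm z) ^ (2 * j)) \<le> wint q (\<lambda>z. (norm z) ^ (2 * 1) + (norm z) ^ (2 * d))"
    by (rule wint_mono)
  also have "\<dots> = wint q (\<lambda>z. (norm z) ^ (2 * 1)) + wint q (\<lambda>z. (norm z) ^ (2 * d))"
    by (rule wint_add) simp_all
  also have "\<dots> < \<infinity>" using wint_norm2_finite assms(3) by simp
  finally show ?thesis .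
qed

text \<open>Unitary translates of \<open>P\<close> have no common zero on the sphere, so by compactness finitely
  many of them dominate \<open>|z|\<^sup>d\<close>.\<close>

lemma homogeneous_wint_finite:
  assumes P: "continuous_on UNIV P" and hom: "\<And>w z. P (w *s z) = w ^ d * P z"
    and d: "d \<ge> 1" and nz: "P w0 \<noteq> 0" and fin: "wint q (\<lambda>z. (cmod (P z))\<^sup>2) < \<infinity>"
  shows "wint q (\<lambda>z. (norm z) ^ (2 * d)) < \<infinity>"
proof -
  have w0: "w0 \<noteq> 0"
  proof
    assume "w0 = 0"
    then have "P w0 = 0 ^ d * P w0" using hom[of 0 w0] by simp
    then show False using nz d by (simp add: power_0_left)
  qed
  define w1 where "w1 = of_real (inverse (norm w0)) *s w0"
  have w1: "norm w1 = 1" using w0 by (simp add: w1_def norm_cscale norm_inverse)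
  have P1: "P w1 \<noteq> 0" using nz w0 by (simp add: w1_def hom)
  have PU: "continuous_on S (\<lambda>z. P (U *v z))" for U S
    by (rule continuous_on_compose2[OF P, of S "(*v) U"])
       (auto intro: linear_continuous_on bounded_linear_matrix)
  define \<C> where "\<C> = (\<lambda>U. {z. P (U *v z) \<noteq> 0}) ` {U. unitary_matrix U}"
  have c1: "compact (sphere (0 :: complex ^ 'n) 1)" by simp
  have c2: "open B" if "B \<in> \<C>" for B
    using that PU[of UNIV] by (auto simp: \<C>_def intro!: open_Collect_neq)
  have c3: "sphere 0 1 \<subseteq> \<Union>\<C>"
  proof
    fix z :: "complex ^ 'n" assume "z \<in> sphere 0 1"
    then have "norm z = norm w1" using w1 by simp
    then obtain U where "unitary_matrix U" "U *v z = w1" by (rule unitary_transitive)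
    then show "z \<in> \<Union>\<C>" using P1 by (auto simp: \<C>_def intro!: exI[of _ U])
  qed
  obtain \<D> where "\<D> \<subseteq> \<C>" "finite \<D>" "sphere 0 1 \<subseteq> \<Union>\<D>"
    by (rule compactE[OF c1 c3 c2])
  then obtain T where T: "finite T" "T \<subseteq> {U. unitary_matrix U}" "\<D> = (\<lambda>U. {z. P (U *v z) \<noteq> 0}) ` T"
    unfolding \<C>_def by (meson finite_subset_image)
  define \<phi> where "\<phi> z = (\<Sum>U\<in>T. (cmod (P (U *v z)))\<^sup>2)" for z
  have "continuous_on (sphere 0 1) \<phi>"
    unfolding \<phi>_def by (intro continuous_intros PU)
  moreover have "sphere (0 :: complex ^ 'n) 1 \<noteq> {}" using w1 by auto
  ultimately obtain y0 where y0: "y0 \<in> sphere 0 1" "\<And>y. y \<in> sphere 0 1 \<Longrightarrow> \<phi> y0 \<le> \<phi> y"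
    using continuous_attains_inf[of "sphere (0 :: complex ^ 'n) 1" \<phi>] by auto
  obtain U where U: "U \<in> T" "P (U *v y0) \<noteq> 0"
    using y0(1) \<open>sphere 0 1 \<subseteq> \<Union>\<D>\<close> T(3) by auto
  have pos: "\<phi> y0 > 0"
    unfolding \<phi>_def by (rule sum_pos2[OF T(1) U(1)]) (use U in auto)
  have le: "(norm z) ^ (2 * d) \<le> inverse (\<phi> y0) * \<phi> z" for z
  proof (cases "z = 0")
    case True
    then show ?thesis using d pos by (simp add: \<phi>_def sum_nonneg power_0_left)
  next
    case False
    define y where "y = of_real (inverse (norm z)) *s z"
    have y: "y \<in> sphere 0 1" using False by (simp add: y_def norm_cscale norm_inverse)
    have z: "z = of_real (norm z) *s y"
      using False by (simp add: y_def vector_smult_assoc flip: of_real_mult)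
    have "P (U *v z) = of_real (norm z) ^ d * P (U *v y)" for U
      by (subst z) (simp add: vector_scalar_commute hom)
    then have "\<phi> z = (norm z) ^ (2 * d) * \<phi> y"
      by (simp add: \<phi>_def norm_mult norm_power power_mult_distrib sum_distrib_left power_mult[symmetric] mult.commute[of d])
    moreover have "1 \<le> inverse (\<phi> y0) * \<phi> y" using y0(2)[OF y] pos by (simp add: field_simps)
    ultimately show ?thesis
      using mult_left_mono[of 1 "inverse (\<phi> y0) * \<phi> y" "(norm z) ^ (2 * d)"] by (simp add: mult_ac)
  qed
  have m: "(\<lambda>z. (cmod (P (U *v z)))\<^sup>2) \<in> borel_measurable borel" for U
    by (intro borel_measurable_continuous_onI continuous_intros PU)
  have m1: "(\<lambda>z. (cmod (P z))\<^sup>2) \<in> borel_measurable borel"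
    by (intro borel_measurable_continuous_onI continuous_intros P)
  \<comment> \<open>Each translate has the same integral as P, because weight and volume are
    unitarily invariant.\<close>
  have "wint q \<phi> < \<infinity>"
    unfolding \<phi>_def
  proof (rule wint_sum_finite[OF T(1)])
    show "wint q (\<lambda>z. (cmod (P (U *v z)))\<^sup>2) < \<infinity>" if "U \<in> T" for U
      using wint_unitary[OF _ m1, of U] that T(2) fin by auto
  qed (use m in auto)
  moreover have "\<phi> \<in> borel_measurable borel"
    unfolding \<phi>_def by (intro borel_measurable_sum m)
  ultimately have "wint q (\<lambda>z. inverse (\<phi> y0) * \<phi> z) < \<infinity>"
    using pos by (simp add: wint_cmult ennreal_mult_less_top)
  with wint_mono[OF le, of q] show ?thesis by (rule order_le_less_trans)
qed

text \<open>Integrate the circle mean inequality \<open>tay_norm_le\<close> and exchange the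
  integrals; for each fixed t, multiplication by \<open>circ t\<close> is unitary and leaves the
  weighted integral of |F|^2 unchanged.\<close>

lemma tay_wint_le:
  assumes F: "entire F"
  shows "wint q (\<lambda>z. (cmod (tay F d z))\<^sup>2) \<le> wint q (\<lambda>z. (cmod (F z))\<^sup>2)"
proof -
  have c: "continuous_on UNIV (\<lambda>(z, t). F (circ t *s z))" by (rule continuous_F_circ[OF F])
  have Fm [measurable]: "F \<in> borel_measurable borel"
    by (rule borel_measurable_continuous_onI[OF entire_continuous[OF F]])
  have cm: "(\<lambda>x. F (circ (snd x) *s fst x)) \<in> borel_measurable (borel \<Otimes>\<^sub>M borel)"
    using borel_measurable_continuous_onI[OF c] by (simp add: borel_prod split_def)
  \<comment> \<open>The indicator of the unit interval turns the parameter integral into one over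
    the whole line, so that Fubini for Lebesgue measure applies.\<close>
  define h where "h z t = ennreal (dens z) * (indicator {0..1} t * ennreal ((cmod (F (circ t *s z)))\<^sup>2 / (1 + (norm z)\<^sup>2) ^ q))" for z t
  have hm: "(\<lambda>(z, t). h z t) \<in> borel_measurable (lborel \<Otimes>\<^sub>M lborel)"
    unfolding h_def split_def using cm by measurable
  have tm: "tay F d \<in> borel_measurable borel"
    by (rule borel_measurable_continuous_onI[OF continuous_tay[OF F]])
  have "wint q (\<lambda>z. (cmod (tay F d z))\<^sup>2) =
      (\<integral>\<^sup>+z. ennreal (dens z) * ennreal ((cmod (tay F d z))\<^sup>2 / (1 + (norm z)\<^sup>2) ^ q) \<partial>lborel)"
    unfolding wint_def by (rule nn_integral_riem_vol) (use tm in measurable)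
  also have "\<dots> \<le> (\<integral>\<^sup>+z. (\<integral>\<^sup>+t. h z t \<partial>lborel) \<partial>lborel)"
  proof (rule nn_integral_mono)
    fix z
    define f where "f t = (cmod (F (circ t *s z)))\<^sup>2 / (1 + (norm z)\<^sup>2) ^ q" for t
    have Fc: "continuous_on S (\<lambda>t. F (circ t *s z))" for S
      by (intro continuous_on_compose2[OF entire_continuous[OF F, of UNIV]] continuous_intros) auto
    then have fc: "continuous_on S f" for S
      unfolding f_def using one_norm_pos[of z] by (intro continuous_intros) auto
    have fi: "(f has_integral integral {0..1} f) {0..1}"
      by (intro integrable_integral integrable_continuous_real fc)
    have f0: "f t \<ge> 0" for t using one_norm_pos[of z] by (simp add: f_def)
    have "(cmod (tay F d z))\<^sup>2 / (1 + (norm z)\<^sup>2) ^ q \<le>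
        integral {0..1} (\<lambda>t. (cmod (F (circ t *s z)))\<^sup>2) / (1 + (norm z)\<^sup>2) ^ q"
      using one_norm_pos[of z] by (intro divide_right_mono tay_norm_le F) simp
    also have "\<dots> = integral {0..1} f" unfolding f_def by simp
    finally have "ennreal ((cmod (tay F d z))\<^sup>2 / (1 + (norm z)\<^sup>2) ^ q) \<le> ennreal (integral {0..1} f)"
      by (rule ennreal_leI)
    also have "ennreal (integral {0..1} f) = (\<integral>\<^sup>+t. indicator {0..1} t * ennreal (f t) \<partial>lborel)"
    proof -
      have "((\<lambda>t. if t \<in> {0..1} then f t else 0) has_integral integral {0..1} f) UNIV"
        using fi by (simp only: has_integral_restrict_UNIV)
      then have "(\<integral>\<^sup>+t. ennreal (if t \<in> {0..1} then f t else 0) \<partial>lborel) = ennreal (integral {0..1} f)"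
        using borel_measurable_continuous_onI[OF fc] f0
        by (intro nn_integral_has_integral_lborel) (auto intro!: measurable_If)
      moreover have "ennreal (if t \<in> {0..1} then f t else 0) = indicator {0..1} t * ennreal (f t)" for t
        by simp
      ultimately show ?thesis by simp
    qed
    finally have "ennreal (dens z) * ennreal ((cmod (tay F d z))\<^sup>2 / (1 + (norm z)\<^sup>2) ^ q) \<le>
        ennreal (dens z) * (\<integral>\<^sup>+t. indicator {0..1} t * ennreal (f t) \<partial>lborel)"
      by (rule mult_left_mono) simp
    also have "\<dots> = (\<integral>\<^sup>+t. h z t \<partial>lborel)"
      unfolding h_def f_def[symmetric]
      by (rule nn_integral_cmult[symmetric]) (use borel_measurable_continuous_onI[OF fc] in measurable)
    finally show "ennreal (dens z) * ennreal ((cmod (tay F d z))\<^sup>2 / (1 + (norm z)\<^sup>2) ^ q) \<le> (\<integral>\<^sup>+t. h z t \<partial>lborel)" .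
  qed
  also have "\<dots> = (\<integral>\<^sup>+t. (\<integral>\<^sup>+z. h z t \<partial>lborel) \<partial>lborel)"
    by (rule lborel_pair.Fubini'[symmetric]) (use hm in simp)
  also have "\<dots> = (\<integral>\<^sup>+t. indicator {0..1::real} t * wint q (\<lambda>z. (cmod (F z))\<^sup>2) \<partial>lborel)"
  proof (rule nn_integral_cong)
    fix t :: real
    obtain U :: "complex ^ 'n ^ 'n" where U: "unitary_matrix U" "\<And>x. U *v x = circ t *s x"
      by (rule unitary_scalar[OF norm_circ[of t]], rule that) simp_all
    have m: "(\<lambda>z. F (U *v z)) \<in> borel_measurable borel" by measurable
    have "(\<integral>\<^sup>+z. h z t \<partial>lborel) = (\<integral>\<^sup>+z. indicator {0..1} t * (ennreal (dens z) *
        ennreal ((cmod (F (U *v z)))\<^sup>2 / (1 + (norm z)\<^sup>2) ^ q)) \<partial>lborel)"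
      by (rule nn_integral_cong) (simp add: h_def U(2) mult_ac)
    also have "\<dots> = indicator {0..1} t * (\<integral>\<^sup>+z. ennreal (dens z) *
        ennreal ((cmod (F (U *v z)))\<^sup>2 / (1 + (norm z)\<^sup>2) ^ q) \<partial>lborel)"
      by (rule nn_integral_cmult) (use m in measurable)
    also have "(\<integral>\<^sup>+z. ennreal (dens z) * ennreal ((cmod (F (U *v z)))\<^sup>2 / (1 + (norm z)\<^sup>2) ^ q) \<partial>lborel)
        = wint q (\<lambda>z. (cmod (F (U *v z)))\<^sup>2)"
      unfolding wint_def by (rule nn_integral_riem_vol[symmetric]) (use m in measurable)
    also have "\<dots> = wint q (\<lambda>z. (cmod (F z))\<^sup>2)"
      by (rule wint_unitary[OF U(1)]) measurable
    finally show "(\<integral>\<^sup>+z. h z t \<partial>lborel) = indicator {0..1} t * wint q (\<lambda>z. (cmod (F z))\<^sup>2)" .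
  qed
  also have "\<dots> = wint q (\<lambda>z. (cmod (F z))\<^sup>2)"
    by (subst nn_integral_multc) simp_all
  finally show ?thesis .
qed

section \<open>Decomposition of the weighted space into homogeneous parts\<close>

lemma weighted_space_iff:
  "F \<in> weighted_space g q \<longleftrightarrow> entire F \<and> F 0 = 0 \<and> wint q (\<lambda>z. (cmod (F z))\<^sup>2) < \<infinity>"
  by (simp add: weighted_space_def wint_def)

lemma weighted_space_entire: "F \<in> weighted_space g q \<Longrightarrow> entire F"
  by (simp add: weighted_space_iff)

lemma entire_norm2_measurable: "entire F \<Longrightarrow> (\<lambda>z. (cmod (F z))\<^sup>2) \<in> borel_measurable borel"
  by (intro borel_measurable_continuous_onI continuous_intros entire_continuous)

lemma weighted_space_zero: "(\<lambda>z. 0) \<in> weighted_space g q"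
  by (simp add: weighted_space_iff entire_const wint_def)

lemma weighted_space_cmult:
  assumes "F \<in> weighted_space g q" shows "(\<lambda>z. c * F z) \<in> weighted_space g q"
  using assms
  by (simp add: weighted_space_iff entire_mult entire_const norm_mult power_mult_distrib
      wint_cmult entire_norm2_measurable ennreal_mult_less_top)

lemma weighted_space_add:
  assumes F: "F \<in> weighted_space g q" and G: "G \<in> weighted_space g q"
  shows "(\<lambda>z. F z + G z) \<in> weighted_space g q"
proof -
  have e: "entire F" "entire G" using F G by (simp_all add: weighted_space_iff)
  have "(cmod (F z + G z))\<^sup>2 \<le> 2 * (cmod (F z))\<^sup>2 + 2 * (cmod (G z))\<^sup>2" for z
  proof -
    have "(cmod (F z + G z))\<^sup>2 \<le> (cmod (F z) + cmod (G z))\<^sup>2"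
      by (intro power_mono norm_triangle_ineq) simp
    also have "\<dots> \<le> 2 * (cmod (F z))\<^sup>2 + 2 * (cmod (G z))\<^sup>2"
      using sum_squares_bound[of "cmod (F z)" "cmod (G z)"] by (simp add: power2_sum)
    finally show ?thesis .
  qed
  then have "wint q (\<lambda>z. (cmod (F z + G z))\<^sup>2) \<le> wint q (\<lambda>z. 2 * (cmod (F z))\<^sup>2 + 2 * (cmod (G z))\<^sup>2)"
    by (rule wint_mono)
  also have "\<dots> = 2 * wint q (\<lambda>z. (cmod (F z))\<^sup>2) + 2 * wint q (\<lambda>z. (cmod (G z))\<^sup>2)"
  proof (subst wint_add)
    show "(\<lambda>z. 2 * (cmod (F z))\<^sup>2) \<in> borel_measurable borel" "(\<lambda>z. 2 * (cmod (G z))\<^sup>2) \<in> borel_measurable borel"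
      by (intro borel_measurable_continuous_onI continuous_intros entire_continuous e)+
  qed (simp_all add: entire_norm2_measurable wint_cmult e)
  also have "\<dots> < \<infinity>" using F G by (simp add: weighted_space_iff ennreal_mult_less_top)
  finally show ?thesis using F G by (simp add: weighted_space_iff entire_add)
qed

lemma weighted_space_sum:
  "(\<And>i. i \<in> I \<Longrightarrow> f i \<in> weighted_space g q) \<Longrightarrow> (\<lambda>z. \<Sum>i\<in>I. f i z) \<in> weighted_space g q"
  by (induction I rule: infinite_finite_induct) (auto intro: weighted_space_zero weighted_space_add)

text \<open>The maximum exists because degree q is excluded and there are no gaps, so the set is
  finite, and because degree 1 belongs to it.\<close>

definition dstar :: nat
  where "dstar = Max {d. 1 \<le> d \<and> wint q (\<lambda>z. (norm z) ^ (2 * d)) < \<infinity>}"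

lemma dstar:
  shows "1 \<le> dstar" "dstar \<le> q - 1"
    and "d \<in> {1..dstar} \<longleftrightarrow> 1 \<le> d \<and> wint q (\<lambda>z. (norm z) ^ (2 * d)) < \<infinity>"
proof -
  let ?S = "{d. 1 \<le> d \<and> wint q (\<lambda>z. (norm z) ^ (2 * d)) < \<infinity>}"
  have le: "d \<le> q - 1" if "d \<in> ?S" for d
  proof (rule ccontr)
    assume "\<not> d \<le> q - 1"
    then have "wint q (\<lambda>z. (norm z) ^ (2 * q)) < \<infinity>"
      using wint_norm_interpolate[of q d] that q by simp
    then show False by (simp add: wint_normq_infinite)
  qed
  then have fin: "finite ?S" by (meson finite_nat_set_iff_bounded_le)
  have one: "1 \<in> ?S" using wint_norm2_finite by simp
  then show "1 \<le> dstar" unfolding dstar_def using fin by (rule Max_ge[rotated])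
  have in_S: "dstar \<in> ?S" unfolding dstar_def using fin one by (intro Max_in) blast+
  then show "dstar \<le> q - 1" by (rule le)
  show "d \<in> {1..dstar} \<longleftrightarrow> 1 \<le> d \<and> wint q (\<lambda>z. (norm z) ^ (2 * d)) < \<infinity>"
  proof
    assume "d \<in> {1..dstar}"
    then show "1 \<le> d \<and> wint q (\<lambda>z. (norm z) ^ (2 * d)) < \<infinity>"
      using wint_norm_interpolate[of d dstar] in_S by auto
  next
    assume "1 \<le> d \<and> wint q (\<lambda>z. (norm z) ^ (2 * d)) < \<infinity>"
    then have "d \<in> ?S" by simp
    then have "d \<le> dstar" unfolding dstar_def by (rule Max_ge[OF fin])
    then show "d \<in> {1..dstar}" using \<open>d \<in> ?S\<close> by simp
  qed
qed

lemma hom_poly_weighted_space: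
  assumes d: "d \<in> {1..dstar}" and F: "F \<in> hom_poly d"
  shows "F \<in> weighted_space g q"
proof -
  obtain C where C: "C \<ge> 0" "\<And>z. cmod (F z) \<le> C * norm z ^ d"
    by (rule hom_poly_bound[OF F], rule that, assumption, simp)
  have "(cmod (F z))\<^sup>2 \<le> C\<^sup>2 * (norm z) ^ (2 * d)" for z
    using power_mono[OF C(2)[of z] norm_ge_zero, of 2]
    by (simp add: power_mult_distrib power_mult[symmetric] mult.commute[of d])
  then have "wint q (\<lambda>z. (cmod (F z))\<^sup>2) \<le> wint q (\<lambda>z. C\<^sup>2 * (norm z) ^ (2 * d))"
    by (rule wint_mono)
  also have "\<dots> < \<infinity>" using dstar(3)[of d] d by (simp add: wint_cmult ennreal_mult_less_top)
  finally have "wint q (\<lambda>z. (cmod (F z))\<^sup>2) < \<infinity>" .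
  moreover have "F 0 = 0" using hom_poly_scale[OF F, of 0 0] d by (cases d) auto
  ultimately show ?thesis using hom_poly_entire[OF F] by (simp add: weighted_space_iff)
qed

lemma tay_weighted_space:
  assumes F: "F \<in> weighted_space g q"
  shows "tay F d \<in> hom_poly d" "F = (\<lambda>z. \<Sum>d=1..dstar. tay F d z)"
proof -
  have e: "entire F" using F by (rule weighted_space_entire)
  have zero: "tay F d = (\<lambda>z. 0)" if "d \<notin> {1..dstar}" for d
  proof (rule ccontr)
    assume "tay F d \<noteq> (\<lambda>z. 0)"
    then obtain w0 where w0: "tay F d w0 \<noteq> 0" by auto
    \<comment> \<open>The part of degree 0 is the constant F 0, which vanishes in the weighted
      space.\<close>
    have d: "d \<ge> 1"
      using w0 F by (cases d) (auto simp: tay_def weighted_space_iff)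
    have "wint q (\<lambda>z. (cmod (tay F d z))\<^sup>2) < \<infinity>"
      using tay_wint_le[OF e, of d] F by (auto simp: weighted_space_iff intro: order_le_less_trans)
    then have "wint q (\<lambda>z. (norm z) ^ (2 * d)) < \<infinity>"
      by (rule homogeneous_wint_finite[OF continuous_tay[OF e] tay_scale[OF e] d w0])
    then show False using dstar(3)[of d] that d by simp
  qed
  have "tay F d = (\<lambda>z. 0)" if "d > dstar" for d by (rule zero) (use that in simp)
  note * = tay_finite_imp_hom_poly[OF e this]
  show "tay F d \<in> hom_poly d" by (rule *(2))
  have "F z = (\<Sum>d=1..dstar. tay F d z)" for z
  proof -
    have "F z = (\<Sum>d\<le>dstar. tay F d z)" by (rule fun_cong[OF *(1)])
    also have "\<dots> = (\<Sum>d=1..dstar. tay F d z)"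
      by (rule sum.mono_neutral_right) (auto simp: zero)
    finally show ?thesis .
  qed
  then show "F = (\<lambda>z. \<Sum>d=1..dstar. tay F d z)" by (rule ext)
qed

lemma tay_sum_hom_poly:
  assumes "\<And>d. d \<in> {1..dstar} \<Longrightarrow> f d \<in> hom_poly d" "d \<in> {1..dstar}"
  shows "tay (\<lambda>z. \<Sum>d=1..dstar. f d z) d = f d"
proof
  fix z
  have "tay (\<lambda>z. \<Sum>d=1..dstar. f d z) d z = (if d \<le> dstar then (if d = 0 then 0 else f d z) else 0)"
  proof (rule tay_eqI)
    fix w
    have "(\<Sum>d=1..dstar. f d (w *s z)) = (\<Sum>d=1..dstar. (if d = 0 then 0 else f d z) * w ^ d)"
      by (rule sum.cong) (auto simp: hom_poly_scale[OF assms(1)])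
    also have "\<dots> = (\<Sum>d\<le>dstar. (if d = 0 then 0 else f d z) * w ^ d)"
      by (rule sum.mono_neutral_left) auto
    finally show "(\<Sum>d=1..dstar. f d (w *s z)) = (\<Sum>d\<le>dstar. (if d = 0 then 0 else f d z) * w ^ d)" .
  qed
  then show "tay (\<lambda>z. \<Sum>d=1..dstar. f d z) d z = f d z" using assms(2) by simp
qed

lemma weighted_space_direct_sum: "is_direct_sum (weighted_space g q) {1..dstar} hom_poly"
  unfolding is_direct_sum_def
proof (intro conjI ballI)
  fix p :: "nat \<Rightarrow> complex ^ 'n \<Rightarrow> complex"
  assume "p \<in> PiE {1..dstar} hom_poly"
  then show "(\<lambda>z. \<Sum>d\<in>{1..dstar}. p d z) \<in> weighted_space g q"
    by (intro weighted_space_sum hom_poly_weighted_space) auto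
next
  fix F assume F: "F \<in> weighted_space g q"
  show "\<exists>!p. p \<in> PiE {1..dstar} hom_poly \<and> F = (\<lambda>z. \<Sum>d\<in>{1..dstar}. p d z)"
  proof (rule ex1I[of _ "restrict (tay F) {1..dstar}"])
    show "restrict (tay F) {1..dstar} \<in> PiE {1..dstar} hom_poly \<and>
        F = (\<lambda>z. \<Sum>d\<in>{1..dstar}. restrict (tay F) {1..dstar} d z)"
    proof
      show "restrict (tay F) {1..dstar} \<in> PiE {1..dstar} hom_poly"
        by (simp add: restrict_PiE_iff tay_weighted_space(1)[OF F])
      show "F = (\<lambda>z. \<Sum>d\<in>{1..dstar}. restrict (tay F) {1..dstar} d z)"
        by (rule trans[OF tay_weighted_space(2)[OF F]]) (intro ext sum.cong, simp_all)
    qed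
    fix p assume p: "p \<in> PiE {1..dstar} hom_poly \<and> F = (\<lambda>z. \<Sum>d\<in>{1..dstar}. p d z)"
    then have hp: "p d \<in> hom_poly d" if "d \<in> {1..dstar}" for d using that by auto
    have F_eq: "F = (\<lambda>z. \<Sum>d\<in>{1..dstar}. p d z)" using p by blast
    have pt: "tay F d = p d" if "d \<in> {1..dstar}" for d
      unfolding F_eq by (rule tay_sum_hom_poly[OF hp that])
    show "p = restrict (tay F) {1..dstar}"
    proof
      fix d
      show "p d = restrict (tay F) {1..dstar} d"
      proof (cases "d \<in> {1..dstar}")
        case True
        then show ?thesis by (simp only: pt restrict_apply if_True)
      next
        case False
        \<comment> \<open>Elements of \<open>PiE\<close> are \<open>undefined\<close> off the index
          set, and so is a restriction; uniqueness thus covers the arguments outside the degrees as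
          well.\<close>
        then have "p d = undefined" using p by (blast intro: PiE_arb)
        then show ?thesis using False by (simp only: restrict_apply if_False)
      qed
    qed
  qed
qed

end

end

text \<open>By complex linearity of the derivative, the real and imaginary parts of F have Wirtinger
  derivatives F_\<alpha> / 2 and -i F_\<alpha> / 2. Each contributes the same amount, and twice 4
  times 1/4 is the factor 2.\<close>

lemma cgrad_sq_entire:
  assumes F: "entire F"
  shows "cgrad_sq g F z = 2 * Re (\<Sum>\<alpha>\<in>UNIV. \<Sum>\<beta>\<in>UNIV. ginv g z \<alpha> \<beta> *
    dir_deriv F (axis \<alpha> 1) z * cnj (dir_deriv F (axis \<beta> 1) z))"
proof -
  let ?l = "\<lambda>\<alpha>. dir_deriv F (axis \<alpha> 1) z"
  have ax: "axis \<alpha> \<i> = \<i> *s axis \<alpha> 1" for \<alpha> :: 'a by (auto simp: vec_eq_iff axis_def)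
  have dI: "dir_deriv F (axis \<alpha> \<i>) z = \<i> * ?l \<alpha>" for \<alpha>
    unfolding ax entire_dir_deriv_scale[OF F] ..
  have "dir_deriv (\<lambda>w. complex_of_real (Re (F w))) v z = of_real (Re (dir_deriv F v z))"
    and "dir_deriv (\<lambda>w. complex_of_real (Im (F w))) v z = of_real (Im (dir_deriv F v z))" for v
    by (intro dir_deriv_eqI has_derivative_of_real has_derivative_Re has_derivative_Im entire_has_derivative F)+
  note d = this
  have w: "wirt \<alpha> (\<lambda>w. complex_of_real (Re (F w))) z = ?l \<alpha> / 2"
    "wirt_bar \<alpha> (\<lambda>w. complex_of_real (Re (F w))) z = cnj (?l \<alpha>) / 2"
    "wirt \<alpha> (\<lambda>w. complex_of_real (Im (F w))) z = - \<i> * ?l \<alpha> / 2"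
    "wirt_bar \<alpha> (\<lambda>w. complex_of_real (Im (F w))) z = \<i> * cnj (?l \<alpha>) / 2" for \<alpha>
    unfolding wirt_def wirt_bar_def d dI by (simp_all add: complex_eq_iff)
  let ?S = "\<Sum>\<alpha>\<in>UNIV. \<Sum>\<beta>\<in>UNIV. ginv g z \<alpha> \<beta> * ?l \<alpha> * cnj (?l \<beta>)"
  have "grad_sq g (\<lambda>w. Re (F w)) z = 4 * Re (?S / 4)" "grad_sq g (\<lambda>w. Im (F w)) z = 4 * Re (?S / 4)"
  proof -
    have "x * (- \<i> * l / 2) * (\<i> * m / 2) = x * l * m / 4" for x l m :: complex
      by (simp add: complex_eq_iff field_simps)
    then show "grad_sq g (\<lambda>w. Im (F w)) z = 4 * Re (?S / 4)"
      unfolding grad_sq_def w sum_divide_distrib by (simp only:)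
    have "x * (l / 2) * (m / 2) = x * l * m / 4" for x l m :: complex by simp
    then show "grad_sq g (\<lambda>w. Re (F w)) z = 4 * Re (?S / 4)"
      unfolding grad_sq_def w sum_divide_distrib by (simp only:)
  qed
  then show ?thesis unfolding cgrad_sq_def by simp
qed

lemma unitary_inverse:
  assumes U: "unitary_matrix U"
  obtains V where "unitary_matrix V" "\<And>z. U *v (V *v z) = z"
proof -
  define V where "V = (\<chi> i j. cnj (U $ j $ i))"
  have UV: "U *v (V *v z) = z" for z
    using U by (simp add: unitary_matrix_def V_def matrix_vector_mul_assoc)
  have "herm (V *v x) (V *v y) = herm x y" for x y
    using herm_unitary[OF U, of "V *v x" "V *v y"] by (simp add: UV)
  then have "unitary_matrix V" by (simp add: unitary_matrix_iff_herm)
  then show thesis using that UV by blast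
qed

lemma component_power_hom_poly: "(\<lambda>z. (z $ i) ^ d) \<in> hom_poly d"
proof (induction d)
  case 0
  have "sum m UNIV = 0 \<longleftrightarrow> m = (\<lambda>_. 0)" for m :: "'a \<Rightarrow> nat" by (auto simp: fun_eq_iff)
  then show ?case by (intro hom_polyI[where c = "\<lambda>_. 1"]) simp
next
  case (Suc d)
  then show ?case using hom_poly_mult_component[OF Suc, of i] by simp
qed

lemma AE_continuous_zero:
  fixes F :: "'a::euclidean_space \<Rightarrow> complex"
  assumes "continuous_on UNIV F" "AE z in lborel. F z = 0"
  shows "F z = 0"
proof (rule ccontr)
  assume "F z \<noteq> 0"
  have o: "open {z. F z \<noteq> 0}" using assms(1) by (intro open_Collect_neq) auto
  have "{z. F z \<noteq> 0} \<in> null_sets lborel"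
    using assms(2) o by (intro AE_iff_null_sets[THEN iffD2]) auto
  then have "negligible {z. F z \<noteq> 0}"
    by (simp add: negligible_iff_null_sets null_sets_completionI)
  then show False using open_not_negligible[OF o] \<open>F z \<noteq> 0\<close> by auto
qed

section \<open>Orthonormal bases and the diagonal kernel\<close>

context radial_kaehler
begin

context
  fixes q :: nat
  assumes q: "q = CARD('n) + 2"
begin

abbreviation "H \<equiv> weighted_space g q"
abbreviation "ip \<equiv> weighted_inner g q"

lemmas H_entire = weighted_space_entire[OF q]
lemmas H_zero = weighted_space_zero[OF q]
lemmas H_add = weighted_space_add[OF q]
lemmas H_cmult = weighted_space_cmult[OF q]
lemmas H_sum = weighted_space_sum[OF q]
lemmas H_iff = weighted_space_iff[OF q]

section \<open>The weighted inner product and its unitary invariance\<close>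

lemma ip_measurable:
  assumes "entire F" "entire G"
  shows "(\<lambda>z. F z * cnj (G z) / complex_of_real ((1 + (norm z)\<^sup>2) ^ q)) \<in> borel_measurable borel"
proof (intro borel_measurable_continuous_onI continuous_intros entire_continuous assms)
  show "\<forall>z\<in>UNIV. complex_of_real ((1 + (norm z)\<^sup>2) ^ q) \<noteq> 0"
    using one_norm_pos by (metis of_real_eq_0_iff power_eq_0_iff less_irrefl)
qed

lemma norm_weight: "cmod (complex_of_real ((1 + (norm z)\<^sup>2) ^ q)) = (1 + (norm z)\<^sup>2) ^ q"
  using one_norm_pos[of z] by (simp only: norm_of_real abs_of_nonneg zero_le_power less_imp_le)

lemma ip_integrable:
  assumes F: "F \<in> H" and G: "G \<in> H"
  shows "integrable (riem_vol g) (\<lambda>z. F z * cnj (G z) / complex_of_real ((1 + (norm z)\<^sup>2) ^ q))"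
proof (rule integrableI_bounded)
  show "(\<lambda>z. F z * cnj (G z) / complex_of_real ((1 + (norm z)\<^sup>2) ^ q)) \<in> borel_measurable (riem_vol g)"
    using ip_measurable[OF H_entire[OF F] H_entire[OF G]]
    by (subst measurable_cong_sets[OF sets_riem_vol refl])
  have "(\<integral>\<^sup>+z. ennreal (norm (F z * cnj (G z) / complex_of_real ((1 + (norm z)\<^sup>2) ^ q))) \<partial>riem_vol g) =
      wint q (\<lambda>z. cmod (F z) * cmod (G z))"
    unfolding wint_def norm_divide norm_weight norm_mult complex_mod_cnj ..
  also have "\<dots> \<le> wint q (\<lambda>z. (cmod (F z))\<^sup>2 + (cmod (G z))\<^sup>2)"
  proof (rule wint_mono)
    show "cmod (F z) * cmod (G z) \<le> (cmod (F z))\<^sup>2 + (cmod (G z))\<^sup>2" for z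
      using sum_squares_bound[of "cmod (F z)" "cmod (G z)"]
        mult_nonneg_nonneg[OF norm_ge_zero[of "F z"] norm_ge_zero[of "G z"]] by linarith
  qed
  also have "\<dots> = wint q (\<lambda>z. (cmod (F z))\<^sup>2) + wint q (\<lambda>z. (cmod (G z))\<^sup>2)"
    by (rule wint_add) (simp_all add: entire_norm2_measurable[OF q] H_entire F G)
  also have "\<dots> < \<infinity>" using F G by (simp add: H_iff)
  finally show "(\<integral>\<^sup>+z. ennreal (norm (F z * cnj (G z) / complex_of_real ((1 + (norm z)\<^sup>2) ^ q))) \<partial>riem_vol g) < \<infinity>" .
qed

lemma ip_add_left:
  assumes "F \<in> H" "F' \<in> H" "G \<in> H"
  shows "ip (\<lambda>z. F z + F' z) G = ip F G + ip F' G"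
  unfolding weighted_inner_def distrib_right add_divide_distrib
  by (rule Bochner_Integration.integral_add[OF ip_integrable ip_integrable]) (rule assms)+

lemma ip_cmult_left: "ip (\<lambda>z. c * F z) G = c * ip F G"
proof -
  have "c * F z * cnj (G z) / w = c * (F z * cnj (G z) / w)" for z w by simp
  then show ?thesis unfolding weighted_inner_def by (simp only: integral_mult_right_zero)
qed

lemma ip_commute: "ip G F = cnj (ip F G)"
proof -
  have "ip G F = (\<integral>z. cnj (F z * cnj (G z) / complex_of_real ((1 + (norm z)\<^sup>2) ^ q)) \<partial>riem_vol g)"
    unfolding weighted_inner_def
    by (rule Bochner_Integration.integral_cong) (simp_all add: mult.commute)
  also have "\<dots> = cnj (ip F G)"
    unfolding weighted_inner_def
    by (rule integral_bounded_linear'[OF bounded_linear_cnj bounded_linear_cnj]) simp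
  finally show ?thesis .
qed

lemma ip_sum_left:
  assumes "\<And>i. i \<in> I \<Longrightarrow> f i \<in> H" "G \<in> H"
  shows "ip (\<lambda>z. \<Sum>i\<in>I. c i * f i z) G = (\<Sum>i\<in>I. c i * ip (f i) G)"
  using assms(1)
proof (induction I rule: infinite_finite_induct)
  case (insert i I)
  then have "ip (\<lambda>z. c i * f i z + (\<Sum>i\<in>I. c i * f i z)) G =
      ip (\<lambda>z. c i * f i z) G + ip (\<lambda>z. \<Sum>i\<in>I. c i * f i z) G"
    by (intro ip_add_left H_cmult H_sum assms(2)) auto
  then show ?case using insert by (simp add: ip_cmult_left)
qed (simp_all add: weighted_inner_def)

text \<open>Vanishing norm gives F = 0 almost everywhere for the volume, hence for Lebesgue measure
  since the density is positive, hence everywhere by continuity.\<close>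

lemma ip_self:
  assumes F: "F \<in> H"
  shows "ip F F = of_real (Re (ip F F))" "Re (ip F F) \<ge> 0" "Re (ip F F) = 0 \<Longrightarrow> F = (\<lambda>z. 0)"
proof -
  define h where "h z = (cmod (F z))\<^sup>2 / (1 + (norm z)\<^sup>2) ^ q" for z
  have eq: "F z * cnj (F z) / complex_of_real ((1 + (norm z)\<^sup>2) ^ q) = of_real (h z)" for z
    unfolding h_def of_real_divide complex_norm_square ..
  have i: "integrable (riem_vol g) h"
  proof -
    have "integrable (riem_vol g) (\<lambda>z. complex_of_real (h z))"
      using ip_integrable[OF F F] by (simp only: eq)
    then have "integrable (riem_vol g) (\<lambda>z. Re (complex_of_real (h z)))"
      by (rule integrable_bounded_linear[OF bounded_linear_Re])
    then show ?thesis unfolding Re_complex_of_real .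
  qed
  have ip: "ip F F = of_real (integral\<^sup>L (riem_vol g) h)"
    unfolding weighted_inner_def eq by (rule integral_of_real[OF i])
  have h0: "h z \<ge> 0" for z using one_norm_pos[of z] by (simp add: h_def)
  show "ip F F = of_real (Re (ip F F))" "Re (ip F F) \<ge> 0"
    using h0 by (simp_all add: ip)
  assume "Re (ip F F) = 0"
  then have "integral\<^sup>L (riem_vol g) h = 0" by (simp add: ip)
  then have "AE z in riem_vol g. h z = 0"
    using integral_nonneg_eq_0_iff_AE[OF i] h0 by simp
  then have "AE z in lborel. 0 < ennreal (dens z) \<longrightarrow> h z = 0"
    unfolding riem_vol_dens by (subst (asm) AE_density) simp_all
  then have "AE z in lborel. F z = 0"
  proof eventually_elim
    case (elim z)
    then have "h z = 0" using dens_pos[of z] by simp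
    then show ?case using one_norm_pos[of z] by (simp add: h_def)
  qed
  then show "F = (\<lambda>z. 0)" using AE_continuous_zero[OF entire_continuous[OF H_entire[OF F]]] by blast
qed

lemma H_unitary:
  assumes F: "F \<in> H" and U: "unitary_matrix U"
  shows "(\<lambda>z. F (U *v z)) \<in> H"
proof -
  have "entire (\<lambda>z. F (U *v z))"
    by (rule entire_linear_compose[OF H_entire[OF F] bounded_linear_matrix vector_scalar_commute])
  moreover have "wint q (\<lambda>z. (cmod (F (U *v z)))\<^sup>2) = wint q (\<lambda>z. (cmod (F z))\<^sup>2)"
    by (rule wint_unitary[OF U entire_norm2_measurable[OF q H_entire[OF F]]])
  ultimately show ?thesis using F by (simp add: H_iff)
qed

lemma ip_unitary:
  assumes F: "F \<in> H" and G: "G \<in> H" and U: "unitary_matrix U"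
  shows "ip (\<lambda>z. F (U *v z)) (\<lambda>z. G (U *v z)) = ip F G"
proof -
  let ?h = "\<lambda>z. F z * cnj (G z) / complex_of_real ((1 + (norm z)\<^sup>2) ^ q)"
  have "ip F G = integral\<^sup>L (distr (riem_vol g) borel ((*v) U)) ?h"
    unfolding riem_vol_unitary[OF U] weighted_inner_def ..
  also have "\<dots> = (\<integral>z. ?h (U *v z) \<partial>riem_vol g)"
  proof (rule integral_distr)
    show "(*v) U \<in> riem_vol g \<rightarrow>\<^sub>M borel" by measurable
    show "?h \<in> borel_measurable borel" by (rule ip_measurable[OF H_entire[OF F] H_entire[OF G]])
  qed
  finally show ?thesis by (simp add: weighted_inner_def norm_unitary[OF U])
qed

definition orthonormal :: "nat \<Rightarrow> (nat \<Rightarrow> complex ^ 'n \<Rightarrow> complex) \<Rightarrow> bool"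
  where "orthonormal N s \<longleftrightarrow> (\<forall>i<N. s i \<in> H) \<and> (\<forall>i<N. \<forall>j<N. ip (s i) (s j) = (if i = j then 1 else 0))"

lemma ip_orthonormal_sum:
  assumes "orthonormal N s" "j < N"
  shows "ip (\<lambda>z. \<Sum>i<N. c i * s i z) (s j) = c j"
proof -
  have "ip (\<lambda>z. \<Sum>i<N. c i * s i z) (s j) = (\<Sum>i<N. c i * ip (s i) (s j))"
    by (rule ip_sum_left) (use assms in \<open>auto simp: orthonormal_def\<close>)
  also have "\<dots> = (\<Sum>i<N. if i = j then c j else 0)"
    by (rule sum.cong) (use assms in \<open>auto simp: orthonormal_def\<close>)
  finally show ?thesis using assms(2) by simp
qed

text \<open>A function whose residual has norm zero already lies in the span, so dependent sets are
  handled by skipping it; otherwise the normalised residual is appended.\<close>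

lemma gram_schmidt:
  assumes "finite B" "B \<subseteq> H"
  shows "\<exists>N s. orthonormal N s \<and> (\<forall>f\<in>B. \<exists>c. f = (\<lambda>z. \<Sum>i<N. c i * s i z))"
  using assms
proof (induction B)
  case empty
  show ?case by (rule exI[of _ 0]) (simp add: orthonormal_def)
next
  case (insert f B)
  then obtain N s where s: "orthonormal N s" "\<forall>f\<in>B. \<exists>c. f = (\<lambda>z. \<Sum>i<N. c i * s i z)" by blast
  have f: "f \<in> H" using insert by simp
  have sH: "\<And>i. i < N \<Longrightarrow> s i \<in> H" using s(1) by (simp add: orthonormal_def)
  define P where "P = (\<lambda>z. \<Sum>i<N. ip f (s i) * s i z)"
  define u where "u = (\<lambda>z. f z + (-1) * P z)"
  have PH: "P \<in> H" unfolding P_def by (intro H_sum H_cmult) (use sH in auto)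
  have uH: "u \<in> H" unfolding u_def by (intro H_add H_cmult f PH)
  have us: "ip u (s j) = 0" if "j < N" for j
  proof -
    have "ip u (s j) = ip f (s j) + (-1) * ip P (s j)"
      unfolding u_def using ip_add_left[OF f H_cmult[OF PH] sH[OF that]] by (simp only: ip_cmult_left)
    also have "ip P (s j) = ip f (s j)" unfolding P_def by (rule ip_orthonormal_sum[OF s(1) that])
    finally show ?thesis by simp
  qed
  have fu: "f z = u z + P z" for z by (simp add: u_def)
  show ?case
  proof (cases "Re (ip u u) = 0")
    case True
    then have "f = P" using ip_self(3)[OF uH] fu by auto
    then have "\<exists>c. f = (\<lambda>z. \<Sum>i<N. c i * s i z)"
      unfolding P_def by (rule exI[of _ "\<lambda>i. ip f (s i)"])
    then show ?thesis using s by (intro exI[of _ N] exI[of _ s]) simp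
  next
    case False
    define r where "r = sqrt (Re (ip u u))"
    have r: "r > 0" "Re (ip u u) = r * r" using False ip_self(2)[OF uH] by (simp_all add: r_def)
    define s' where "s' = s(N := (\<lambda>z. of_real (inverse r) * u z))"
    have s'N: "s' N = (\<lambda>z. of_real (inverse r) * u z)" and s'i: "i < N \<Longrightarrow> s' i = s i" for i
      by (simp_all add: s'_def)
    have NN: "ip (s' N) (s' N) = 1"
    proof -
      have "ip (s' N) (s' N) = of_real (inverse r) * cnj (of_real (inverse r) * ip u u)"
        unfolding s'N ip_cmult_left ip_commute[of u "\<lambda>z. of_real (inverse r) * u z"] by simp
      then show ?thesis using r by (subst (asm) ip_self(1)[OF uH]) (simp add: field_simps flip: of_real_mult)
    qed
    have Nj: "ip (s' N) (s' j) = 0" if "j < N" for j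
      unfolding s'N s'i[OF that] ip_cmult_left us[OF that] by simp
    have jN: "ip (s' j) (s' N) = 0" if "j < N" for j
      using Nj[OF that] ip_commute[of "s' j" "s' N"] by simp
    have "orthonormal (Suc N) s'"
      unfolding orthonormal_def
    proof (intro conjI allI impI)
      fix i assume "i < Suc N"
      then show "s' i \<in> H" using H_cmult[OF uH] sH by (cases "i = N") (simp_all add: s'_def)
    next
      fix i j assume "i < Suc N" "j < Suc N"
      then show "ip (s' i) (s' j) = (if i = j then 1 else 0)"
        using NN Nj jN s(1) s'i
        by (cases "i = N"; cases "j = N") (auto simp: orthonormal_def less_Suc_eq)
    qed
    moreover have "\<exists>c. h = (\<lambda>z. \<Sum>i<Suc N. c i * s' i z)" if "h \<in> insert f B" for h
    proof -
      have comb: "\<exists>c. (\<lambda>z. k * u z + (\<Sum>i<N. c0 i * s i z)) = (\<lambda>z. \<Sum>i<Suc N. c i * s' i z)" for k c0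
      \<comment> \<open>The new basis function is u / r, so the coefficient k of u becomes k
        r.\<close>
      proof (rule exI[of _ "c0(N := k * of_real r)"])
        show "(\<lambda>z. k * u z + (\<Sum>i<N. c0 i * s i z)) = (\<lambda>z. \<Sum>i<Suc N. (c0(N := k * of_real r)) i * s' i z)"
          using r by (simp add: fun_eq_iff s'N s'i flip: of_real_mult)
      qed
      show ?thesis
      proof (cases "h = f")
        case True
        have "f = (\<lambda>z. 1 * u z + (\<Sum>i<N. ip f (s i) * s i z))"
        proof
          fix z show "f z = 1 * u z + (\<Sum>i<N. ip f (s i) * s i z)"
            unfolding mult_1_left using fu[of z] unfolding P_def .
        qed
        moreover obtain c where "(\<lambda>z. 1 * u z + (\<Sum>i<N. ip f (s i) * s i z)) = (\<lambda>z. \<Sum>i<Suc N. c i * s' i z)"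
          using comb[of 1 "\<lambda>i. ip f (s i)"] by (rule exE)
        ultimately have "f = (\<lambda>z. \<Sum>i<Suc N. c i * s' i z)" by (rule trans)
        then have "h = (\<lambda>z. \<Sum>i<Suc N. c i * s' i z)" unfolding True .
        then show ?thesis by (rule exI[of _ c])
      next
        case False
        then have "h \<in> B" using that by simp
        from bspec[OF s(2) this] obtain c0 where "h = (\<lambda>z. \<Sum>i<N. c0 i * s i z)" by (rule exE)
        then have "h = (\<lambda>z. 0 * u z + (\<Sum>i<N. c0 i * s i z))"
          unfolding mult_zero_left add_0_left .
        moreover obtain c where "(\<lambda>z. 0 * u z + (\<Sum>i<N. c0 i * s i z)) = (\<lambda>z. \<Sum>i<Suc N. c i * s' i z)"
          using comb[of 0 c0] by (rule exE)
        ultimately have "h = (\<lambda>z. \<Sum>i<Suc N. c i * s' i z)" by (rule trans)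
        then show ?thesis by (rule exI[of _ c])
      qed
    qed
    ultimately show ?thesis by blast
  qed
qed

text \<open>Orthonormalise the monomials of the degrees 1, ..., \<open>dstar q\<close>; their span
  contains every homogeneous part and therefore, by the finite decomposition, the whole weighted
  space.\<close>

lemma onb_exists: "\<exists>N s. onb g q N s"
proof -
  define mono :: "('n \<Rightarrow> nat) \<Rightarrow> complex ^ 'n \<Rightarrow> complex" where "mono m = (\<lambda>z. \<Prod>i\<in>UNIV. (z $ i) ^ m i)" for m
  define B where "B = (\<Union>d\<in>{1..dstar q}. mono ` {m. sum m UNIV = d})"
  have fin: "finite B" unfolding B_def by (intro finite_UN_I finite_imageI finite_exponents) simp
  have "B \<subseteq> H"
    unfolding B_def mono_def
    using hom_poly_weighted_space[OF q] monomial_hom_poly by blast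
  then obtain N s where s: "orthonormal N s" "\<forall>f\<in>B. \<exists>c. f = (\<lambda>z. \<Sum>i<N. c i * s i z)"
    using gram_schmidt[OF fin] by blast
  define S where "S = {f. \<exists>c. f = (\<lambda>z. \<Sum>i<N. c i * s i z)}"
  have S0: "(\<lambda>z. 0) \<in> S" unfolding S_def by (auto intro!: exI[of _ "\<lambda>_. 0"])
  have S_add: "(\<lambda>z. f z + h z) \<in> S" if fS: "f \<in> S" and hS: "h \<in> S" for f h
  proof -
    obtain c where "f = (\<lambda>z. \<Sum>i<N. c i * s i z)" using fS unfolding S_def by blast
    moreover obtain c' where "h = (\<lambda>z. \<Sum>i<N. c' i * s i z)" using hS unfolding S_def by blast
    ultimately have "(\<lambda>z. f z + h z) = (\<lambda>z. \<Sum>i<N. (c i + c' i) * s i z)"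
      by (simp add: sum.distrib distrib_right)
    then show ?thesis unfolding S_def mem_Collect_eq by (rule exI[of _ "\<lambda>i. c i + c' i"])
  qed
  have S_cmult: "(\<lambda>z. k * f z) \<in> S" if fS: "f \<in> S" for f k
  proof -
    obtain c where "f = (\<lambda>z. \<Sum>i<N. c i * s i z)" using fS unfolding S_def by blast
    then have "(\<lambda>z. k * f z) = (\<lambda>z. \<Sum>i<N. (k * c i) * s i z)"
      by (simp add: sum_distrib_left mult.assoc)
    then show ?thesis unfolding S_def mem_Collect_eq by (rule exI[of _ "\<lambda>i. k * c i"])
  qed
  have S_sum: "(\<lambda>z. \<Sum>i\<in>I. f i z) \<in> S" if "\<And>i. i \<in> I \<Longrightarrow> f i \<in> S" for I and f :: "'x \<Rightarrow> _"
    using that by (induction I rule: infinite_finite_induct) (simp_all add: S0 S_add)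
  have "F \<in> S" if F: "F \<in> H" for F
  proof -
    have "tay F d \<in> S" if d: "d \<in> {1..dstar q}" for d
    proof -
      obtain c where c: "tay F d = (\<lambda>z. \<Sum>m | sum m UNIV = d. c m * (\<Prod>i\<in>UNIV. (z $ i) ^ m i))"
        using tay_weighted_space(1)[OF q F, of d] unfolding hom_poly_def by blast
      have "(\<lambda>z. \<Prod>i\<in>UNIV. (z $ i) ^ m i) \<in> S" if "sum m UNIV = d" for m :: "'n \<Rightarrow> nat"
      proof -
        have "mono m \<in> B" unfolding B_def using that d by blast
        from bspec[OF s(2) this] show ?thesis unfolding S_def mem_Collect_eq mono_def .
      qed
      then show ?thesis unfolding c by (intro S_sum S_cmult) simp
    qed
    then have "(\<lambda>z. \<Sum>d=1..dstar q. tay F d z) \<in> S" by (rule S_sum)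
    then show ?thesis by (rule ssubst[OF tay_weighted_space(2)[OF q F], of "\<lambda>f. f \<in> S"])
  qed
  then have "onb g q N s"
    using s(1) unfolding onb_def orthonormal_def S_def by blast
  then show ?thesis by blast
qed

text \<open>Evaluation, directional derivative and homogeneous part at a point are functionals of
  this kind, so that one change-of-basis argument serves the kernel, the derivative sum and the
  coefficients.\<close>

definition linear_on_H :: "((complex ^ 'n \<Rightarrow> complex) \<Rightarrow> complex) \<Rightarrow> bool"
  where "linear_on_H L \<longleftrightarrow> (\<forall>F\<in>H. \<forall>G\<in>H. L (\<lambda>z. F z + G z) = L F + L G) \<and>
    (\<forall>F\<in>H. \<forall>c. L (\<lambda>z. c * F z) = c * L F)"

lemma linear_on_H_sum:
  fixes N :: nat
  assumes L: "linear_on_H L" and s: "\<And>i. i < N \<Longrightarrow> s i \<in> H"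
  shows "L (\<lambda>z. \<Sum>i<N. c i * s i z) = (\<Sum>i<N. c i * L (s i))"
  using s
proof (induction N)
  case 0
  have "\<forall>F\<in>H. \<forall>c. L (\<lambda>z. c * F z) = c * L F" using L by (simp add: linear_on_H_def)
  from bspec[OF this H_zero, THEN spec, of 0] show ?case by simp
next
  case (Suc N)
  have "L (\<lambda>z. (\<Sum>i<N. c i * s i z) + c N * s N z) = L (\<lambda>z. \<Sum>i<N. c i * s i z) + L (\<lambda>z. c N * s N z)"
    using L H_sum[of "{..<N}" "\<lambda>i z. c i * s i z"] H_cmult Suc.prems unfolding linear_on_H_def by simp
  also have "L (\<lambda>z. c N * s N z) = c N * L (s N)"
    using L Suc.prems unfolding linear_on_H_def by blast
  finally show ?case using Suc by simp
qed

lemma linear_on_H_eval: "linear_on_H (\<lambda>F. F z)"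
  and linear_on_H_deriv: "linear_on_H (\<lambda>F. dir_deriv F v z)"
  and linear_on_H_tay: "linear_on_H (\<lambda>F. tay F d z)"
proof -
  show "linear_on_H (\<lambda>F. F z)" by (simp add: linear_on_H_def)
  show "linear_on_H (\<lambda>F. tay F d z)" by (simp add: linear_on_H_def tay_add tay_cmult H_entire)
  show "linear_on_H (\<lambda>F. dir_deriv F v z)"
    unfolding linear_on_H_def
  proof (intro conjI ballI allI)
    fix F G c assume F: "F \<in> H" and G: "G \<in> H"
    show "dir_deriv (\<lambda>z. F z + G z) v z = dir_deriv F v z + dir_deriv G v z"
      by (intro dir_deriv_eqI has_derivative_add entire_has_derivative H_entire F G)
  next
    fix F c assume F: "F \<in> H"
    show "dir_deriv (\<lambda>z. c * F z) v z = c * dir_deriv F v z"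
      by (intro dir_deriv_eqI has_derivative_mult_right entire_has_derivative H_entire F)
  qed
qed

lemma onb_orthonormal: "onb g q N s \<Longrightarrow> orthonormal N s"
  by (simp add: onb_def orthonormal_def)

lemma onb_expand:
  assumes s: "onb g q N s" and F: "F \<in> H" and L: "linear_on_H L"
  shows "L F = (\<Sum>i<N. ip F (s i) * L (s i))"
proof -
  obtain c where c: "F = (\<lambda>z. \<Sum>i<N. c i * s i z)" using s F unfolding onb_def by blast
  have "ip F (s j) = c j" if "j < N" for j
    unfolding c by (rule ip_orthonormal_sum[OF onb_orthonormal[OF s] that])
  moreover have "L F = (\<Sum>i<N. c i * L (s i))"
    unfolding c by (rule linear_on_H_sum[OF L]) (use s in \<open>simp add: onb_def\<close>)
  ultimately show ?thesis by simp
qed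

text \<open>Expand each s_i in the basis t and regroup: the conjugated coefficients are those of t_j
  in the basis s. Applied to a basis and its rotation, the lemma also yields the unitary invariance
  of the kernel.\<close>

lemma onb_independent:
  assumes s: "onb g q N s" and t: "onb g q M t" and L: "linear_on_H L" "linear_on_H L'"
  shows "(\<Sum>i<N. L (s i) * cnj (L' (s i))) = (\<Sum>j<M. L (t j) * cnj (L' (t j)))"
proof -
  have sH: "\<And>i. i < N \<Longrightarrow> s i \<in> H" and tH: "\<And>i. i < M \<Longrightarrow> t i \<in> H"
    using s t by (simp_all add: onb_def)
  have "(\<Sum>i<N. L (s i) * cnj (L' (s i))) = (\<Sum>i<N. \<Sum>j<M. ip (s i) (t j) * L (t j) * cnj (L' (s i)))"
    by (intro sum.cong refl) (simp add: onb_expand[OF t sH L(1)] sum_distrib_right)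
  also have "\<dots> = (\<Sum>j<M. \<Sum>i<N. ip (s i) (t j) * L (t j) * cnj (L' (s i)))" by (rule sum.swap)
  also have "\<dots> = (\<Sum>j<M. L (t j) * cnj (\<Sum>i<N. ip (t j) (s i) * L' (s i)))"
    by (intro sum.cong refl)
       (simp add: sum_distrib_left ip_commute[of "s _" "t _"] mult_ac)
  also have "\<dots> = (\<Sum>j<M. L (t j) * cnj (L' (t j)))"
    by (intro sum.cong refl) (simp add: onb_expand[OF s tH L(2)])
  finally show ?thesis .
qed

lemma diag_kernel_eq: "diag_kernel N s z = Re (\<Sum>i<N. s i z * cnj (s i z))"
  unfolding diag_kernel_def Re_sum complex_norm_square[symmetric] by simp

text \<open>The derivative sum is a combination, with coefficients \<open>ginv\<close>, of pairings
  of two partial derivatives, each of which is independent of the basis.\<close>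

lemma kernel_data_onb:
  assumes s: "onb g q N s"
  shows "kernel_data g q (diag_kernel N s) (deriv_sum g N s)"
  unfolding kernel_data_def
proof (intro conjI allI impI)
  show "\<exists>N s. onb g q N s" using s by blast
  fix M t assume t: "onb g q M t"
  show "diag_kernel M t = diag_kernel N s"
  proof
    fix z
    have "(\<Sum>j<M. t j z * cnj (t j z)) = (\<Sum>i<N. s i z * cnj (s i z))"
      by (rule onb_independent[OF t s linear_on_H_eval linear_on_H_eval])
    then show "diag_kernel M t z = diag_kernel N s z" unfolding diag_kernel_eq by (rule arg_cong)
  qed
  show "deriv_sum g M t = deriv_sum g N s"
  proof
    fix z
    have D: "deriv_sum g k f z = 2 * Re (\<Sum>\<alpha>\<in>UNIV. \<Sum>\<beta>\<in>UNIV. ginv g z \<alpha> \<beta> *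
        (\<Sum>i<k. dir_deriv (f i) (axis \<alpha> 1) z * cnj (dir_deriv (f i) (axis \<beta> 1) z)))"
      if f: "onb g q k f" for k f
    proof -
      have "deriv_sum g k f z = (\<Sum>i<k. 2 * Re (\<Sum>\<alpha>\<in>UNIV. \<Sum>\<beta>\<in>UNIV. ginv g z \<alpha> \<beta> *
          dir_deriv (f i) (axis \<alpha> 1) z * cnj (dir_deriv (f i) (axis \<beta> 1) z)))"
        unfolding deriv_sum_def using f by (intro sum.cong refl cgrad_sq_entire H_entire) (simp add: onb_def)
      also have "\<dots> = 2 * Re (\<Sum>i<k. \<Sum>\<alpha>\<in>UNIV. \<Sum>\<beta>\<in>UNIV. ginv g z \<alpha> \<beta> *
          (dir_deriv (f i) (axis \<alpha> 1) z * cnj (dir_deriv (f i) (axis \<beta> 1) z)))"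
        by (simp only: sum_distrib_left[symmetric] Re_sum mult.assoc)
      also have "(\<Sum>i<k. \<Sum>\<alpha>\<in>UNIV. \<Sum>\<beta>\<in>UNIV. ginv g z \<alpha> \<beta> *
          (dir_deriv (f i) (axis \<alpha> 1) z * cnj (dir_deriv (f i) (axis \<beta> 1) z))) =
          (\<Sum>\<alpha>\<in>UNIV. \<Sum>\<beta>\<in>UNIV. ginv g z \<alpha> \<beta> *
          (\<Sum>i<k. dir_deriv (f i) (axis \<alpha> 1) z * cnj (dir_deriv (f i) (axis \<beta> 1) z)))"
        unfolding sum_distrib_left
        by (subst sum.swap, rule sum.cong[OF refl], rule sum.swap)
      finally show ?thesis .
    qed
    show "deriv_sum g M t z = deriv_sum g N s z"
      unfolding D[OF t] D[OF s]
      by (simp only: onb_independent[OF t s linear_on_H_deriv linear_on_H_deriv])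
  qed
qed

text \<open>Orthonormality is the invariance of the inner product; spanning follows by expanding F
  composed with the inverse of U.\<close>

lemma onb_unitary:
  assumes s: "onb g q N s" and U: "unitary_matrix U"
  shows "onb g q N (\<lambda>i z. s i (U *v z))"
  unfolding onb_def
proof (intro conjI allI impI ballI)
  have sH: "\<And>i. i < N \<Longrightarrow> s i \<in> H" using s by (simp add: onb_def)
  show "(\<lambda>z. s i (U *v z)) \<in> H" if "i < N" for i by (rule H_unitary[OF sH[OF that] U])
  show "ip (\<lambda>z. s i (U *v z)) (\<lambda>z. s j (U *v z)) = (if i = j then 1 else 0)" if "i < N" "j < N" for i j
    using s that by (simp add: ip_unitary[OF sH sH U] onb_def)
  fix F assume F: "F \<in> H"
  obtain V where V: "unitary_matrix V" "\<And>z. V *v (U *v z) = z"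
  proof -
    obtain V where V: "unitary_matrix V" "\<And>z. U *v (V *v z) = z" by (rule unitary_inverse[OF U], rule that, assumption, simp)
    \<comment> \<open>\<open>unitary_inverse\<close> gives a right inverse; U preserves norms and is
      therefore injective, which makes V a left inverse as well.\<close>
    have "V *v (U *v z) = z" for z
    proof -
      have "norm (V *v (U *v z) - z) = norm (U *v (V *v (U *v z) - z))" by (simp add: norm_unitary[OF U])
      also have "\<dots> = 0" by (simp add: matrix_vector_mult_diff_distrib V(2))
      finally show ?thesis by simp
    qed
    then show thesis using that V(1) by blast
  qed
  have "(\<lambda>z. F (V *v z)) \<in> H" by (rule H_unitary[OF F V(1)])
  then obtain c where c: "(\<lambda>z. F (V *v z)) = (\<lambda>z. \<Sum>i<N. c i * s i z)"
    using s unfolding onb_def by blast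
  have "F z = (\<Sum>i<N. c i * s i (U *v z))" for z
    using fun_cong[OF c, of "U *v z"] by (simp add: V(2))
  then show "\<exists>c. F = (\<lambda>z. \<Sum>i<N. c i * s i (U *v z))" by blast
qed

text \<open>The squared norm of the functional that takes F to the value at E of its part of degree
  d; it will be the coefficient of s^d in the kernel.\<close>

definition kcoeff :: "nat \<Rightarrow> (nat \<Rightarrow> complex ^ 'n \<Rightarrow> complex) \<Rightarrow> nat \<Rightarrow> real"
  where "kcoeff N s d = (\<Sum>i<N. (cmod (tay (s i) d E))\<^sup>2)"

text \<open>If the sum vanished, the functional would vanish on the basis and so on the whole space,
  but it takes the value 1 on the d-th power of the coordinate z_e.\<close>

lemma kcoeff_pos:
  assumes s: "onb g q N s" and d: "d \<in> {1..dstar q}"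
  shows "kcoeff N s d > 0"
proof (rule ccontr)
  assume "\<not> kcoeff N s d > 0"
  moreover have "kcoeff N s d \<ge> 0" unfolding kcoeff_def by (intro sum_nonneg) simp
  ultimately have "(\<Sum>i<N. (cmod (tay (s i) d E))\<^sup>2) = 0" unfolding kcoeff_def by linarith
  then have zero: "tay (s i) d E = 0" if "i < N" for i
    using that by (subst (asm) sum_nonneg_eq_0_iff) auto
  have hp: "(\<lambda>z. (z $ e) ^ d) \<in> hom_poly d" by (rule component_power_hom_poly)
  have "tay (\<lambda>z. (z $ e) ^ d) d E = 0"
    using onb_expand[OF s hom_poly_weighted_space[OF q d hp] linear_on_H_tay[of d E]] zero by simp
  moreover have "tay (\<lambda>z. (z $ e) ^ d) d E = 1"
  proof -
    have "tay (\<lambda>z. (z $ e) ^ d) d E = (if d \<le> d then (if d = d then 1 else 0) else 0)"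
    proof (rule tay_eqI[where c = "\<lambda>k. if k = d then 1 else 0" and N = d])
      fix w :: complex
      have "(\<Sum>k\<le>d. (if k = d then 1 else 0) * w ^ k) = (\<Sum>k\<le>d. if k = d then w ^ d else 0)"
        by (rule sum.cong) auto
      then show "((w *s E) $ e) ^ d = (\<Sum>k\<le>d. (if k = d then 1 else 0) * w ^ k)"
        by (simp add: E_def)
    qed
    then show ?thesis by simp
  qed
  ultimately show False by simp
qed

text \<open>The scalar \<open>w = exp (i \<pi> / (d - k))\<close> satisfies \<open>w\<^sup>d * cnj w\<^sup>k = - 1\<close>.\<close>

lemma tay_orthogonal:
  assumes s: "onb g q N s" and dk: "d \<noteq> k"
  shows "(\<Sum>i<N. tay (s i) d z * cnj (tay (s i) k z)) = 0"
proof -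
  define \<theta> where "\<theta> = pi / (real d - real k)"
  define w where "w = cis \<theta>"
  obtain U :: "complex ^ 'n ^ 'n" where U: "unitary_matrix U" "\<And>x. U *v x = w *s x"
    by (rule unitary_scalar[of w], simp add: w_def, rule that) simp_all
  have sE: "entire (s i)" if "i < N" for i using s that H_entire by (simp add: onb_def)
  have tw: "tay (\<lambda>z. s i (U *v z)) j z = w ^ j * tay (s i) j z" if "i < N" for i j
  proof -
    have "tay (\<lambda>z. s i (U *v z)) j z = tay (s i) j (w *s z)"
      unfolding tay_def U(2) by (simp add: vector_smult_assoc mult.commute)
    then show ?thesis by (simp add: tay_scale[OF sE[OF that]])
  qed
  have "real d * \<theta> - real k * \<theta> = pi"
  proof -
    have "real d * \<theta> - real k * \<theta> = (real d - real k) * \<theta>" by (simp add: algebra_simps)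
    then show ?thesis using dk by (simp add: \<theta>_def)
  qed
  then have "w ^ d * cnj w ^ k = -1"
    unfolding w_def cis_cnj Complex.DeMoivre cis_mult by simp
  then have ww: "w ^ d * x * cnj (w ^ k * y) = - (x * cnj y)" for x y
  proof -
    assume *: "w ^ d * cnj w ^ k = -1"
    have "w ^ d * x * cnj (w ^ k * y) = (w ^ d * cnj w ^ k) * (x * cnj y)" by (simp add: mult_ac)
    then show ?thesis unfolding * by simp
  qed
  let ?S = "\<Sum>i<N. tay (s i) d z * cnj (tay (s i) k z)"
  \<comment> \<open>Rotating the basis by w leaves the sum unchanged by basis independence, yet
    multiplies each term by -1.\<close>
  have "?S = (\<Sum>i<N. tay (\<lambda>z. s i (U *v z)) d z * cnj (tay (\<lambda>z. s i (U *v z)) k z))"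
    by (rule onb_independent[OF s onb_unitary[OF s U(1)] linear_on_H_tay linear_on_H_tay])
  also have "\<dots> = (\<Sum>i<N. - (tay (s i) d z * cnj (tay (s i) k z)))"
    by (intro sum.cong refl) (simp only: tw lessThan_iff ww)
  also have "\<dots> = - ?S" by (rule sum_negf)
  finally show ?thesis by simp
qed

text \<open>Invariance of the kernel moves z to the axis, where each basis function is a polynomial
  in |z|; the products of different degrees cancel by \<open>tay_orthogonal\<close>.\<close>

lemma diag_kernel_kpoly:
  assumes s: "onb g q N s"
  shows "diag_kernel N s z = kpoly (dstar q) (kcoeff N s) ((norm z)\<^sup>2)"
proof -
  let ?x = "complex_of_real (norm z)" and ?D = "{1..dstar q}"
  obtain U where U: "unitary_matrix U" "U *v z = norm z *\<^sub>R E" by (rule unitary_to_axis)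
  have sH: "s i \<in> H" if "i < N" for i using s that by (simp add: onb_def)
  have exp: "s i (U *v z) = (\<Sum>d\<in>?D. ?x ^ d * tay (s i) d E)" if "i < N" for i
    unfolding U(2) scaleR_eq_scale
    by (subst tay_weighted_space(2)[OF q sH[OF that]]) (simp add: tay_scale[OF H_entire[OF sH[OF that]]])
  have "(\<Sum>i<N. s i z * cnj (s i z)) = (\<Sum>i<N. s i (U *v z) * cnj (s i (U *v z)))"
    by (rule onb_independent[OF s onb_unitary[OF s U(1)] linear_on_H_eval linear_on_H_eval])
  also have "\<dots> = (\<Sum>i<N. \<Sum>d\<in>?D. \<Sum>k\<in>?D. ?x ^ d * ?x ^ k * (tay (s i) d E * cnj (tay (s i) k E)))"
    by (intro sum.cong refl) (simp add: exp sum_product mult_ac)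
  also have "\<dots> = (\<Sum>d\<in>?D. \<Sum>k\<in>?D. ?x ^ d * ?x ^ k * (\<Sum>i<N. tay (s i) d E * cnj (tay (s i) k E)))"
    unfolding sum_distrib_left by (subst sum.swap, rule sum.cong[OF refl], rule sum.swap)
  also have "\<dots> = (\<Sum>d\<in>?D. \<Sum>k\<in>?D. if k = d then of_real (kcoeff N s d * ((norm z)\<^sup>2) ^ d) else 0)"
  proof (intro sum.cong refl)
    fix d k
    show "?x ^ d * ?x ^ k * (\<Sum>i<N. tay (s i) d E * cnj (tay (s i) k E)) =
        (if k = d then of_real (kcoeff N s d * ((norm z)\<^sup>2) ^ d) else 0)"
    proof (cases "k = d")
      case True
      have "(\<Sum>i<N. tay (s i) d E * cnj (tay (s i) d E)) = of_real (kcoeff N s d)"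
        unfolding kcoeff_def of_real_sum complex_norm_square ..
      then show ?thesis using True
        by (simp add: power2_eq_square power_mult_distrib)
    next
      case False
      then show ?thesis using tay_orthogonal[OF s, of d k E] by simp
    qed
  qed
  also have "\<dots> = of_real (kpoly (dstar q) (kcoeff N s) ((norm z)\<^sup>2))"
    by (simp add: kpoly_def)
  finally show ?thesis unfolding diag_kernel_eq by simp
qed

text \<open>Both sides are compared with (1 + |z|^2)^D for D = \<open>dstar q\<close>. In the
  derivative sum, the factor 1 + |z|^2 of the inverse metric is absorbed by the factor r^(-2) of
  Cauchy's estimate.\<close>

lemma deriv_sum_bound:
  assumes s: "onb g q N s"
  shows "\<exists>C. \<forall>z. deriv_sum g N s z \<le> C * (1 + diag_kernel N s z)"
proof -
  let ?n = "CARD('n)" and ?D = "dstar q"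
  define c where "c = kcoeff N s"
  have c: "c d > 0" if "d \<in> {1..?D}" for d using kcoeff_pos[OF s that] by (simp add: c_def)
  have D1: "1 \<le> ?D" by (rule dstar[OF q])
  define K where "K z = diag_kernel N s z" for z
  have K: "K z = kpoly ?D c ((norm z)\<^sup>2)" for z by (simp add: K_def c_def diag_kernel_kpoly[OF s])
  define A where "A = (\<Sum>d=1..?D. c d)"
  have A0: "A \<ge> 0" unfolding A_def by (intro sum_nonneg less_imp_le[OF c])
  have K_upper: "K z \<le> A * (1 + (norm z)\<^sup>2) ^ ?D" for z
    unfolding K kpoly_def A_def sum_distrib_right
  proof (rule sum_mono)
    fix d assume d: "d \<in> {1..?D}"
    have "((norm z)\<^sup>2) ^ d \<le> (1 + (norm z)\<^sup>2) ^ d" by (intro power_mono) auto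
    also have "\<dots> \<le> (1 + (norm z)\<^sup>2) ^ ?D" using d by (intro power_increasing) auto
    finally show "c d * ((norm z)\<^sup>2) ^ d \<le> c d * (1 + (norm z)\<^sup>2) ^ ?D"
      using c[OF d] by (intro mult_left_mono) auto
  qed
  \<comment> \<open>The top coefficient alone controls the growth: with s = |z|^2, (1 + s)^D is at
    most 2^D (1 + s^D), and s^D is at most K divided by the coefficient of degree D.\<close>
  have K_lower: "(1 + (norm z)\<^sup>2) ^ ?D \<le> 2 ^ ?D * (1 + 1 / c ?D) * (1 + K z)" for z
  proof -
    let ?s = "(norm z)\<^sup>2"
    have cD: "c ?D > 0" using c D1 by simp
    have KD: "c ?D * ?s ^ ?D \<le> K z" unfolding K by (rule kpoly_ge_term[OF D1 c]) (use D1 in auto)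
    have K0: "K z \<ge> 0" unfolding K by (rule kpoly_nonneg[OF D1 c]) auto
    have "?s ^ ?D \<le> K z / c ?D" using KD cD by (simp add: field_simps)
    moreover have "(1 + 1 / c ?D) * (1 + K z) = 1 + K z + 1 / c ?D + K z / c ?D"
      by (simp add: algebra_simps add_divide_distrib)
    moreover have "1 / c ?D > 0" using cD by simp
    ultimately have "1 + ?s ^ ?D \<le> (1 + 1 / c ?D) * (1 + K z)"
      using K0 by linarith
    moreover have "(1 + ?s) ^ ?D \<le> 2 ^ ?D * (1 + ?s ^ ?D)"
    proof (cases "?s \<le> 1")
      case True
      then have "(1 + ?s) ^ ?D \<le> 2 ^ ?D" by (intro power_mono) auto
      also have "\<dots> \<le> 2 ^ ?D * (1 + ?s ^ ?D)" by simp
      finally show ?thesis .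
    next
      case False
      then have "(1 + ?s) ^ ?D \<le> (2 * ?s) ^ ?D" by (intro power_mono) auto
      also have "\<dots> \<le> 2 ^ ?D * (1 + ?s ^ ?D)" by (simp add: power_mult_distrib)
      finally show ?thesis .
    qed
    moreover have "2 ^ ?D * x \<le> 2 ^ ?D * y" if "x \<le> y" for x y :: real
      using that by simp
    ultimately show ?thesis unfolding mult.assoc by (meson order_trans)
  qed
  have step: "cgrad_sq g (s i) z \<le> (2 * real ?n * A * 10 ^ ?D / a 1) * (1 + (norm z)\<^sup>2) ^ ?D"
    if i: "i < N" for i z
  proof -
    have F: "entire (s i)" using s i H_entire by (simp add: onb_def)
    define r where "r = 1 + norm z"
    have r: "r \<ge> 1" "r > 0" by (simp_all add: r_def add_pos_nonneg)
    define l where "l = (\<chi> \<alpha>. dir_deriv (s i) (axis \<alpha> 1) z)"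
    have r2: "r\<^sup>2 \<le> 2 * (1 + (norm z)\<^sup>2)"
      using sum_squares_bound[of 1 "norm z"] by (simp add: r_def power2_sum)
    have comp: "(cmod (l $ \<alpha>))\<^sup>2 \<le> A * (5 * r\<^sup>2) ^ ?D / r\<^sup>2" for \<alpha>
    proof -
      have "cmod (dir_deriv (s i) (axis \<alpha> 1) z) \<le> sqrt (A * (5 * r\<^sup>2) ^ ?D) / r"
      proof (rule entire_deriv_bound[OF F r(2)])
        fix w assume w: "cmod w = r"
        let ?y = "z + w *s axis \<alpha> 1"
        have "norm ?y \<le> norm z + r"
          using norm_triangle_ineq[of z "w *s axis \<alpha> 1"] w by (simp add: norm_cscale norm_axis_1)
        then have "norm ?y \<le> 2 * r" by (simp add: r_def)
        then have "(norm ?y)\<^sup>2 \<le> (2 * r)\<^sup>2" by (intro power_mono) auto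
        moreover have "1 \<le> r\<^sup>2" using r(1) by simp
        \<comment> \<open>|y| is at most 2 r and 1 is at most r^2, hence the factor 5 = 1 +
          4.\<close>
        ultimately have y: "1 + (norm ?y)\<^sup>2 \<le> 5 * r\<^sup>2" by (simp add: power_mult_distrib)
        have "(cmod (s i ?y))\<^sup>2 \<le> K ?y"
          unfolding K_def diag_kernel_def by (rule member_le_sum) (use i in auto)
        also have "\<dots> \<le> A * (1 + (norm ?y)\<^sup>2) ^ ?D" by (rule K_upper)
        also have "\<dots> \<le> A * (5 * r\<^sup>2) ^ ?D"
          using y A0 by (intro mult_left_mono power_mono) auto
        finally show "cmod (s i ?y) \<le> sqrt (A * (5 * r\<^sup>2) ^ ?D)" by (rule real_le_rsqrt)
      qed
      then have "(cmod (l $ \<alpha>))\<^sup>2 \<le> (sqrt (A * (5 * r\<^sup>2) ^ ?D) / r)\<^sup>2"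
        unfolding l_def vec_lambda_beta by (intro power_mono) auto
      also have "\<dots> = A * (5 * r\<^sup>2) ^ ?D / r\<^sup>2" using A0 by (simp add: power_divide)
      finally show ?thesis .
    qed
    have "(norm l)\<^sup>2 = (\<Sum>\<alpha>\<in>UNIV. (cmod (l $ \<alpha>))\<^sup>2)"
      by (simp add: norm_vec_def L2_set_def sum_nonneg)
    also have "\<dots> \<le> (\<Sum>\<alpha>\<in>(UNIV :: 'n set). A * (5 * r\<^sup>2) ^ ?D / r\<^sup>2)" by (intro sum_mono comp)
    finally have l: "(norm l)\<^sup>2 \<le> real ?n * (A * (5 * r\<^sup>2) ^ ?D / r\<^sup>2)" by simp
    have lam: "a 1 / (1 + (norm z)\<^sup>2) > 0" using a_pos[of 1] one_norm_pos[of z] by simp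
    have "cgrad_sq g (s i) z \<le> 2 * ((norm l)\<^sup>2 / (a 1 / (1 + (norm z)\<^sup>2)))"
      using ginv_bound[OF herm_met lam metric_lower, of l] unfolding cgrad_sq_entire[OF F] by (simp add: l_def)
    also have "\<dots> = 2 / a 1 * ((norm l)\<^sup>2 * (1 + (norm z)\<^sup>2))" by simp
    also have "\<dots> \<le> 2 / a 1 * (real ?n * (A * (5 * r\<^sup>2) ^ ?D / r\<^sup>2) * r\<^sup>2)"
    proof (intro mult_left_mono mult_mono l)
      show "1 + (norm z)\<^sup>2 \<le> r\<^sup>2" by (simp add: r_def power2_sum)
    qed (use a_pos[of 1] A0 r in \<open>auto simp: less_imp_le\<close>)
    also have "\<dots> = 2 * real ?n * A / a 1 * (5 * r\<^sup>2) ^ ?D" using r by simp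
    \<comment> \<open>The factor 10 is 5 times the 2 in the bound of r^2 by 2 (1 + |z|^2).\<close>
    also have "\<dots> \<le> 2 * real ?n * A / a 1 * (10 * (1 + (norm z)\<^sup>2)) ^ ?D"
      using a_pos[of 1] A0 r2 by (intro mult_left_mono power_mono) auto
    also have "\<dots> = (2 * real ?n * A * 10 ^ ?D / a 1) * (1 + (norm z)\<^sup>2) ^ ?D"
      by (subst power_mult_distrib) simp
    finally show ?thesis .
  qed
  have "deriv_sum g N s z \<le> (real N * (2 * real ?n * A * 10 ^ ?D / a 1) * (2 ^ ?D * (1 + 1 / c ?D))) * (1 + diag_kernel N s z)" for z
  proof -
    have "deriv_sum g N s z \<le> (\<Sum>i<N. (2 * real ?n * A * 10 ^ ?D / a 1) * (1 + (norm z)\<^sup>2) ^ ?D)"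
      unfolding deriv_sum_def by (intro sum_mono step) simp
    also have "\<dots> = real N * (2 * real ?n * A * 10 ^ ?D / a 1) * (1 + (norm z)\<^sup>2) ^ ?D" by simp
    also have "\<dots> \<le> real N * (2 * real ?n * A * 10 ^ ?D / a 1) * (2 ^ ?D * (1 + 1 / c ?D) * (1 + K z))"
      using a_pos[of 1] A0 by (intro mult_left_mono K_lower) auto
    finally show ?thesis by (simp add: K_def mult.assoc)
  qed
  then show ?thesis by blast
qed

end

section \<open>Distances from the origin and the gradient of the exhaustion\<close>

lemma gdist_zero_le: "gdist g 0 z \<le> sqrt (a 0) * norm z"
proof -
  have "gdist g 0 z \<le> integral {0..1} (\<lambda>t. sqrt (riem g (linepath 0 z t) (z - 0) (z - 0)))"
    by (rule gdist_le_linepath[OF herm_met])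
  also have "\<dots> \<le> integral {0..1} (\<lambda>t::real. sqrt (a 0) * norm z)"
  proof (rule integral_le[OF linepath_length(1)[OF herm_met]])
    fix t
    have "sqrt (riem g (linepath 0 z t) (z - 0) (z - 0)) \<le> sqrt (a 0 * (norm z)\<^sup>2)"
      using metric_upper[of "linepath 0 z t" z] by simp
    then show "sqrt (riem g (linepath 0 z t) (z - 0) (z - 0)) \<le> sqrt (a 0) * norm z"
      by (simp add: real_sqrt_mult)
  qed (intro integrable_continuous_real continuous_on_const)
  finally show ?thesis by simp
qed

text \<open>The vector of derivatives of log (1 + |z|^2) has Euclidean norm |z| / (1 + |z|^2), and
  the inverse metric costs a factor (1 + |z|^2) / a 1; the square of the norm times this factor is
  at most 1 / a 1.\<close>

lemma grad_log_bound: "sqrt (grad_sq g (\<lambda>z. ln (1 + (norm z)\<^sup>2)) z) \<le> sqrt (4 / a 1)"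
proof -
  let ?s = "(norm z)\<^sup>2"
  have d: "((\<lambda>s. ln (1 + s)) has_real_derivative 1 / (1 + ?s)) (at ?s)"
    using one_norm_pos[of z] by (auto intro!: derivative_eq_intros)
  define \<xi> where "\<xi> = (\<chi> \<alpha>. of_real (1 / (1 + ?s)) * cnj (z $ \<alpha>))"
  have "wirt \<alpha> (\<lambda>w. complex_of_real (ln (1 + (norm w)\<^sup>2))) z = \<xi> $ \<alpha>"
    and "wirt_bar \<alpha> (\<lambda>w. complex_of_real (ln (1 + (norm w)\<^sup>2))) z = cnj (\<xi> $ \<alpha>)" for \<alpha>
    using wirt_bar_radial[OF d] by (simp_all add: \<xi>_def)
  note w = this
  have "\<xi> = of_real (1 / (1 + ?s)) *s (\<chi> \<alpha>. cnj (z $ \<alpha>))" by (simp add: \<xi>_def vec_eq_iff)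
  moreover have "norm (\<chi> \<alpha>. cnj (z $ \<alpha>)) = norm z" by (simp add: norm_vec_def)
  ultimately have nx: "norm \<xi> = norm z / (1 + ?s)"
    using one_norm_pos[of z] by (simp only: norm_cscale norm_of_real) simp
  have lam: "a 1 / (1 + ?s) > 0" using a_pos[of 1] one_norm_pos[of z] by simp
  have "grad_sq g (\<lambda>z. ln (1 + (norm z)\<^sup>2)) z \<le> 4 * ((norm \<xi>)\<^sup>2 / (a 1 / (1 + ?s)))"
    using ginv_bound[OF herm_met lam metric_lower, of \<xi>] unfolding grad_sq_def w by simp
  also have "(norm \<xi>)\<^sup>2 / (a 1 / (1 + ?s)) = ?s / (1 + ?s) / a 1"
  proof -
    have "(x / t)\<^sup>2 / (y / t) = x\<^sup>2 / t / y" if "t > 0" for x y t :: real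
      using that by (simp add: power2_eq_square field_simps)
    then show ?thesis unfolding nx using one_norm_pos[of z] by blast
  qed
  also have "\<dots> \<le> 1 / a 1"
    using a_pos[of 1] one_norm_pos[of z] by (intro divide_right_mono) auto
  finally show ?thesis by simp
qed

end

theorem theorem1p4:
  fixes g :: "complex ^ 'n::finite \<Rightarrow> complex ^ 'n ^ 'n" and q :: nat
  assumes "CARD('n) \<ge> 2"
    and "kaehler_metric g"
    and "complete_metric g"
    and "unitary_invariant g"
    and "nonneg_bisectional g"
    and "q = CARD('n) + 2"
  shows "(\<exists>\<kappa>>0. \<forall>z v. riem g z v v \<ge> \<kappa> / (1 + (norm z)\<^sup>2) * (norm v)\<^sup>2) \<and>
         (let \<rho> = (\<lambda>z :: complex ^ 'n. ln (1 + (norm z)\<^sup>2)) in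
           smooth \<rho> \<and> strictly_psh \<rho> \<and> exhaustion \<rho> \<and>
           (\<exists>C. \<forall>z. sqrt (grad_sq g \<rho> z) \<le> C)) \<and>
         (\<exists>dstar (c :: nat \<Rightarrow> real) K Kq Dq.
           1 \<le> dstar \<and> dstar \<le> q - 1 \<and>
           is_direct_sum (weighted_space g q) {1..dstar} hom_poly \<and>
           kernel_data g q Kq Dq \<and>
           (\<forall>d\<in>{1..dstar}. c d > 0) \<and>
           (\<forall>s. K s = (\<Sum>d=1..dstar. c d * s ^ d)) \<and>
           (\<forall>z. Kq z = K ((norm z)\<^sup>2)) \<and>
           smooth (\<lambda>z. ln (1 + Kq z) / real q) \<and>
           strictly_psh (\<lambda>z. ln (1 + Kq z) / real q) \<and>
           exhaustion (\<lambda>z. ln (1 + Kq z) / real q) \<and>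
           (\<exists>R :: nat \<Rightarrow> real.
             0 < R 1 \<and> (\<forall>j\<ge>1. R j < R (Suc j)) \<and> filterlim R at_top sequentially \<and>
             (\<forall>j\<ge>1. \<forall>z. R j \<le> gdist g 0 z \<and> gdist g 0 z \<le> R (Suc j) \<longrightarrow>
               ln (1 + Kq z) / real q \<ge> real j)) \<and>
           (\<exists>C0. \<forall>z. Dq z \<le> C0 * (real q)\<^sup>2 * (1 + Kq z)))"
proof -
  have q: "q = CARD('n) + 2" by (rule assms(6))
  have q0: "real q > 0" using q by simp
  \<comment> \<open>The assumption n \<ge> 2 provides the two different indices of the
    locale.\<close>
  have "\<not> (\<forall>x\<in>UNIV. \<forall>y\<in>UNIV. x = (y :: 'n))"
    using assms(1) card_le_Suc0_iff_eq[of "UNIV :: 'n set"] by simp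
  then obtain e p :: 'n where ep: "e \<noteq> p" by blast
  interpret radial_kaehler g e p
    by unfold_locales (use assms(2-5) ep in \<open>auto simp: kaehler_metric_def\<close>)
  obtain N s where s: "onb g q N s" using onb_exists[OF q] by blast
  define D where "D = dstar q"
  define c where "c = kcoeff N s"
  define K where "K = kpoly D c"
  define Kq where "Kq = diag_kernel N s"
  have D: "1 \<le> D" "D \<le> q - 1" using dstar(1,2)[OF q] by (simp_all add: D_def)
  have c: "c d > 0" if "d \<in> {1..D}" for d
    using kcoeff_pos[OF q s] that by (simp add: c_def D_def)
  have c1: "c 1 > 0" using c D by simp
  have Kq: "Kq z = kpoly D c ((norm z)\<^sup>2)" for z
    using diag_kernel_kpoly[OF q s] by (simp add: Kq_def D_def c_def)
  have Kq_ge: "c 1 * (norm z)\<^sup>2 \<le> Kq z" for z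
    using kpoly_ge_term[OF D(1) c, where s = "(norm z)\<^sup>2" and d = 1] D by (simp add: Kq)
  have part1: "\<exists>\<kappa>>0. \<forall>z v. riem g z v v \<ge> \<kappa> / (1 + (norm z)\<^sup>2) * (norm v)\<^sup>2"
    using a_pos[of 1] metric_lower by blast
  \<comment> \<open>The function \<rho> is the case K(s) = s and r = 1 of the logarithms treated for
    \<open>kpoly\<close>.\<close>
  have rho: "(\<lambda>z :: complex ^ 'n. ln (1 + (norm z)\<^sup>2)) = (\<lambda>z. ln (1 + kpoly 1 (\<lambda>_. 1) ((norm z)\<^sup>2)) / 1)"
    by (simp add: kpoly_def)
  have part2: "smooth (\<lambda>z :: complex ^ 'n. ln (1 + (norm z)\<^sup>2)) \<and>
      strictly_psh (\<lambda>z :: complex ^ 'n. ln (1 + (norm z)\<^sup>2)) \<and>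
      exhaustion (\<lambda>z :: complex ^ 'n. ln (1 + (norm z)\<^sup>2)) \<and>
      (\<exists>C. \<forall>z. sqrt (grad_sq g (\<lambda>z. ln (1 + (norm z)\<^sup>2)) z) \<le> C)"
  proof (intro conjI)
    show "\<exists>C. \<forall>z. sqrt (grad_sq g (\<lambda>z. ln (1 + (norm z)\<^sup>2)) z) \<le> C"
      using grad_log_bound by blast
  qed (unfold rho, (rule smooth_ln_kpoly strictly_psh_ln_kpoly exhaustion_ln_kpoly; simp)+)
  obtain C where C: "\<And>z. deriv_sum g N s z \<le> C * (1 + Kq z)"
    using deriv_sum_bound[OF q s] unfolding Kq_def by blast
  \<comment> \<open>Distance at least \<open>R j\<close> forces c 1 |z|^2 \<ge> exp (j q), because
    the distance is at most sqrt (a 0) |z|; and c 1 |z|^2 is a lower bound for the kernel.\<close>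
  define R where "R j = sqrt (a 0 * exp (real j * real q) / c 1)" for j :: nat
  have R: "R j < R (Suc j)" for j
    using q0 a_pos[of 0] c1 by (simp add: R_def divide_strict_right_mono)
  have Rlim: "filterlim R at_top sequentially"
  proof -
    have "filterlim (\<lambda>j. real j * real q) at_top sequentially"
      by (rule filterlim_at_top_mult_tendsto_pos[OF tendsto_const q0 filterlim_real_sequentially])
    then have "filterlim (\<lambda>j. a 0 / c 1 * exp (real j * real q)) at_top sequentially"
      using a_pos[of 0] c1
      by (intro filterlim_tendsto_pos_mult_at_top[OF tendsto_const] filterlim_compose[OF exp_at_top]) auto
    from filterlim_compose[OF sqrt_at_top this] show ?thesis
      by (simp add: R_def[abs_def])
  qed
  have far: "ln (1 + Kq z) / real q \<ge> real j" if "R j \<le> gdist g 0 z" for j z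
  proof -
    have "R j \<le> sqrt (a 0) * norm z" using that gdist_zero_le[of z] by linarith
    then have "(R j)\<^sup>2 \<le> (sqrt (a 0) * norm z)\<^sup>2"
      using a_pos[of 0] c1 by (intro power_mono) (auto simp: R_def)
    then have "a 0 * exp (real j * real q) / c 1 \<le> a 0 * (norm z)\<^sup>2"
      using a_pos[of 0] c1 by (simp add: R_def power_mult_distrib)
    then have "exp (real j * real q) \<le> c 1 * (norm z)\<^sup>2"
      using a_pos[of 0] c1 by (simp add: field_simps)
    then have "exp (real j * real q) \<le> 1 + Kq z" using Kq_ge[of z] by linarith
    then have "real j * real q \<le> ln (1 + Kq z)"
      by (metis exp_gt_zero less_le_trans ln_exp ln_le_cancel_iff)
    then show ?thesis using q0 by (simp add: field_simps)
  qed
  have part3: "\<exists>dstar (c :: nat \<Rightarrow> real) K Kq Dq.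
           1 \<le> dstar \<and> dstar \<le> q - 1 \<and>
           is_direct_sum (weighted_space g q) {1..dstar} hom_poly \<and>
           kernel_data g q Kq Dq \<and>
           (\<forall>d\<in>{1..dstar}. c d > 0) \<and>
           (\<forall>s. K s = (\<Sum>d=1..dstar. c d * s ^ d)) \<and>
           (\<forall>z. Kq z = K ((norm z)\<^sup>2)) \<and>
           smooth (\<lambda>z. ln (1 + Kq z) / real q) \<and>
           strictly_psh (\<lambda>z. ln (1 + Kq z) / real q) \<and>
           exhaustion (\<lambda>z. ln (1 + Kq z) / real q) \<and>
           (\<exists>R :: nat \<Rightarrow> real.
             0 < R 1 \<and> (\<forall>j\<ge>1. R j < R (Suc j)) \<and> filterlim R at_top sequentially \<and>
             (\<forall>j\<ge>1. \<forall>z. R j \<le> gdist g 0 z \<and> gdist g 0 z \<le> R (Suc j) \<longrightarrow>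
               ln (1 + Kq z) / real q \<ge> real j)) \<and>
           (\<exists>C0. \<forall>z. Dq z \<le> C0 * (real q)\<^sup>2 * (1 + Kq z))"
  proof (rule exI[of _ D], rule exI[of _ c], rule exI[of _ K], rule exI[of _ Kq],
      rule exI[of _ "deriv_sum g N s"], intro conjI)
    show "is_direct_sum (weighted_space g q) {1..D} hom_poly"
      unfolding D_def by (rule weighted_space_direct_sum[OF q])
    show "kernel_data g q Kq (deriv_sum g N s)"
      unfolding Kq_def by (rule kernel_data_onb[OF q s])
    show "\<forall>s. K s = (\<Sum>d=1..D. c d * s ^ d)" by (simp add: K_def kpoly_def)
    show "\<forall>z. Kq z = K ((norm z)\<^sup>2)" by (simp add: K_def Kq)
    show "smooth (\<lambda>z. ln (1 + Kq z) / real q)"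
      unfolding Kq by (rule smooth_ln_kpoly[OF D(1) c])
    show "strictly_psh (\<lambda>z. ln (1 + Kq z) / real q)"
      unfolding Kq by (rule strictly_psh_ln_kpoly[OF D(1) c q0])
    show "exhaustion (\<lambda>z. ln (1 + Kq z) / real q)"
      unfolding Kq by (rule exhaustion_ln_kpoly[OF D(1) c q0])
    show "\<exists>R :: nat \<Rightarrow> real.
        0 < R 1 \<and> (\<forall>j\<ge>1. R j < R (Suc j)) \<and> filterlim R at_top sequentially \<and>
        (\<forall>j\<ge>1. \<forall>z. R j \<le> gdist g 0 z \<and> gdist g 0 z \<le> R (Suc j) \<longrightarrow>
          ln (1 + Kq z) / real q \<ge> real j)"
      using R Rlim far a_pos[of 0] c1 by (intro exI[of _ R]) (auto simp: R_def)
    \<comment> \<open>The factor q^2 of the claim is absorbed into the constant.\<close>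
    show "\<exists>C0. \<forall>z. deriv_sum g N s z \<le> C0 * (real q)\<^sup>2 * (1 + Kq z)"
      using C q0 by (intro exI[of _ "C / (real q)\<^sup>2"]) simp
  qed (use D c in auto)
  show ?thesis unfolding Let_def by (rule conjI[OF part1 conjI[OF part2 part3]])
qed

end
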